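(* Let $\Gamma=(V,E)$ be a finite simplicial graph with a vertex-labelling by non-trivial finite groups $G_v$ ($v\in V$), and let $G_\Gamma$ be the corresponding graph product. Decompose $\Gamma$ as a join $\Gamma_1*\Gamma_2$, where $\Gamma_1$ is the full subgraph generated by the vertices which are adjacent to all other vertices of $\Gamma$ (and $\Gamma_2$ is the full subgraph generated by the remaining vertices). Then: (i) $e(G_\Gamma)=0$ if and only if the graph $\Gamma$ is complete. (ii) $e(G_\Gamma)=1$ if and only if $\Gamma$ is connected, not complete and has no complete separating subgraph. (iii) $e(G_\Gamma)=2$ if and only if $\Gamma_2$ is isomorphic to $(\{\mathbb{Z}_2,\mathbb{Z}_2\},\emptyset)$. (iv) $e(G_\Gamma)=\infty$ if and only if $\Gamma$ has a complete separating subgraph $\Delta$ and $\Gamma_2$ is not isomorphic to $(\{\mathbb{Z}_2,\mathbb{Z}_2\},\emptyset)$.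
   Context: A simplicial graph $\Gamma=(V,E)$ consists of a set $V$ of vertices and a set $E$ of 2-element subsets of $V$ (edges). A subgraph $\Gamma'=(V',E')$ is full (or induced) if $E'$ contains all edges $\{v,w\}\in E$ with $v,w\in V'$. A graph is complete if every two distinct vertices are joined by an edge (the empty graph counts as complete). The join $\Gamma_1*\Gamma_2$ is obtained from the disjoint union of $\Gamma_1$ and $\Gamma_2$ by adding all edges between a vertex of $\Gamma_1$ and a vertex of $\Gamma_2$; either of the two graphs may be empty. A subgraph $\Delta=(X,Y)$ of $\Gamma=(V,E)$ is a separating subgraph if the induced subgraph of $\Gamma$ with vertex set $V-X$ has at least two connected components; in particular, if $\Gamma$ is disconnected, then the empty graph is a (complete) separating subgraph. The notation $(\{\mathbb{Z}_2,\mathbb{Z}_2\},\emptyset)$ denotes the vertex-labelled graph with exactly two vertices, no edge, and both vertex groups cyclic of order $2$; "isomorphic" means isomorphic as vertex-labelled graphs, with corresponding vertex groups isomorphic. Graph product: given a finite simplicial graph $\Gamma=(V,E)$ and a non-trivial finitely generated group $G_v$ for each $v\in V$, the graph product $G_\Gamma$ is the quotient of the free product $\ast_{v\in V}G_v$ by the normal closure of all commutators $[g,h]$ with $g\in G_u$, $h\in G_w$, $\{u,w\}\in E$. Number of ends: for a finitely generated group $G$ with finite generating set $S$, $e(G):=\sup\{\#\pi_0^u(\mathrm{Cay}(G,S)-C)\mid C\subseteq \mathrm{Cay}(G,S)\text{ finite subgraph}\}$, where $\mathrm{Cay}(G,S)$ is the Cayley graph of $G$ with respect to $S$ and $\#\pi_0^u(\mathrm{Cay}(G,S)-C)$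 is the number of unbounded connected components of $\mathrm{Cay}(G,S)-C$. This does not depend on $S$. *)

theory Defs
  imports "HOL-Algebra.Elementary_Groups" "HOL-Library.Extended_Nat"
begin

type_synonym 'v graph = "'v set \<times> 'v set set"

abbreviation verts :: "'v graph \<Rightarrow> 'v set" where "verts \<equiv> fst"
abbreviation edges :: "'v graph \<Rightarrow> 'v set set" where "edges \<equiv> snd"

definition simplicial_graph :: "'v graph \<Rightarrow> bool" where
  "simplicial_graph \<Gamma> \<longleftrightarrow> (\<forall>e\<in>edges \<Gamma>. e \<subseteq> verts \<Gamma> \<and> card e = 2)"

definition subgraph :: "'v graph \<Rightarrow> 'v graph \<Rightarrow> bool" where
  "subgraph \<Delta> \<Gamma> \<longleftrightarrow> simplicial_graph \<Delta> \<and> verts \<Delta> \<subseteq> verts \<Gamma> \<and> edges \<Delta> \<subseteq> edges \<Gamma>"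

definition full_subgraph :: "'v graph \<Rightarrow> 'v set \<Rightarrow> 'v graph" where
  "full_subgraph \<Gamma> X = (verts \<Gamma> \<inter> X, {e \<in> edges \<Gamma>. e \<subseteq> X})"

definition complete_graph :: "'v graph \<Rightarrow> bool" where
  "complete_graph \<Gamma> \<longleftrightarrow> (\<forall>u\<in>verts \<Gamma>. \<forall>v\<in>verts \<Gamma>. u \<noteq> v \<longrightarrow> {u, v} \<in> edges \<Gamma>)"

text \<open>The two vertex sets are understood to be disjoint.\<close>

definition graph_join :: "'v graph \<Rightarrow> 'v graph \<Rightarrow> 'v graph" where
  "graph_join \<Gamma>1 \<Gamma>2 =
     (verts \<Gamma>1 \<union> verts \<Gamma>2,
      edges \<Gamma>1 \<union> edges \<Gamma>2 \<union> {{u, v} | u v. u \<in> verts \<Gamma>1 \<and> v \<in> verts \<Gamma>2})"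

definition adj :: "'v graph \<Rightarrow> 'v rel" where
  "adj \<Gamma> = {(u, v). {u, v} \<in> edges \<Gamma>}"

definition components :: "'v graph \<Rightarrow> 'v set set" where
  "components \<Gamma> = verts \<Gamma> // ((adj \<Gamma>)\<^sup>* \<inter> verts \<Gamma> \<times> verts \<Gamma>)"

definition connected_graph :: "'v graph \<Rightarrow> bool" where
  "connected_graph \<Gamma> \<longleftrightarrow> (\<forall>u\<in>verts \<Gamma>. \<forall>v\<in>verts \<Gamma>. (u, v) \<in> (adj \<Gamma>)\<^sup>*)"

text \<open>Deleting a subgraph \<open>\<Delta>\<close> deletes its vertices together with all edges of \<open>\<Gamma>\<close> meeting them.\<close>

definition graph_minus :: "'v graph \<Rightarrow> 'v graph \<Rightarrow> 'v graph" where
  "graph_minus \<Gamma> \<Delta> = full_subgraph \<Gamma> (verts \<Gamma> - verts \<Delta>)"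

definition separating_subgraph :: "'v graph \<Rightarrow> 'v graph \<Rightarrow> bool" where
  "separating_subgraph \<Delta> \<Gamma> \<longleftrightarrow> subgraph \<Delta> \<Gamma> \<and>
     (\<exists>A\<in>components (graph_minus \<Gamma> \<Delta>). \<exists>B\<in>components (graph_minus \<Gamma> \<Delta>). A \<noteq> B)"

text \<open>The path metric; meaningful only for vertices in the same component.\<close>

definition graph_dist :: "'v graph \<Rightarrow> 'v \<Rightarrow> 'v \<Rightarrow> nat" where
  "graph_dist \<Gamma> u v = (LEAST n. (u, v) \<in> adj \<Gamma> ^^ n)"

definition unbounded_in :: "'v graph \<Rightarrow> 'v set \<Rightarrow> bool" where
  "unbounded_in \<Gamma> A \<longleftrightarrow> \<not> (\<exists>n. \<forall>u\<in>A. \<forall>v\<in>A. graph_dist \<Gamma> u v \<le> n)"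

definition labelled_graph_iso ::
    "'v graph \<Rightarrow> ('v \<Rightarrow> ('a, 'b) monoid_scheme) \<Rightarrow> 'w graph \<Rightarrow> ('w \<Rightarrow> ('c, 'd) monoid_scheme) \<Rightarrow> bool" where
  "labelled_graph_iso \<Gamma> G \<Lambda> H \<longleftrightarrow>
     (\<exists>f. bij_betw f (verts \<Gamma>) (verts \<Lambda>) \<and>
          (\<forall>u\<in>verts \<Gamma>. \<forall>v\<in>verts \<Gamma>. {u, v} \<in> edges \<Gamma> \<longleftrightarrow> {f u, f v} \<in> edges \<Lambda>) \<and>
          (\<forall>v\<in>verts \<Gamma>. G v \<cong> H (f v)))"

definition two_points :: "nat graph" where
  "two_points = ({0, 1}, {})"

text \<open>
  The free product of the groups \<open>G v\<close>, \<open>v \<in> V\<close>, is the monoid of words in the letters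
  \<open>(v, g)\<close> with \<open>g \<in> G v\<close> modulo the congruence generated by
  \<open>(v, g)(v, h) = (v, gh)\<close> and by erasing the letters \<open>(v, 1)\<close>.
\<close>

definition fp_words :: "'v set \<Rightarrow> ('v \<Rightarrow> ('a, 'b) monoid_scheme) \<Rightarrow> ('v \<times> 'a) list set" where
  "fp_words V G = lists (SIGMA v:V. carrier (G v))"

definition fp_step :: "'v set \<Rightarrow> ('v \<Rightarrow> ('a, 'b) monoid_scheme) \<Rightarrow> ('v \<times> 'a) list rel" where
  "fp_step V G =
     {(xs @ [(v, g), (v, h)] @ ys, xs @ [(v, g \<otimes>\<^bsub>G v\<^esub> h)] @ ys) | xs ys v g h.
        xs \<in> fp_words V G \<and> ys \<in> fp_words V G \<and> v \<in> V \<and> g \<in> carrier (G v) \<and> h \<in> carrier (G v)} \<union>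
     {(xs @ [(v, \<one>\<^bsub>G v\<^esub>)] @ ys, xs @ ys) | xs ys v.
        xs \<in> fp_words V G \<and> ys \<in> fp_words V G \<and> v \<in> V}"

definition fp_rel :: "'v set \<Rightarrow> ('v \<Rightarrow> ('a, 'b) monoid_scheme) \<Rightarrow> ('v \<times> 'a) list rel" where
  "fp_rel V G = (fp_step V G \<union> (fp_step V G)\<inverse>)\<^sup>* \<inter> fp_words V G \<times> fp_words V G"

definition free_product :: "'v set \<Rightarrow> ('v \<Rightarrow> ('a, 'b) monoid_scheme) \<Rightarrow> ('v \<times> 'a) list set monoid" where
  "free_product V G =
     \<lparr>carrier = fp_words V G // fp_rel V G,
      monoid.mult = (\<lambda>A B. fp_rel V G `` {xs @ ys | xs ys. xs \<in> A \<and> ys \<in> B}),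
      one = fp_rel V G `` {[]}\<rparr>"

definition fp_inj :: "'v set \<Rightarrow> ('v \<Rightarrow> ('a, 'b) monoid_scheme) \<Rightarrow> 'v \<Rightarrow> 'a \<Rightarrow> ('v \<times> 'a) list set" where
  "fp_inj V G v g = fp_rel V G `` {[(v, g)]}"

definition normal_closure :: "('a, 'b) monoid_scheme \<Rightarrow> 'a set \<Rightarrow> 'a set" where
  "normal_closure G A = (\<lambda>N. N \<lhd> G) hull A"

definition commutator :: "('a, 'b) monoid_scheme \<Rightarrow> 'a \<Rightarrow> 'a \<Rightarrow> 'a" where
  "commutator G x y = x \<otimes>\<^bsub>G\<^esub> y \<otimes>\<^bsub>G\<^esub> inv\<^bsub>G\<^esub> x \<otimes>\<^bsub>G\<^esub> inv\<^bsub>G\<^esub> y"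

definition graph_product ::
    "'v graph \<Rightarrow> ('v \<Rightarrow> ('a, 'b) monoid_scheme) \<Rightarrow> ('v \<times> 'a) list set set monoid" where
  "graph_product \<Gamma> G =
     (let F = free_product (verts \<Gamma>) G; \<iota> = fp_inj (verts \<Gamma>) G in
      F Mod normal_closure F
        {commutator F (\<iota> u g) (\<iota> w h) | u w g h.
           {u, w} \<in> edges \<Gamma> \<and> g \<in> carrier (G u) \<and> h \<in> carrier (G w)})"

text \<open>Loops and multiplicities of edges are dropped; they do not affect connectivity.\<close>

definition cayley_graph :: "('a, 'b) monoid_scheme \<Rightarrow> 'a set \<Rightarrow> 'a graph" where
  "cayley_graph G S =
     (carrier G, {{g, g \<otimes>\<^bsub>G\<^esub> s} | g s. g \<in> carrier G \<and> s \<in> S \<and> g \<otimes>\<^bsub>G\<^esub> s \<noteq> g})"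

definition ecard :: "'a set \<Rightarrow> enat" where
  "ecard A = (if finite A then enat (card A) else \<infinity>)"

definition ends_wrt :: "('a, 'b) monoid_scheme \<Rightarrow> 'a set \<Rightarrow> enat" where
  "ends_wrt G S =
     (SUP C\<in>{C. subgraph C (cayley_graph G S) \<and> finite (verts C) \<and> finite (edges C)}.
        ecard {A \<in> components (graph_minus (cayley_graph G S) C).
                 unbounded_in (cayley_graph G S) A})"

definition finite_generating_set :: "('a, 'b) monoid_scheme \<Rightarrow> 'a set \<Rightarrow> bool" where
  "finite_generating_set G S \<longleftrightarrow> finite S \<and> S \<subseteq> carrier G \<and> generate G S = carrier G"

text \<open>
  For a finitely generated group the value does not depend on the generating set; an arbitrary
  one is chosen. Unboundedness is measured in the path metric of the whole Cayley graph.
\<close>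

definition ends :: "('a, 'b) monoid_scheme \<Rightarrow> enat" where
  "ends G = ends_wrt G (SOME S. finite_generating_set G S)"

end

theory Submission
  imports Defs
begin

text \<open>
  Call \<open>A \<subseteq> G\<close> almost invariant if \<open>A\<close> and \<open>A t\<close> differ by finitely many elements for every
  \<open>t \<in> G\<close>. For every finite generating set, the number of ends is the supremum of the numbers of
  pairwise disjoint infinite almost invariant sets.

  If no complete subgraph separates a non-complete \<open>\<Gamma>\<close>, the complement of every ball of the graph
  product is connected: the vertices carrying a last letter of a reduced word span a complete
  subgraph, and removing it leaves a connected graph, which links the ways of leaving a ball. Hence
  almost invariant sets are finite or cofinite.

  If \<open>\<Gamma> - X\<close> falls apart into \<open>P\<close> and \<open>Q\<close> with \<open>X\<close> complete, the elements whose first letter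
  outside \<open>X\<close> lies in \<open>P\<close> form an almost invariant set \<open>H\<^sub>P\<close>, and likewise \<open>H\<^sub>Q\<close>. Let \<open>K\<close> be the
  (finite) subgroup generated by the vertex groups over \<open>X\<close>, and \<open>K\<^sub>P\<close>, \<open>K\<^sub>Q\<close> those over \<open>X \<union> P\<close>,
  \<open>X \<union> Q\<close>. Elements of \<open>K\<^sub>P - K\<close> map \<open>H\<^sub>Q\<close> into \<open>H\<^sub>P\<close>, so ping-pong yields infinitely many disjoint
  translates unless \<open>K\<close> has index \<open>2\<close> in both \<open>K\<^sub>P\<close> and \<open>K\<^sub>Q\<close>. In that exceptional case, up to the
  finite factor \<open>K\<close>, the group consists of two rays of alternating words.
\<close>

subsection \<open>Ends and almost invariant sets\<close>

text \<open>\<open>ends\<close> evaluates an arbitrarily chosen finite generating set, so no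
  convenient Cayley graph can be fixed; almost invariant sets give a description in which the
  generators do not occur. They are tested by right multiplication, as Cayley edges are, and so
  survive left translation; this is what lets ping-pong create new sets. The other obstacle is that
  \<open>graph_product\<close> is a quotient of a quotient of words, where no element is visibly
  nontrivial. In place of a confluence argument, the group acts from the right on states, and only
  the defining relations have to be checked for that action. The index 2 is the threshold of
  ping-pong: if \<open>K\<close> has index at least 3 in \<open>K\<^sub>P\<close>, two elements of
  \<open>K\<^sub>P\<close> in different nontrivial cosets of \<open>K\<close> give disjoint
  translates of \<open>H\<^sub>Q\<close>. With index 2 on both sides, \<open>P\<close> and
  \<open>Q\<close> are single vertices with groups of order 2, adjacent to all of \<open>X\<close>.
  The cases complete, unsplittable, exceptional and split otherwise are exhaustive and exclusive,
  with distinct values of \<open>ends\<close>; computing the four values therefore yields all four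
  equivalences.\<close>

lemma sym_adj: "sym (adj \<Gamma>)"
  by (auto simp: adj_def sym_def insert_commute)

lemma adj_rtrancl_sym: "(x, y) \<in> (adj \<Gamma>)\<^sup>* \<Longrightarrow> (y, x) \<in> (adj \<Gamma>)\<^sup>*"
  using sym_rtrancl[OF sym_adj] by (meson symD)

lemma in_components_iff:
  "A \<in> components \<Gamma> \<longleftrightarrow> (\<exists>x\<in>verts \<Gamma>. A = {y \<in> verts \<Gamma>. (x, y) \<in> (adj \<Gamma>)\<^sup>*})"
  unfolding components_def quotient_def by auto

lemma components_disjnt:
  assumes "A \<in> components \<Gamma>" "B \<in> components \<Gamma>" "A \<noteq> B"
  shows "disjnt A B"
proof (rule ccontr)
  assume "\<not> disjnt A B"
  then obtain z where z: "z \<in> A" "z \<in> B" by (auto simp: disjnt_def)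
  obtain x where x: "A = {y \<in> verts \<Gamma>. (x, y) \<in> (adj \<Gamma>)\<^sup>*}"
    using assms(1) by (auto simp: in_components_iff)
  obtain x' where x': "B = {y \<in> verts \<Gamma>. (x', y) \<in> (adj \<Gamma>)\<^sup>*}"
    using assms(2) by (auto simp: in_components_iff)
  have "(x, x') \<in> (adj \<Gamma>)\<^sup>*" "(x', x) \<in> (adj \<Gamma>)\<^sup>*"
    using z x x' adj_rtrancl_sym[of _ _ \<Gamma>] by (auto intro: rtrancl_trans[of _ z])
  then have "A = B" unfolding x x' by (auto intro: rtrancl_trans)
  then show False using assms(3) by simp
qed

text \<open>Right multiplication is used because the edges of \<open>cayley_graph\<close> join
  \<open>g\<close> and \<open>g s\<close>: for a finite generating set the condition says that only
  finitely many edges lead out of \<open>A\<close>.\<close>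

definition almost_invariant :: "('a, 'b) monoid_scheme \<Rightarrow> 'a set \<Rightarrow> bool" where
  "almost_invariant G A \<longleftrightarrow> A \<subseteq> carrier G \<and>
     (\<forall>t\<in>carrier G. finite {g \<in> carrier G. (g \<in> A) \<noteq> (g \<otimes>\<^bsub>G\<^esub> t \<in> A)})"

text \<open>The defect set of a product \<open>s t\<close> is covered by that of \<open>s\<close>
  and a right translate of that of \<open>t\<close>, and inverses only translate it, so finiteness
  spreads from the generators to the group.\<close>

lemma (in group) almost_invariant_generate:
  assumes gen: "generate G S = carrier G" and S: "S \<subseteq> carrier G" and A: "A \<subseteq> carrier G"
    and fin: "\<And>t. t \<in> S \<Longrightarrow> finite {g \<in> carrier G. (g \<in> A) \<noteq> (g \<otimes> t \<in> A)}"
  shows "almost_invariant G A"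
proof -
  let ?B = "\<lambda>t. {g \<in> carrier G. (g \<in> A) \<noteq> (g \<otimes> t \<in> A)}"
  have "finite (?B t)" if "t \<in> generate G S" for t using that
  proof (induction rule: generate.induct)
    case one
    have "?B \<one> = {}" by auto
    then show ?case by (simp only: finite.emptyI)
  next
    case (incl h)
    then show ?case by (rule fin)
  next
    case (inv h)
    then have h: "h \<in> carrier G" using S by auto
    have "?B (inv h) \<subseteq> (\<lambda>g. g \<otimes> h) ` ?B h"
    proof
      fix g assume g: "g \<in> ?B (inv h)"
      then have "g \<otimes> inv h \<in> ?B h" using h by (auto simp: m_assoc)
      moreover have "g = g \<otimes> inv h \<otimes> h" using g h by (auto simp: m_assoc)
      ultimately show "g \<in> (\<lambda>g. g \<otimes> h) ` ?B h" by blast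
    qed
    then show ?case using fin[OF inv] finite_surj by blast
  next
    case (eng s t)
    then have c: "s \<in> carrier G" "t \<in> carrier G" using gen by auto
    have "?B (s \<otimes> t) \<subseteq> ?B s \<union> (\<lambda>g. g \<otimes> inv s) ` ?B t"
    proof
      fix g assume g: "g \<in> ?B (s \<otimes> t)"
      show "g \<in> ?B s \<union> (\<lambda>g. g \<otimes> inv s) ` ?B t"
      proof (cases "g \<in> ?B s")
        case False
        then have "g \<otimes> s \<in> ?B t" using g c by (auto simp: m_assoc)
        moreover have "g = g \<otimes> s \<otimes> inv s" using g c by (auto simp: m_assoc)
        ultimately show ?thesis by blast
      qed blast
    qed
    then show ?case using eng finite_subset by blast
  qed
  then show ?thesis using gen A by (auto simp: almost_invariant_def)
qed

section \<open>Local finiteness and connectedness of Cayley graphs, and bounds for the number of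
  ends\<close>

locale cayley = group +
  fixes S X
  assumes gen: "finite_generating_set G S"
  defines "X \<equiv> cayley_graph G S"
begin

lemma S: "finite S" "S \<subseteq> carrier G" "generate G S = carrier G"
  using gen by (auto simp: finite_generating_set_def)

lemma adj_iff:
  "(g, h) \<in> adj X \<longleftrightarrow> g \<in> carrier G \<and> h \<in> carrier G \<and> g \<noteq> h \<and> (\<exists>s\<in>S. h = g \<otimes> s \<or> g = h \<otimes> s)"
  using S(2) unfolding adj_def X_def cayley_graph_def
  by (simp add: doubleton_eq_iff subset_iff) (metis m_closed)

lemma verts_X [simp]: "verts X = carrier G"
  by (simp add: X_def cayley_graph_def)

lemma verts_minus [simp]: "verts (graph_minus X C) = carrier G - verts C"
  by (auto simp: graph_minus_def full_subgraph_def)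

lemma adj_minus: "(g, h) \<in> adj (graph_minus X C) \<longleftrightarrow> (g, h) \<in> adj X \<and> g \<notin> verts C \<and> h \<notin> verts C"
  using adj_iff by (auto simp: graph_minus_def full_subgraph_def adj_def)

lemma step_adj: "g \<in> carrier G \<Longrightarrow> s \<in> S \<Longrightarrow> (g, g \<otimes> s) \<in> (adj X)\<^sup>*"
proof (cases "g = g \<otimes> s")
  case False
  assume gs: "g \<in> carrier G" "s \<in> S"
  then have "(g, g \<otimes> s) \<in> adj X" unfolding adj_iff using S(2) False by blast
  then show ?thesis by blast
qed simp

lemma mult_connected:
  assumes "t \<in> carrier G" shows "g \<in> carrier G \<Longrightarrow> (g, g \<otimes> t) \<in> (adj X)\<^sup>*"
proof -
  have "t \<in> generate G S" using assms S by simp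
  then show "g \<in> carrier G \<Longrightarrow> (g, g \<otimes> t) \<in> (adj X)\<^sup>*"
  proof (induction arbitrary: g rule: generate.induct)
    case one
    then show ?case by simp
  next
    case (incl h)
    then show ?case by (simp add: step_adj)
  next
    case (inv h)
    then have h: "h \<in> carrier G" using S by auto
    have "(g \<otimes> inv h, g \<otimes> inv h \<otimes> h) \<in> (adj X)\<^sup>*" using inv h by (intro step_adj) auto
    then show ?case using inv h by (simp add: m_assoc adj_rtrancl_sym)
  next
    case (eng s t)
    then have c: "s \<in> carrier G" "t \<in> carrier G" using S by auto
    show ?case using eng.IH(1)[of g] eng.IH(2)[of "g \<otimes> s"] eng.prems c
      by (simp add: m_assoc)
  qed
qed

lemma connected: "g \<in> carrier G \<Longrightarrow> h \<in> carrier G \<Longrightarrow> (g, h) \<in> (adj X)\<^sup>*"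
  using mult_connected[of "inv g \<otimes> h" g] by (simp add: m_assoc[symmetric])

lemma finite_neighbours: "finite {h. (g, h) \<in> adj X}"
proof -
  have "{h. (g, h) \<in> adj X} \<subseteq> (\<lambda>s. g \<otimes> s) ` S \<union> (\<lambda>s. g \<otimes> inv s) ` S"
  proof
    fix h assume "h \<in> {h. (g, h) \<in> adj X}"
    then obtain s where "s \<in> S" "g \<in> carrier G" "h \<in> carrier G" "h = g \<otimes> s \<or> g = h \<otimes> s"
      by (auto simp: adj_iff)
    moreover have "h = g \<otimes> inv s" if "g = h \<otimes> s"
      using that \<open>s \<in> S\<close> \<open>h \<in> carrier G\<close> S by (auto simp: m_assoc)
    ultimately show "h \<in> (\<lambda>s. g \<otimes> s) ` S \<union> (\<lambda>s. g \<otimes> inv s) ` S" by blast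
  qed
  then show ?thesis using S(1) finite_subset by blast
qed

lemma finite_sphere: "finite {h. (g, h) \<in> adj X ^^ n}"
proof (induction n)
  case (Suc n)
  have "{h. (g, h) \<in> adj X ^^ Suc n} = (\<Union>k\<in>{h. (g, h) \<in> adj X ^^ n}. {h. (k, h) \<in> adj X})"
    by auto
  then show ?case using Suc finite_neighbours by simp
qed simp

text \<open>The Cayley graph is connected and its spheres are finite, so a set bounded in the path
  metric lies in finitely many spheres around one of its points.\<close>

lemma unbounded_iff:
  assumes "A \<subseteq> carrier G" shows "unbounded_in X A \<longleftrightarrow> infinite A"
proof -
  have "infinite A" if "unbounded_in X A"
  proof
    assume fin: "finite A"
    let ?D = "(\<lambda>(u, v). graph_dist X u v) ` (A \<times> A)"
    have "\<forall>u\<in>A. \<forall>v\<in>A. graph_dist X u v \<le> Max ?D"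
      using fin by (auto intro!: Max_ge)
    then show False using that unfolding unbounded_in_def by blast
  qed
  moreover have "finite A" if bd: "\<not> unbounded_in X A"
  proof (cases "A = {}")
    case False
    then obtain u where u: "u \<in> A" by blast
    obtain n where n: "\<forall>u\<in>A. \<forall>v\<in>A. graph_dist X u v \<le> n"
      using bd unfolding unbounded_in_def by blast
    have "A \<subseteq> (\<Union>k\<in>{..n}. {h. (u, h) \<in> adj X ^^ k})"
    proof
      fix v assume v: "v \<in> A"
      have "(u, v) \<in> (adj X)\<^sup>*" using connected u v assms by auto
      then obtain k where "(u, v) \<in> adj X ^^ k" using rtrancl_imp_relpow by blast
      then have "(u, v) \<in> adj X ^^ (graph_dist X u v)"
        unfolding graph_dist_def by (rule LeastI)
      then show "v \<in> (\<Union>k\<in>{..n}. {h. (u, h) \<in> adj X ^^ k})" using n u v by auto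
    qed
    then show ?thesis using finite_sphere by (meson finite_UN finite_atMost finite_subset)
  qed simp
  ultimately show ?thesis by blast
qed

text \<open>Outside \<open>C\<close> the two ends of an edge lie in the same component, so
  membership of \<open>g\<close> and \<open>g t\<close> can differ only if one of them is in the
  finite set \<open>verts C\<close>.\<close>

lemma component_almost_invariant:
  assumes A: "A \<in> components (graph_minus X C)" and C: "finite (verts C)"
  shows "almost_invariant G A"
proof (rule almost_invariant_generate[OF S(3,2)])
  obtain x where x: "x \<in> carrier G - verts C"
    "A = {y \<in> carrier G - verts C. (x, y) \<in> (adj (graph_minus X C))\<^sup>*}"
    using A unfolding in_components_iff by auto
  then show Ac: "A \<subseteq> carrier G" by auto
  fix t assume t: "t \<in> S"
  then have tc: "t \<in> carrier G" using S by auto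
  have "{g \<in> carrier G. (g \<in> A) \<noteq> (g \<otimes> t \<in> A)} \<subseteq> verts C \<union> (\<lambda>h. h \<otimes> inv t) ` verts C"
  proof
    fix g assume g: "g \<in> {g \<in> carrier G. (g \<in> A) \<noteq> (g \<otimes> t \<in> A)}"
    show "g \<in> verts C \<union> (\<lambda>h. h \<otimes> inv t) ` verts C"
    proof (rule ccontr)
      assume n: "g \<notin> verts C \<union> (\<lambda>h. h \<otimes> inv t) ` verts C"
      moreover have "g = g \<otimes> t \<otimes> inv t" using g tc by (simp add: m_assoc)
      ultimately have n2: "g \<otimes> t \<notin> verts C" by blast
      have "g \<noteq> g \<otimes> t" using g by auto
      then have "(g, g \<otimes> t) \<in> adj (graph_minus X C)"
        using n n2 g t tc by (auto simp: adj_minus adj_iff)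
      moreover then have "(g \<otimes> t, g) \<in> adj (graph_minus X C)" using sym_adj symD by metis
      ultimately have "g \<in> A \<longleftrightarrow> g \<otimes> t \<in> A"
        using x n n2 g tc by (auto intro: rtrancl_into_rtrancl)
      then show False using g by auto
    qed
  qed
  then show "finite {g \<in> carrier G. (g \<in> A) \<noteq> (g \<otimes> t \<in> A)}"
    using C by (auto elim!: finite_subset)
qed

text \<open>A path from any vertex to \<open>c\<close> has to enter \<open>C\<close>, and just
  before it does so it is at a neighbour of \<open>C\<close>. Hence every component contains one of
  finitely many neighbours.\<close>

lemma finite_components_minus:
  assumes C: "finite (verts C)" "c \<in> verts C" "verts C \<subseteq> carrier G"
  shows "finite (components (graph_minus X C))"
proof -
  let ?M = "graph_minus X C"
  let ?N = "\<Union>c\<in>verts C. {h. (c, h) \<in> adj X}"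
  have exit: "\<exists>z\<in>?N. z \<notin> verts C \<and> (x, z) \<in> (adj ?M)\<^sup>*"
    if "(x, y) \<in> (adj X)\<^sup>*" "x \<notin> verts C" "y \<in> verts C" for x y
    using that
  proof (induction rule: converse_rtrancl_induct)
    case (step x w)
    show ?case
    proof (cases "w \<in> verts C")
      case True
      have "(w, x) \<in> adj X" using step(1) sym_adj symD by metis
      then show ?thesis using True step by blast
    next
      case False
      then obtain z where z: "z \<in> ?N" "z \<notin> verts C" "(w, z) \<in> (adj ?M)\<^sup>*"
        using step by blast
      have "(x, w) \<in> adj ?M" using False step by (simp add: adj_minus)
      then show ?thesis using z by (meson converse_rtrancl_into_rtrancl)
    qed
  qed simp
  have "components ?M \<subseteq> (\<lambda>z. {y \<in> verts ?M. (z, y) \<in> (adj ?M)\<^sup>*}) ` ?N"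
  proof
    fix A assume "A \<in> components ?M"
    then obtain x where x: "x \<in> verts ?M" "A = {y \<in> verts ?M. (x, y) \<in> (adj ?M)\<^sup>*}"
      unfolding in_components_iff by blast
    have "(x, c) \<in> (adj X)\<^sup>*" using x C connected by auto
    then obtain z where z: "z \<in> ?N" "(x, z) \<in> (adj ?M)\<^sup>*" using exit[of x c] x C by auto
    have "A = {y \<in> verts ?M. (z, y) \<in> (adj ?M)\<^sup>*}"
      unfolding x(2) using z(2) adj_rtrancl_sym[OF z(2)] by (auto intro: rtrancl_trans)
    then show "A \<in> (\<lambda>z. {y \<in> verts ?M. (z, y) \<in> (adj ?M)\<^sup>*}) ` ?N" using z(1) by blast
  qed
  moreover have "finite ?N" using C finite_neighbours by blast
  ultimately show ?thesis using finite_surj by blast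
qed

text \<open>Once all boundary points are deleted, each \<open>A\<close> is a union of components
  apart from its points in \<open>K\<close>. Only finitely many components remain, so an infinite
  \<open>A\<close> contains an infinite one, and disjointness makes this choice injective.\<close>

lemma ends_wrt_ge:
  assumes fin: "finite \<A>" and dis: "pairwise disjnt \<A>"
    and inf: "\<And>A. A \<in> \<A> \<Longrightarrow> infinite A" and ai: "\<And>A. A \<in> \<A> \<Longrightarrow> almost_invariant G A"
  shows "enat (card \<A>) \<le> ends_wrt G S"
proof -
  let ?B = "\<lambda>A s. {g \<in> carrier G. (g \<in> A) \<noteq> (g \<otimes> s \<in> A)}"
  \<comment> \<open>Both ends of every boundary edge are collected; \<open>\<one>\<close> serves as
    the point of \<open>K\<close> that \<open>finite_components_minus\<close> asks for.\<close>
  define K where "K = insert \<one> (\<Union>A\<in>\<A>. \<Union>s\<in>S. ?B A s \<union> (\<lambda>g. g \<otimes> s) ` ?B A s)"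
  define C where "C = (K, {} :: 'a set set)"
  have K: "finite K" "\<one> \<in> K" "K \<subseteq> carrier G"
    using S fin ai by (auto simp: K_def almost_invariant_def)
  have sub: "subgraph C X" using K by (auto simp: subgraph_def C_def simplicial_graph_def)
  let ?M = "graph_minus X C"
  have vM: "verts ?M = carrier G - K" by (simp add: C_def)
  have finM: "finite (components ?M)"
    using K by (intro finite_components_minus[where c=\<one>]) (auto simp: C_def)
  have edge: "g \<in> A \<longleftrightarrow> h \<in> A" if "A \<in> \<A>" and e: "(g, h) \<in> adj ?M" for A g h
  proof -
    obtain s where s: "s \<in> S" "h = g \<otimes> s \<or> g = h \<otimes> s" "g \<in> carrier G" "h \<in> carrier G"
      "g \<notin> K" "h \<notin> K"
      using e by (auto simp: adj_minus adj_iff C_def)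
    have "g \<notin> ?B A s" "h \<notin> ?B A s" using s that by (auto simp: K_def)
    then show ?thesis using s(2-4) by auto
  qed
  have path: "g \<in> A \<longleftrightarrow> h \<in> A" if "A \<in> \<A>" "(g, h) \<in> (adj ?M)\<^sup>*" for A g h
    using that(2) by (induction) (auto simp: edge[OF that(1)])
  have "\<exists>Q\<in>components ?M. infinite Q \<and> Q \<subseteq> A" if A: "A \<in> \<A>" for A
  proof (rule ccontr)
    assume n: "\<not> ?thesis"
    have "A \<subseteq> K \<union> \<Union>{Q \<in> components ?M. Q \<subseteq> A}"
    proof
      fix x assume x: "x \<in> A"
      then have xc: "x \<in> carrier G" using ai[OF A] by (auto simp: almost_invariant_def)
      let ?Q = "{y \<in> verts ?M. (x, y) \<in> (adj ?M)\<^sup>*}"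
      show "x \<in> K \<union> \<Union>{Q \<in> components ?M. Q \<subseteq> A}"
      proof (cases "x \<in> K")
        case False
        then have "?Q \<in> components ?M" using xc vM unfolding in_components_iff by blast
        moreover have "?Q \<subseteq> A" using path[OF A] x by auto
        moreover have "x \<in> ?Q" using xc False vM by auto
        ultimately show ?thesis by blast
      qed simp
    qed
    moreover have "finite (K \<union> \<Union>{Q \<in> components ?M. Q \<subseteq> A})"
      using K finM n by auto
    ultimately show False using inf[OF A] finite_subset by blast
  qed
  then obtain q where q: "\<And>A. A \<in> \<A> \<Longrightarrow> q A \<in> components ?M"
    "\<And>A. A \<in> \<A> \<Longrightarrow> infinite (q A)" "\<And>A. A \<in> \<A> \<Longrightarrow> q A \<subseteq> A" by metis
  have "inj_on q \<A>"
  proof (rule inj_onI, rule ccontr)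
    fix A B assume AB: "A \<in> \<A>" "B \<in> \<A>" "q A = q B" "A \<noteq> B"
    then have "disjnt A B" using dis by (auto simp: pairwise_def)
    then have "q A = {}" using q(3)[of A] q(3)[of B] AB by (auto simp: disjnt_def)
    then show False using q(2)[of A] AB by auto
  qed
  let ?U = "{A \<in> components ?M. unbounded_in X A}"
  have U: "q ` \<A> \<subseteq> ?U"
    using q unbounded_iff finM vM by (fastforce simp: in_components_iff)
  have "card \<A> = card (q ` \<A>)" using \<open>inj_on q \<A>\<close> by (simp add: card_image)
  also have "\<dots> \<le> card ?U" using U finM by (intro card_mono) auto
  finally have "enat (card \<A>) \<le> ecard ?U" using finM by (simp add: ecard_def)
  also have "\<dots> \<le> ends_wrt G S"
    unfolding ends_wrt_def X_def[symmetric] using sub K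
    by (intro SUP_upper) (simp add: C_def)
  finally show ?thesis .
qed

text \<open>The unbounded components are themselves disjoint infinite almost invariant sets.
  Applying the bound to finite subfamilies first excludes the value \<infinity> of
  \<open>ecard\<close>.\<close>

lemma ends_wrt_le:
  assumes "\<And>\<A>. finite \<A> \<Longrightarrow> pairwise disjnt \<A> \<Longrightarrow> (\<And>A. A \<in> \<A> \<Longrightarrow> infinite A) \<Longrightarrow>
      (\<And>A. A \<in> \<A> \<Longrightarrow> almost_invariant G A) \<Longrightarrow> card \<A> \<le> n"
  shows "ends_wrt G S \<le> enat n"
  unfolding ends_wrt_def X_def[symmetric]
proof (rule SUP_least)
  fix C assume C: "C \<in> {C. subgraph C X \<and> finite (verts C) \<and> finite (edges C)}"
  let ?U = "{A \<in> components (graph_minus X C). unbounded_in X A}"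
  have card: "card \<A> \<le> n" if "finite \<A>" "\<A> \<subseteq> ?U" for \<A>
  proof (rule assms[OF that(1)])
    show "pairwise disjnt \<A>"
      using that components_disjnt[of _ "graph_minus X C"] unfolding pairwise_def by blast
    fix A assume A: "A \<in> \<A>"
    then show ai: "almost_invariant G A" using that C component_almost_invariant[of A C] by blast
    show "infinite A" using ai A that unbounded_iff by (auto simp: almost_invariant_def)
  qed
  have "finite ?U"
  proof (rule ccontr)
    assume "infinite ?U"
    then obtain \<A> where "\<A> \<subseteq> ?U" "finite \<A>" "card \<A> = Suc n"
      using infinite_arbitrarily_large by blast
    then show False using card[of \<A>] by auto
  qed
  then show "ecard ?U \<le> enat n" using card[of ?U] by (auto simp: ecard_def)
qed

end

text \<open>One known finite generating set makes the choice in \<open>ends\<close> meaningful; for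
  graph products the witness is \<open>letters\<close>.\<close>

lemma (in group) cayley_some_generating_set:
  assumes "finite_generating_set G S"
  shows "cayley G (SOME S. finite_generating_set G S)"
  using someI[of "finite_generating_set G", OF assms] group_axioms
  by (simp add: cayley_def cayley_axioms_def)

lemma (in group) ends_ge:
  assumes "finite_generating_set G S" "finite \<A>" "pairwise disjnt \<A>"
    and "\<And>A. A \<in> \<A> \<Longrightarrow> infinite A" "\<And>A. A \<in> \<A> \<Longrightarrow> almost_invariant G A"
  shows "enat (card \<A>) \<le> ends G"
  unfolding ends_def by (rule cayley.ends_wrt_ge[OF cayley_some_generating_set]) (use assms in auto)

lemma (in group) ends_le:
  assumes "finite_generating_set G S"
    and "\<And>\<A>. finite \<A> \<Longrightarrow> pairwise disjnt \<A> \<Longrightarrow> (\<And>A. A \<in> \<A> \<Longrightarrow> infinite A) \<Longrightarrow>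
      (\<And>A. A \<in> \<A> \<Longrightarrow> almost_invariant G A) \<Longrightarrow> card \<A> \<le> n"
  shows "ends G \<le> enat n"
  unfolding ends_def
  by (rule cayley.ends_wrt_le[OF cayley_some_generating_set[OF assms(1)]]) (use assms(2) in auto)

subsection \<open>Free products and graph products\<close>

lemma fp_words_simps [simp]:
  "[] \<in> fp_words V G"
  "x # xs \<in> fp_words V G \<longleftrightarrow> fst x \<in> V \<and> snd x \<in> carrier (G (fst x)) \<and> xs \<in> fp_words V G"
  "xs @ ys \<in> fp_words V G \<longleftrightarrow> xs \<in> fp_words V G \<and> ys \<in> fp_words V G"
  by (auto simp: fp_words_def mem_Sigma_iff[of "fst x" "snd x", simplified])

locale group_family =
  fixes V :: "'v set" and G :: "'v \<Rightarrow> ('a, 'b) monoid_scheme"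
  assumes groups: "v \<in> V \<Longrightarrow> group (G v)"
begin

abbreviation "W \<equiv> fp_words V G"
abbreviation "R \<equiv> fp_rel V G"
abbreviation "F \<equiv> free_product V G"

definition cls :: "('v \<times> 'a) list \<Rightarrow> ('v \<times> 'a) list set" where "cls w = R `` {w}"

lemma vertex_closed [simp]:
  assumes "v \<in> V"
  shows "\<one>\<^bsub>G v\<^esub> \<in> carrier (G v)"
    and "a \<in> carrier (G v) \<Longrightarrow> inv\<^bsub>G v\<^esub> a \<in> carrier (G v)"
    and "a \<in> carrier (G v) \<Longrightarrow> b \<in> carrier (G v) \<Longrightarrow> a \<otimes>\<^bsub>G v\<^esub> b \<in> carrier (G v)"
proof -
  interpret group "G v" by (rule groups[OF assms])
  show "\<one>\<^bsub>G v\<^esub> \<in> carrier (G v)" by simp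
  show "a \<in> carrier (G v) \<Longrightarrow> inv\<^bsub>G v\<^esub> a \<in> carrier (G v)" by simp
  show "a \<in> carrier (G v) \<Longrightarrow> b \<in> carrier (G v) \<Longrightarrow> a \<otimes>\<^bsub>G v\<^esub> b \<in> carrier (G v)" by simp
qed

lemma step_words: "(x, y) \<in> fp_step V G \<Longrightarrow> x \<in> W \<and> y \<in> W"
  by (auto simp: fp_step_def)

lemma step_append:
  assumes "(x, y) \<in> fp_step V G" "u \<in> W" "w \<in> W"
  shows "(u @ x @ w, u @ y @ w) \<in> fp_step V G"
  using assms(1) unfolding fp_step_def
proof (elim UnE)
  assume "(x, y) \<in> {(xs @ [(v, g), (v, h)] @ ys, xs @ [(v, g \<otimes>\<^bsub>G v\<^esub> h)] @ ys) | xs ys v g h.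
        xs \<in> W \<and> ys \<in> W \<and> v \<in> V \<and> g \<in> carrier (G v) \<and> h \<in> carrier (G v)}"
  then obtain xs ys v g h where *: "x = xs @ [(v, g), (v, h)] @ ys"
    "y = xs @ [(v, g \<otimes>\<^bsub>G v\<^esub> h)] @ ys" "xs \<in> W" "ys \<in> W" "v \<in> V" "g \<in> carrier (G v)" "h \<in> carrier (G v)"
    by blast
  show "(u @ x @ w, u @ y @ w) \<in> {(xs @ [(v, g), (v, h)] @ ys, xs @ [(v, g \<otimes>\<^bsub>G v\<^esub> h)] @ ys) | xs ys v g h.
        xs \<in> W \<and> ys \<in> W \<and> v \<in> V \<and> g \<in> carrier (G v) \<and> h \<in> carrier (G v)} \<union>
     {(xs @ [(v, \<one>\<^bsub>G v\<^esub>)] @ ys, xs @ ys) | xs ys v. xs \<in> W \<and> ys \<in> W \<and> v \<in> V}"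
    apply (rule UnI1, rule CollectI)
    apply (rule exI[of _ "u @ xs"], rule exI[of _ "ys @ w"], rule exI[of _ v], rule exI[of _ g], rule exI[of _ h])
    using * assms by simp
next
  assume "(x, y) \<in> {(xs @ [(v, \<one>\<^bsub>G v\<^esub>)] @ ys, xs @ ys) | xs ys v. xs \<in> W \<and> ys \<in> W \<and> v \<in> V}"
  then obtain xs ys v where *: "x = xs @ [(v, \<one>\<^bsub>G v\<^esub>)] @ ys" "y = xs @ ys" "xs \<in> W" "ys \<in> W" "v \<in> V"
    by blast
  show "(u @ x @ w, u @ y @ w) \<in> {(xs @ [(v, g), (v, h)] @ ys, xs @ [(v, g \<otimes>\<^bsub>G v\<^esub> h)] @ ys) | xs ys v g h.
        xs \<in> W \<and> ys \<in> W \<and> v \<in> V \<and> g \<in> carrier (G v) \<and> h \<in> carrier (G v)} \<union>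
     {(xs @ [(v, \<one>\<^bsub>G v\<^esub>)] @ ys, xs @ ys) | xs ys v. xs \<in> W \<and> ys \<in> W \<and> v \<in> V}"
    apply (rule UnI2, rule CollectI)
    apply (rule exI[of _ "u @ xs"], rule exI[of _ "ys @ w"], rule exI[of _ v])
    using * assms by simp
qed

lemma R_append:
  assumes "(x, y) \<in> R" "u \<in> W" "w \<in> W"
  shows "(u @ x @ w, u @ y @ w) \<in> R"
proof -
  let ?r = "fp_step V G \<union> (fp_step V G)\<inverse>"
  have "(x, y) \<in> ?r\<^sup>*" using assms by (simp add: fp_rel_def)
  then have "(u @ x @ w, u @ y @ w) \<in> ?r\<^sup>*"
  proof induction
    case (step y z)
    have "(u @ y @ w, u @ z @ w) \<in> ?r" using step(2) step_append assms by blast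
    then show ?case using step(3) by (rule rtrancl_into_rtrancl[rotated])
  qed simp
  then show ?thesis using assms by (simp add: fp_rel_def)
qed

lemma equiv_R: "equiv W R"
proof (rule equivI)
  have "sym ((fp_step V G \<union> (fp_step V G)\<inverse>)\<^sup>*)"
    by (intro sym_rtrancl sym_Un_converse)
  then show "sym R" unfolding fp_rel_def by (auto simp: sym_def)
  show "trans R" unfolding fp_rel_def trans_def by (blast intro: rtrancl_trans)
qed (auto simp: fp_rel_def refl_on_def)

lemma R_trans: "(x, y) \<in> R \<Longrightarrow> (y, z) \<in> R \<Longrightarrow> (x, z) \<in> R"
  using equiv_R by (meson equivE transE)

lemma cls_eq_iff: "x \<in> W \<Longrightarrow> y \<in> W \<Longrightarrow> cls x = cls y \<longleftrightarrow> (x, y) \<in> R"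
  unfolding cls_def by (rule eq_equiv_class_iff[OF equiv_R])

lemma carrier_F: "carrier F = cls ` W"
  by (auto simp: free_product_def quotient_def cls_def)

lemma one_F: "\<one>\<^bsub>F\<^esub> = cls []"
  by (simp add: free_product_def cls_def)

lemma mult_F:
  assumes "x \<in> W" "y \<in> W" shows "cls x \<otimes>\<^bsub>F\<^esub> cls y = cls (x @ y)"
proof -
  have "(x @ y, x' @ y') \<in> R" if "(x, x') \<in> R" "(y, y') \<in> R" for x' y'
  proof -
    have "x' \<in> W" "y' \<in> W" using that by (auto simp: fp_rel_def)
    then show ?thesis
      using R_append[OF that(1), of "[]" y] R_append[OF that(2), of x' "[]"] assms R_trans by simp
  qed
  then have "R `` {xs @ ys | xs ys. xs \<in> cls x \<and> ys \<in> cls y} \<subseteq> cls (x @ y)"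
    unfolding cls_def using R_trans by blast
  moreover have "x \<in> cls x" "y \<in> cls y"
    unfolding cls_def using equiv_class_self[OF equiv_R] assms by auto
  then have "cls (x @ y) \<subseteq> R `` {xs @ ys | xs ys. xs \<in> cls x \<and> ys \<in> cls y}"
    unfolding cls_def by blast
  ultimately show ?thesis by (simp add: free_product_def)
qed

lemma cls_step: "(x, y) \<in> fp_step V G \<Longrightarrow> cls x = cls y"
  using step_words[of x y] by (subst cls_eq_iff) (auto simp: fp_rel_def)

lemma cls_mult:
  assumes "v \<in> V" "g \<in> carrier (G v)" "h \<in> carrier (G v)"
  shows "cls [(v, g), (v, h)] = cls [(v, g \<otimes>\<^bsub>G v\<^esub> h)]"
proof (rule cls_step)
  show "([(v, g), (v, h)], [(v, g \<otimes>\<^bsub>G v\<^esub> h)]) \<in> fp_step V G"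
    unfolding fp_step_def using assms by (intro UnI1 CollectI exI[of _ "[]"]) auto
qed

lemma cls_one:
  assumes "v \<in> V" shows "cls [(v, \<one>\<^bsub>G v\<^esub>)] = cls []"
proof (rule cls_step)
  show "([(v, \<one>\<^bsub>G v\<^esub>)], []) \<in> fp_step V G"
    unfolding fp_step_def using assms by (intro UnI2 CollectI exI[of _ "[]"]) auto
qed

definition winv :: "('v \<times> 'a) list \<Rightarrow> ('v \<times> 'a) list" where
  "winv w = rev (map (\<lambda>(v, g). (v, inv\<^bsub>G v\<^esub> g)) w)"

lemma winv_Cons: "winv ((v, g) # w) = winv w @ [(v, inv\<^bsub>G v\<^esub> g)]"
  by (simp add: winv_def)

lemma winv_words: "w \<in> W \<Longrightarrow> winv w \<in> W"
proof (induction w)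
  case (Cons x w)
  then show ?case using groups by (cases x) (auto simp: winv_Cons group.inv_closed)
qed (simp add: winv_def)

lemma cls_append_cong:
  "x \<in> W \<Longrightarrow> x' \<in> W \<Longrightarrow> u \<in> W \<Longrightarrow> w \<in> W \<Longrightarrow> cls x = cls x' \<Longrightarrow> cls (u @ x @ w) = cls (u @ x' @ w)"
  by (simp add: cls_eq_iff R_append)

text \<open>Cancellation starts in the middle, where the first letter of the word meets its own
  inverse.\<close>

lemma cls_winv: "w \<in> W \<Longrightarrow> cls (winv w @ w) = cls []"
proof (induction w)
  case Nil
  then show ?case by (simp add: winv_def)
next
  case (Cons x w)
  obtain v g where x: "x = (v, g)" by fastforce
  then have v: "v \<in> V" "g \<in> carrier (G v)" "inv\<^bsub>G v\<^esub> g \<in> carrier (G v)" "w \<in> W"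
    using Cons groups by (auto intro: group.inv_closed)
  have e: "cls [(v, inv\<^bsub>G v\<^esub> g), (v, g)] = cls []"
    using v groups by (simp add: cls_mult cls_one group.l_inv)
  have "cls (winv w @ [(v, inv\<^bsub>G v\<^esub> g), (v, g)] @ w) = cls (winv w @ [] @ w)"
    by (rule cls_append_cong) (use v winv_words e in auto)
  then show ?case using Cons v x by (simp add: winv_Cons)
qed

lemma group_F: "group F"
proof (rule groupI)
  fix x y z assume "x \<in> carrier F" "y \<in> carrier F" "z \<in> carrier F"
  then show "x \<otimes>\<^bsub>F\<^esub> y \<otimes>\<^bsub>F\<^esub> z = x \<otimes>\<^bsub>F\<^esub> (y \<otimes>\<^bsub>F\<^esub> z)"
    by (auto simp: carrier_F mult_F)
next
  fix x assume "x \<in> carrier F"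
  then obtain w where "w \<in> W" "x = cls w" by (auto simp: carrier_F)
  then show "\<exists>y\<in>carrier F. y \<otimes>\<^bsub>F\<^esub> x = \<one>\<^bsub>F\<^esub>"
    by (intro bexI[of _ "cls (winv w)"]) (simp_all add: carrier_F mult_F one_F winv_words cls_winv)
qed (auto simp: carrier_F mult_F one_F)

lemma inv_F: "w \<in> W \<Longrightarrow> inv\<^bsub>F\<^esub> (cls w) = cls (winv w)"
  by (rule group.inv_equality[OF group_F])
    (auto simp: mult_F winv_words cls_winv one_F carrier_F)

end

lemma (in group) normal_Inter:
  assumes "\<And>N. N \<in> \<N> \<Longrightarrow> N \<lhd> G" "\<N> \<noteq> {}"
  shows "\<Inter>\<N> \<lhd> G"
  using assms subgroups_Inter[of \<N>] unfolding normal_inv_iff by blast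

lemma (in group) normal_normal_closure:
  assumes "A \<subseteq> carrier G" shows "normal_closure G A \<lhd> G"
proof -
  have "carrier G \<lhd> G" using subgroup_self by (simp add: normal_inv_iff)
  then show ?thesis unfolding normal_closure_def hull_def
    using assms by (intro normal_Inter) auto
qed

section \<open>The graph product as a quotient of the free product, and its letters\<close>

locale graph_of_groups = group_family "verts \<Gamma>" G
  for \<Gamma> :: "'v graph" and G :: "'v \<Rightarrow> ('a, 'b) monoid_scheme" +
  assumes simplicial: "simplicial_graph \<Gamma>"
begin

abbreviation "V \<equiv> verts \<Gamma>"
abbreviation "E \<equiv> edges \<Gamma>"

lemma edge_verts: "{u, w} \<in> E \<Longrightarrow> u \<in> V \<and> w \<in> V \<and> u \<noteq> w"
  using simplicial by (auto simp: simplicial_graph_def)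

definition "Com = {commutator F (fp_inj V G u g) (fp_inj V G w h) | u w g h.
           {u, w} \<in> E \<and> g \<in> carrier (G u) \<and> h \<in> carrier (G w)}"
definition "N = normal_closure F Com"
definition "GP = graph_product \<Gamma> G"

lemma GP_eq: "GP = F Mod N"
  by (simp add: GP_def graph_product_def N_def Com_def Let_def)

lemma commutator_cls:
  assumes "{u, w} \<in> E" "g \<in> carrier (G u)" "h \<in> carrier (G w)"
  shows "commutator F (fp_inj V G u g) (fp_inj V G w h) =
    cls [(u, g), (w, h), (u, inv\<^bsub>G u\<^esub> g), (w, inv\<^bsub>G w\<^esub> h)]"
proof -
  have "u \<in> V" "w \<in> V" using assms edge_verts by auto
  then have "inv\<^bsub>F\<^esub> (cls [(u, g)]) = cls [(u, inv\<^bsub>G u\<^esub> g)]" "inv\<^bsub>F\<^esub> (cls [(w, h)]) = cls [(w, inv\<^bsub>G w\<^esub> h)]"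
    "inv\<^bsub>G u\<^esub> g \<in> carrier (G u)" "inv\<^bsub>G w\<^esub> h \<in> carrier (G w)"
    using assms groups by (auto simp: inv_F winv_def group.inv_closed)
  then show ?thesis using assms \<open>u \<in> V\<close> \<open>w \<in> V\<close>
    by (simp add: commutator_def fp_inj_def cls_def[symmetric] mult_F)
qed

lemma Com_subset: "Com \<subseteq> carrier F"
proof
  fix x assume "x \<in> Com"
  then obtain u w g h where *: "{u, w} \<in> E" "g \<in> carrier (G u)" "h \<in> carrier (G w)"
    "x = cls [(u, g), (w, h), (u, inv\<^bsub>G u\<^esub> g), (w, inv\<^bsub>G w\<^esub> h)]"
    using commutator_cls unfolding Com_def by blast
  then show "x \<in> carrier F" using edge_verts[OF *(1)] groups
    by (auto simp: carrier_F group.inv_closed intro!: imageI)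
qed

lemma normal_N: "N \<lhd> F"
  unfolding N_def by (rule group.normal_normal_closure[OF group_F Com_subset])

sublocale GP: group GP
  unfolding GP_eq by (rule normal.factorgroup_is_group[OF normal_N])

definition el :: "('v \<times> 'a) list \<Rightarrow> ('v \<times> 'a) list set set" where
  "el w = N #>\<^bsub>F\<^esub> cls w"

lemma carrier_GP: "carrier GP = el ` W"
  by (auto simp: GP_eq FactGroup_def RCOSETS_def carrier_F el_def)

lemma one_GP: "\<one>\<^bsub>GP\<^esub> = el []"
  using group.coset_mult_one[OF group_F, of N] normal_imp_subgroup[OF normal_N]
  by (simp add: GP_eq FactGroup_def el_def one_F[symmetric] subgroup.subset)

lemma mult_GP: "x \<in> W \<Longrightarrow> y \<in> W \<Longrightarrow> el x \<otimes>\<^bsub>GP\<^esub> el y = el (x @ y)"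
  by (simp add: GP_eq FactGroup_def el_def normal.rcos_sum[OF normal_N] carrier_F mult_F)

lemma el_eq_iff:
  assumes "x \<in> W" "y \<in> W"
  shows "el x = el y \<longleftrightarrow> cls (x @ winv y) \<in> N"
proof -
  interpret F: group F by (rule group_F)
  have N: "subgroup N F" by (rule normal_imp_subgroup[OF normal_N])
  have c: "cls x \<in> carrier F" "cls y \<in> carrier F" using assms by (auto simp: carrier_F)
  have i: "cls (x @ winv y) = cls x \<otimes>\<^bsub>F\<^esub> inv\<^bsub>F\<^esub> (cls y)"
    using assms by (simp add: inv_F mult_F winv_words)
  show ?thesis
  proof
    assume "el x = el y"
    then have "cls x \<in> N #>\<^bsub>F\<^esub> cls y"
      using F.rcos_self[OF c(1) N] by (simp add: el_def)
    then show "cls (x @ winv y) \<in> N" unfolding i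
      using c N by (auto simp: r_coset_def F.m_assoc subgroup.mem_carrier)
  next
    assume "cls (x @ winv y) \<in> N"
    then have "cls x \<in> N #>\<^bsub>F\<^esub> cls y" unfolding i r_coset_def
      using c by (auto simp: F.m_assoc intro!: bexI[of _ "cls x \<otimes>\<^bsub>F\<^esub> inv\<^bsub>F\<^esub> (cls y)"])
    then show "el x = el y" unfolding el_def using F.repr_independence[OF _ c(2) N] by simp
  qed
qed

definition letter :: "'v \<Rightarrow> 'a \<Rightarrow> ('v \<times> 'a) list set set" where
  "letter v a = el [(v, a)]"

lemma letter_closed [simp]: "v \<in> V \<Longrightarrow> a \<in> carrier (G v) \<Longrightarrow> letter v a \<in> carrier GP"
  by (auto simp: letter_def carrier_GP)

lemma letter_mult:
  "v \<in> V \<Longrightarrow> a \<in> carrier (G v) \<Longrightarrow> b \<in> carrier (G v) \<Longrightarrow>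
    letter v a \<otimes>\<^bsub>GP\<^esub> letter v b = letter v (a \<otimes>\<^bsub>G v\<^esub> b)"
  by (simp add: letter_def mult_GP) (simp add: el_def cls_mult)

lemma letter_one: "v \<in> V \<Longrightarrow> letter v \<one>\<^bsub>G v\<^esub> = \<one>\<^bsub>GP\<^esub>"
  by (simp add: letter_def one_GP el_def cls_one)

lemma letter_inv:
  assumes "v \<in> V" "a \<in> carrier (G v)"
  shows "inv\<^bsub>GP\<^esub> (letter v a) = letter v (inv\<^bsub>G v\<^esub> a)"
  using assms groups
  by (intro GP.inv_equality) (auto simp: letter_mult letter_one group.l_inv group.inv_closed)

lemma letter_commute:
  assumes "{u, w} \<in> E" "g \<in> carrier (G u)" "h \<in> carrier (G w)"
  shows "letter u g \<otimes>\<^bsub>GP\<^esub> letter w h = letter w h \<otimes>\<^bsub>GP\<^esub> letter u g"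
proof -
  have uw: "u \<in> V" "w \<in> V" using assms edge_verts by auto
  have x: "commutator F (fp_inj V G u g) (fp_inj V G w h) \<in> N"
    unfolding N_def normal_closure_def by (rule hull_inc) (use assms in \<open>auto simp: Com_def\<close>)
  have "[(u, g), (w, h)] \<in> W" "[(w, h), (u, g)] \<in> W" using assms uw by auto
  then have "el [(u, g), (w, h)] = el [(w, h), (u, g)]"
    using x commutator_cls[OF assms] by (simp add: el_eq_iff winv_def)
  then show ?thesis using assms uw by (simp add: letter_def mult_GP)
qed

lemma GP_induct [consumes 1, case_names one mult]:
  assumes "x \<in> carrier GP" and "P \<one>\<^bsub>GP\<^esub>"
    and step: "\<And>g v a. g \<in> carrier GP \<Longrightarrow> P g \<Longrightarrow> v \<in> V \<Longrightarrow> a \<in> carrier (G v) \<Longrightarrow> P (g \<otimes>\<^bsub>GP\<^esub> letter v a)"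
  shows "P x"
proof -
  have "P (el w)" if "w \<in> W" for w using that
  proof (induction w rule: rev_induct)
    case Nil
    then show ?case using assms(2) by (simp add: one_GP)
  next
    case (snoc x w)
    then have "P (el w \<otimes>\<^bsub>GP\<^esub> letter (fst x) (snd x))"
      by (intro step) (auto simp: carrier_GP)
    then show ?case using snoc by (simp add: letter_def mult_GP)
  qed
  then show ?thesis using assms(1) by (auto simp: carrier_GP)
qed

text \<open>The universal property of the graph product, applied to permutations of \<open>\<Sigma>\<close>.\<close>

lemma GP_action:
  assumes \<epsilon>: "\<epsilon> \<in> \<Sigma>"
    and closed: "\<And>v a \<sigma>. v \<in> V \<Longrightarrow> a \<in> carrier (G v) \<Longrightarrow> \<sigma> \<in> \<Sigma> \<Longrightarrow> act v a \<sigma> \<in> \<Sigma>"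
    and one: "\<And>v \<sigma>. v \<in> V \<Longrightarrow> \<sigma> \<in> \<Sigma> \<Longrightarrow> act v \<one>\<^bsub>G v\<^esub> \<sigma> = \<sigma>"
    and mult: "\<And>v a b \<sigma>. v \<in> V \<Longrightarrow> a \<in> carrier (G v) \<Longrightarrow> b \<in> carrier (G v) \<Longrightarrow> \<sigma> \<in> \<Sigma> \<Longrightarrow>
       act v b (act v a \<sigma>) = act v (a \<otimes>\<^bsub>G v\<^esub> b) \<sigma>"
    and comm: "\<And>u v a b \<sigma>. {u, v} \<in> E \<Longrightarrow> a \<in> carrier (G u) \<Longrightarrow> b \<in> carrier (G v) \<Longrightarrow> \<sigma> \<in> \<Sigma> \<Longrightarrow>
       act v b (act u a \<sigma>) = act u a (act v b \<sigma>)"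
  shows "\<exists>st. (\<forall>g\<in>carrier GP. st g \<in> \<Sigma>) \<and> st \<one>\<^bsub>GP\<^esub> = \<epsilon> \<and>
    (\<forall>g\<in>carrier GP. \<forall>v\<in>V. \<forall>a\<in>carrier (G v). st (g \<otimes>\<^bsub>GP\<^esub> letter v a) = act v a (st g))"
proof -
  \<comment> \<open>Letters act from left to right, so concatenation of words becomes a right
    action.\<close>
  define run where "run w \<sigma> = foldl (\<lambda>\<sigma> (v, a). act v a \<sigma>) \<sigma> w" for w \<sigma>
  have run_simps: "run [] \<sigma> = \<sigma>" "run ((v, a) # w) \<sigma> = run w (act v a \<sigma>)"
    "run (x @ y) \<sigma> = run y (run x \<sigma>)" for \<sigma> v a w x y
    by (simp_all add: run_def)
  have run_closed: "w \<in> W \<Longrightarrow> \<sigma> \<in> \<Sigma> \<Longrightarrow> run w \<sigma> \<in> \<Sigma>" for w \<sigma>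
    by (induction w arbitrary: \<sigma>) (auto simp: run_simps closed)
  have run_step: "run x \<sigma> = run y \<sigma>" if "(x, y) \<in> fp_step V G" "\<sigma> \<in> \<Sigma>" for x y \<sigma>
    using that unfolding fp_step_def by (auto simp: run_simps mult one run_closed)
  have rel: "run x \<sigma> = run y \<sigma>" if "(x, y) \<in> R" "\<sigma> \<in> \<Sigma>" for x y \<sigma>
  proof -
    have "(x, y) \<in> (fp_step V G \<union> (fp_step V G)\<inverse>)\<^sup>*" using that by (simp add: fp_rel_def)
    then show ?thesis
    proof induction
      case (step y z)
      then show ?case using run_step[OF _ that(2)] by auto
    qed simp
  qed
  have run_cls: "run x \<sigma> = run y \<sigma>" if "cls x = cls y" "x \<in> W" "y \<in> W" "\<sigma> \<in> \<Sigma>" for x y \<sigma>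
    using that cls_eq_iff rel by auto
  have run_winv: "run w (run (winv w) \<sigma>) = \<sigma>" "run (winv w) (run w \<sigma>) = \<sigma>"
    if "w \<in> W" "\<sigma> \<in> \<Sigma>" for w \<sigma>
  proof -
    have *: "run w (run (winv w) \<sigma>) = \<sigma>" if "w \<in> W" "\<sigma> \<in> \<Sigma>" for w \<sigma>
      using run_cls[OF cls_winv, of w \<sigma>] that winv_words[of w] by (simp add: run_simps)
    then show "run w (run (winv w) \<sigma>) = \<sigma>" using that .
    have "winv (winv w) = w" using \<open>w \<in> W\<close>
      using groups by (induction w) (auto simp: winv_def group.inv_inv)
    then show "run (winv w) (run w \<sigma>) = \<sigma>" using *[of "winv w" \<sigma>] that winv_words by simp
  qed
  \<comment> \<open>\<open>K\<close> is the kernel of the action of the free product on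
    \<open>\<Sigma>\<close>. It is normal and contains \<open>Com\<close>, hence contains the hull
    \<open>N\<close>; this makes \<open>run\<close> well defined on cosets of
    \<open>N\<close>.\<close>
  define K where "K = {cls w | w. w \<in> W \<and> (\<forall>\<sigma>\<in>\<Sigma>. run w \<sigma> = \<sigma>)}"
  interpret F: group F by (rule group_F)
  have "K \<lhd> F" unfolding F.normal_inv_iff
  proof (intro conjI ballI F.subgroupI)
    show "K \<subseteq> carrier F" by (auto simp: K_def carrier_F)
    show "K \<noteq> {}" by (auto simp: K_def run_simps intro!: exI[of _ "[]"])
  next
    fix a assume "a \<in> K"
    then obtain w where w: "a = cls w" "w \<in> W" "\<forall>\<sigma>\<in>\<Sigma>. run w \<sigma> = \<sigma>" by (auto simp: K_def)
    have "\<forall>\<sigma>\<in>\<Sigma>. run (winv w) \<sigma> = \<sigma>" using run_winv[OF w(2)] w(3) by metis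
    then show "inv\<^bsub>F\<^esub> a \<in> K" using w winv_words by (auto simp: K_def inv_F)
    fix x assume "x \<in> carrier F"
    then obtain z where z: "x = cls z" "z \<in> W" by (auto simp: carrier_F)
    have "run (z @ w @ winv z) \<sigma> = \<sigma>" if "\<sigma> \<in> \<Sigma>" for \<sigma>
      using that run_closed z w run_winv by (simp add: run_simps)
    then show "x \<otimes>\<^bsub>F\<^esub> a \<otimes>\<^bsub>F\<^esub> inv\<^bsub>F\<^esub> x \<in> K"
      using z w winv_words by (auto simp: K_def mult_F inv_F intro!: exI[of _ "z @ w @ winv z"])
  next
    fix a b assume "a \<in> K" "b \<in> K"
    then obtain w z where w: "a = cls w" "w \<in> W" "\<forall>\<sigma>\<in>\<Sigma>. run w \<sigma> = \<sigma>"
      "b = cls z" "z \<in> W" "\<forall>\<sigma>\<in>\<Sigma>. run z \<sigma> = \<sigma>" by (auto simp: K_def)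
    then show "a \<otimes>\<^bsub>F\<^esub> b \<in> K"
      by (auto simp: K_def mult_F run_simps intro!: exI[of _ "w @ z"])
  qed
  moreover have "Com \<subseteq> K"
  proof
    fix x assume "x \<in> Com"
    then obtain u w g h where *: "{u, w} \<in> E" "g \<in> carrier (G u)" "h \<in> carrier (G w)"
      "x = cls [(u, g), (w, h), (u, inv\<^bsub>G u\<^esub> g), (w, inv\<^bsub>G w\<^esub> h)]"
      using commutator_cls unfolding Com_def by blast
    have uw: "u \<in> V" "w \<in> V" using edge_verts[OF *(1)] by auto
    then have inv: "inv\<^bsub>G u\<^esub> g \<in> carrier (G u)" "inv\<^bsub>G w\<^esub> h \<in> carrier (G w)"
      using * groups by (auto simp: group.inv_closed)
    have "run [(u, g), (w, h), (u, inv\<^bsub>G u\<^esub> g), (w, inv\<^bsub>G w\<^esub> h)] \<sigma> = \<sigma>" if \<sigma>: "\<sigma> \<in> \<Sigma>" for \<sigma>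
    proof -
      have "act u (inv\<^bsub>G u\<^esub> g) (act w h (act u g \<sigma>)) = act w h (act u (inv\<^bsub>G u\<^esub> g) (act u g \<sigma>))"
        using comm[OF *(1) inv(1) *(3)] closed * uw \<sigma> by simp
      also have "\<dots> = act w h \<sigma>"
        using mult[OF uw(1) *(2) inv(1) \<sigma>] one[OF uw(1) \<sigma>] groups uw * by (simp add: group.r_inv)
      finally show ?thesis
        using mult[OF uw(2) *(3) inv(2) \<sigma>] one[OF uw(2) \<sigma>] groups uw *
        by (simp add: run_simps group.r_inv)
    qed
    then show "x \<in> K" using * uw inv by (auto simp: K_def)
  qed
  ultimately have NK: "N \<subseteq> K"
    unfolding N_def normal_closure_def by (intro hull_minimal)
  have el_run: "run x \<sigma> = run y \<sigma>" if "el x = el y" "x \<in> W" "y \<in> W" "\<sigma> \<in> \<Sigma>" for x y \<sigma>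
  proof -
    have "cls (x @ winv y) \<in> K" using that el_eq_iff NK by auto
    then obtain k where k: "cls (x @ winv y) = cls k" "k \<in> W" "\<forall>\<sigma>\<in>\<Sigma>. run k \<sigma> = \<sigma>"
      by (auto simp: K_def)
    have "run (winv y) (run x \<sigma>) = \<sigma>"
      using run_cls[OF k(1)] k that winv_words by (simp add: run_simps)
    then show ?thesis using run_winv(1)[of y "run x \<sigma>"] that run_closed by simp
  qed
  define st where "st g = run (SOME w. w \<in> W \<and> el w = g) \<epsilon>" for g
  have st_el: "st (el w) = run w \<epsilon>" if "w \<in> W" for w
  proof -
    have "(SOME x. x \<in> W \<and> el x = el w) \<in> W \<and> el (SOME x. x \<in> W \<and> el x = el w) = el w"
      by (rule someI[of "\<lambda>x. x \<in> W \<and> el x = el w" w]) (simp add: that)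
    then show ?thesis unfolding st_def using el_run that \<epsilon> by blast
  qed
  show ?thesis
  proof (intro exI[of _ st] conjI ballI)
    show "st g \<in> \<Sigma>" if "g \<in> carrier GP" for g
      using that \<epsilon> by (auto simp: carrier_GP st_el run_closed)
    show "st \<one>\<^bsub>GP\<^esub> = \<epsilon>" by (simp add: one_GP st_el run_simps)
    show "st (g \<otimes>\<^bsub>GP\<^esub> letter v a) = act v a (st g)"
      if "g \<in> carrier GP" "v \<in> V" "a \<in> carrier (G v)" for g v a
      using that by (auto simp: carrier_GP letter_def mult_GP st_el run_simps)
  qed
qed

end

subsection \<open>Normal forms\<close>

text \<open>
  A reduced word is recorded by its projections to the pairs \<open>u, w\<close> of non-adjacent
  (possibly equal) vertices, which do not see the order of commuting letters. The projections are
  stored in reverse, so that the head is the last letter. \<open>final \<sigma>\<close> is the set of vertices that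
  carry the last letter of some reduced word with projections \<open>\<sigma>\<close>.
\<close>

type_synonym ('v, 'a) state = "'v \<Rightarrow> 'v \<Rightarrow> ('v \<times> 'a) list"

context graph_of_groups
begin

definition nonadj :: "'v \<Rightarrow> 'v \<Rightarrow> bool" where
  "nonadj u w \<longleftrightarrow> u \<in> V \<and> w \<in> V \<and> {u, w} \<notin> E"

definition push :: "'v \<Rightarrow> 'a \<Rightarrow> ('v, 'a) state \<Rightarrow> ('v, 'a) state" where
  "push v a \<sigma> = (\<lambda>u w. if (u = v \<or> w = v) \<and> nonadj u w then (v, a) # \<sigma> u w else \<sigma> u w)"

definition pop :: "'v \<Rightarrow> ('v, 'a) state \<Rightarrow> ('v, 'a) state" where
  "pop v \<sigma> = (\<lambda>u w. if (u = v \<or> w = v) \<and> nonadj u w then tl (\<sigma> u w) else \<sigma> u w)"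

definition final :: "('v, 'a) state \<Rightarrow> 'v set" where
  "final \<sigma> = {v \<in> V. \<forall>w. nonadj v w \<longrightarrow> \<sigma> v w \<noteq> [] \<and> fst (hd (\<sigma> v w)) = v}"

definition units :: "'v \<Rightarrow> 'a set" where
  "units v = carrier (G v) - {\<one>\<^bsub>G v\<^esub>}"

text \<open>Only reduced words are recorded: \<open>v \<notin> final \<sigma>\<close> forbids
  appending a letter that could merge with an earlier one.\<close>

inductive_set states :: "('v, 'a) state set" where
  empty: "(\<lambda>_ _. []) \<in> states"
| push: "\<sigma> \<in> states \<Longrightarrow> v \<in> V \<Longrightarrow> v \<notin> final \<sigma> \<Longrightarrow> a \<in> units v \<Longrightarrow> push v a \<sigma> \<in> states"

text \<open>Right multiplication of a reduced word by \<open>(v, b)\<close>. If some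
  \<open>v\<close>-letter can be moved to the end, it is the head of \<open>\<sigma> v v\<close> and
  is cancelled or merged; otherwise the new letter is appended.\<close>

definition act :: "'v \<Rightarrow> 'a \<Rightarrow> ('v, 'a) state \<Rightarrow> ('v, 'a) state" where
  "act v b \<sigma> =
     (if b = \<one>\<^bsub>G v\<^esub> then \<sigma>
      else if v \<notin> final \<sigma> then push v b \<sigma>
      else if snd (hd (\<sigma> v v)) \<otimes>\<^bsub>G v\<^esub> b = \<one>\<^bsub>G v\<^esub> then pop v \<sigma>
      else push v (snd (hd (\<sigma> v v)) \<otimes>\<^bsub>G v\<^esub> b) (pop v \<sigma>))"

lemma nonadj_refl [simp]: "nonadj v v \<longleftrightarrow> v \<in> V"
  using edge_verts[of v v] by (auto simp: nonadj_def)

lemma nonadj_sym: "nonadj u w \<longleftrightarrow> nonadj w u"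
  by (auto simp: nonadj_def insert_commute)

lemma pop_push [simp]: "pop v (push v a \<sigma>) = \<sigma>"
  by (auto simp: pop_def push_def fun_eq_iff)

text \<open>An earlier letter can still reach the end only if it commutes past the new one: a
  non-adjacent vertex shares with \<open>v\<close> a projection whose head is now at
  \<open>v\<close>.\<close>

lemma final_push:
  assumes "v \<in> V"
  shows "final (push v a \<sigma>) = insert v {w \<in> final \<sigma>. {w, v} \<in> E}"
proof (rule Set.set_eqI)
  fix w
  consider "w = v" | "w \<noteq> v" "w \<notin> V" | "w \<noteq> v" "nonadj w v" | "w \<noteq> v" "{w, v} \<in> E"
    using assms by (auto simp: nonadj_def)
  then show "w \<in> final (push v a \<sigma>) \<longleftrightarrow> w \<in> insert v {w \<in> final \<sigma>. {w, v} \<in> E}"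
  proof cases
    case 1
    then show ?thesis using assms by (auto simp: final_def push_def)
  next
    case 2
    then show ?thesis by (auto simp: final_def)
  next
    case 3
    then show ?thesis by (auto simp: final_def push_def nonadj_def)
  next
    case 4
    then have "nonadj w x \<Longrightarrow> push v a \<sigma> w x = \<sigma> w x" for x
      by (auto simp: push_def nonadj_def)
    then show ?thesis using 4 by (auto simp: final_def)
  qed
qed

lemma adj_push_eq: "{u, v} \<in> E \<Longrightarrow> nonadj u w \<Longrightarrow> push v a \<sigma> u w = \<sigma> u w"
  using edge_verts[of u v] by (auto simp: push_def nonadj_def)

lemma adj_pop_eq: "{u, v} \<in> E \<Longrightarrow> nonadj u w \<Longrightarrow> pop v \<sigma> u w = \<sigma> u w"
  using edge_verts[of u v] by (auto simp: pop_def nonadj_def)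

lemma final_adj:
  assumes "{u, v} \<in> E"
  shows "u \<in> final (push v a \<sigma>) \<longleftrightarrow> u \<in> final \<sigma>" "u \<in> final (pop v \<sigma>) \<longleftrightarrow> u \<in> final \<sigma>"
  unfolding final_def using adj_push_eq[OF assms] adj_pop_eq[OF assms] by auto

lemma push_pop_commute:
  assumes "{u, v} \<in> E"
  shows "push u a (push v b \<sigma>) = push v b (push u a \<sigma>)"
    and "pop u (push v b \<sigma>) = push v b (pop u \<sigma>)"
    and "pop u (pop v \<sigma>) = pop v (pop u \<sigma>)"
proof -
  have *: "u \<noteq> v" "\<not> nonadj u v" "\<not> nonadj v u"
    using assms edge_verts[of u v] by (auto simp: nonadj_def insert_commute)
  show "push u a (push v b \<sigma>) = push v b (push u a \<sigma>)"
    using * by (intro ext) (auto simp: push_def)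
  show "pop u (push v b \<sigma>) = push v b (pop u \<sigma>)"
    using * by (intro ext) (auto simp: push_def pop_def)
  show "pop u (pop v \<sigma>) = pop v (pop u \<sigma>)"
    using * by (intro ext) (auto simp: pop_def)
qed

lemma act_final_adj: "{u, v} \<in> E \<Longrightarrow> u \<in> final (act v b \<sigma>) \<longleftrightarrow> u \<in> final \<sigma>"
  by (auto simp: act_def final_adj)

lemma act_adj_eq: "{u, v} \<in> E \<Longrightarrow> act v b \<sigma> u u = \<sigma> u u"
  using edge_verts[of u v] by (simp add: act_def adj_push_eq adj_pop_eq)

text \<open>Acting at \<open>v\<close> changes neither the finality of an adjacent \<open>u\<close>
  nor the list of \<open>u\<close>-letters, so the case distinctions of the two actions do not
  interfere.\<close>

lemma act_commute:
  assumes "{u, v} \<in> E" shows "act v b (act u a \<sigma>) = act u a (act v b \<sigma>)"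
proof -
  have vu: "{v, u} \<in> E" using assms by (simp add: insert_commute)
  \<comment> \<open>\<open>?f\<close> evaluates all tests at the original \<open>\<sigma>\<close>;
    what remains are pushes and pops at adjacent vertices, which commute.\<close>
  let ?f = "\<lambda>w c \<sigma>'. if c = \<one>\<^bsub>G w\<^esub> then \<sigma>'
      else if w \<notin> final \<sigma> then push w c \<sigma>'
      else if snd (hd (\<sigma> w w)) \<otimes>\<^bsub>G w\<^esub> c = \<one>\<^bsub>G w\<^esub> then pop w \<sigma>'
      else push w (snd (hd (\<sigma> w w)) \<otimes>\<^bsub>G w\<^esub> c) (pop w \<sigma>')"
  have "act v b (act u a \<sigma>) = ?f v b (?f u a \<sigma>)"
    unfolding act_def[of v] act_final_adj[OF vu] act_adj_eq[OF vu] by (simp add: act_def)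
  also have "\<dots> = ?f u a (?f v b \<sigma>)"
    using push_pop_commute[OF assms] push_pop_commute[OF vu] by simp
  also have "\<dots> = act u a (act v b \<sigma>)"
    unfolding act_def[of u] act_final_adj[OF assms] act_adj_eq[OF assms] by (simp add: act_def)
  finally show ?thesis .
qed

text \<open>Exchange property. If the newest letter is at some \<open>u\<close> other than
  \<open>v\<close>, then \<open>final_push\<close> makes \<open>u\<close> adjacent to
  \<open>v\<close>, so the \<open>v\<close>-letter found by induction commutes past it. Thus
  \<open>pop\<close> at a final vertex leads back to a state.\<close>

lemma states_final:
  assumes "\<sigma> \<in> states" "v \<in> final \<sigma>"
  shows "\<exists>\<tau>\<in>states. \<exists>a\<in>units v. v \<notin> final \<tau> \<and> \<sigma> = push v a \<tau>"
  using assms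
proof induction
  case empty
  then have "nonadj v v" by (simp add: final_def)
  then show ?case using empty unfolding final_def by blast
next
  case (push \<sigma> u b)
  show ?case
  proof (cases "u = v")
    case True
    then show ?thesis using push by blast
  next
    case False
    then have uv: "{v, u} \<in> E" "v \<in> final \<sigma>" using push.prems final_push[OF push(2)] by auto
    then obtain \<tau> a where \<tau>: "\<tau> \<in> states" "a \<in> units v" "v \<notin> final \<tau>" "\<sigma> = push v a \<tau>"
      using push.IH by blast
    have uv': "{u, v} \<in> E" using uv by (simp add: insert_commute)
    have "push u b \<tau> \<in> states"
      using \<tau> push final_adj(1)[OF uv'] by (intro states.push) auto
    moreover have "v \<notin> final (push u b \<tau>)" using \<tau> final_adj(1)[OF uv(1)] by simp
    moreover have "push u b \<sigma> = push v a (push u b \<tau>)"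
      unfolding \<tau>(4) by (rule push_pop_commute(1)[OF uv'])
    ultimately show ?thesis using \<tau>(2) by blast
  qed
qed

lemma act_push:
  assumes "v \<in> V" "v \<notin> final \<tau>" "a \<in> units v" "b \<in> carrier (G v)"
  shows "act v b (push v a \<tau>) = (if a \<otimes>\<^bsub>G v\<^esub> b = \<one>\<^bsub>G v\<^esub> then \<tau> else push v (a \<otimes>\<^bsub>G v\<^esub> b) \<tau>)"
proof -
  interpret group "G v" by (rule groups[OF assms(1)])
  have "snd (hd (push v a \<tau> v v)) = a" using assms by (simp add: push_def)
  then show ?thesis using assms by (auto simp: act_def final_push units_def)
qed

lemma states_cases [consumes 2]:
  assumes "\<sigma> \<in> states" "v \<in> V"
  obtains "v \<notin> final \<sigma>"
  | \<tau> a where "\<tau> \<in> states" "v \<notin> final \<tau>" "a \<in> units v" "\<sigma> = push v a \<tau>"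
  using states_final[OF assms(1)] by blast

lemma act_states:
  assumes "\<sigma> \<in> states" "v \<in> V" "b \<in> carrier (G v)" shows "act v b \<sigma> \<in> states"
  using assms(1,2)
proof (cases rule: states_cases)
  case 1
  then show ?thesis using assms by (auto simp: act_def units_def intro: states.push)
next
  case (2 \<tau> a)
  then have "a \<otimes>\<^bsub>G v\<^esub> b \<in> carrier (G v)" using assms by (simp add: units_def)
  then show ?thesis using 2 assms by (auto simp: act_push units_def intro: states.push)
qed

text \<open>Stripping a final \<open>v\<close>-letter \<open>c\<close> turns \<open>\<sigma>\<close>
  into \<open>act v c \<tau>\<close> with \<open>v \<notin> final \<tau>\<close>; over such a
  \<open>\<tau>\<close> the action is multiplication in \<open>G v\<close>.\<close>

lemma act_mult:
  assumes "\<sigma> \<in> states" "v \<in> V" and a: "a \<in> carrier (G v)" and b: "b \<in> carrier (G v)"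
  shows "act v b (act v a \<sigma>) = act v (a \<otimes>\<^bsub>G v\<^esub> b) \<sigma>"
proof -
  interpret group "G v" by (rule groups[OF assms(2)])
  have *: "act v b (act v a \<sigma>) = act v (a \<otimes>\<^bsub>G v\<^esub> b) \<sigma>"
    if "v \<notin> final \<sigma>" "a \<in> carrier (G v)" for \<sigma> a
  proof (cases "a = \<one>\<^bsub>G v\<^esub>")
    case False
    then have "act v b (push v a \<sigma>) = act v (a \<otimes>\<^bsub>G v\<^esub> b) \<sigma>"
      using that assms by (subst act_push) (auto simp: units_def act_def)
    then show ?thesis using False that by (simp add: act_def)
  qed (use that b in \<open>simp add: act_def\<close>)
  show ?thesis using assms(1,2)
  proof (cases rule: states_cases)
    case 1
    then show ?thesis using * a by blast
  next
    case (2 \<tau> c)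
    have c: "c \<in> carrier (G v)" "\<sigma> = act v c \<tau>" using 2 by (auto simp: units_def act_def)
    have "act v b (act v a \<sigma>) = act v b (act v (c \<otimes>\<^bsub>G v\<^esub> a) \<tau>)"
    proof -
      have "act v a (act v c \<tau>) = act v (c \<otimes>\<^bsub>G v\<^esub> a) \<tau>"
        using act_push[OF assms(2) 2(2,3) a] 2 a c by (simp add: act_def units_def)
      then show ?thesis using c by simp
    qed
    also have "\<dots> = act v (c \<otimes>\<^bsub>G v\<^esub> (a \<otimes>\<^bsub>G v\<^esub> b)) \<tau>" using * 2 a b c by (simp add: m_assoc)
    also have "\<dots> = act v (a \<otimes>\<^bsub>G v\<^esub> b) \<sigma>"
      using act_push[OF assms(2) 2(2,3), of "a \<otimes>\<^bsub>G v\<^esub> b"] 2 a b c by (simp add: act_def units_def)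
    finally show ?thesis .
  qed
qed

lemma states_sym: "\<sigma> \<in> states \<Longrightarrow> \<sigma> u w = \<sigma> w u"
  by (induction arbitrary: u w rule: states.induct) (auto simp: push_def nonadj_sym)

text \<open>Distinct non-adjacent vertices share one projection list, and its head cannot belong to
  both.\<close>

lemma final_adjacent:
  assumes "\<sigma> \<in> states" "u \<in> final \<sigma>" "v \<in> final \<sigma>" "u \<noteq> v" shows "{u, v} \<in> E"
proof (rule ccontr)
  assume "{u, v} \<notin> E"
  then have "nonadj u v" "nonadj v u" using assms by (auto simp: nonadj_def final_def insert_commute)
  then show False using assms states_sym[OF assms(1), of u v] by (auto simp: final_def)
qed

text \<open>The normal form of a group element: the image of the empty state under the right action
  that \<open>GP_action\<close> supplies.\<close>

definition st :: "('v \<times> 'a) list set set \<Rightarrow> ('v, 'a) state" where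
  "st = (SOME s. (\<forall>g\<in>carrier GP. s g \<in> states) \<and> s \<one>\<^bsub>GP\<^esub> = (\<lambda>_ _. []) \<and>
    (\<forall>g\<in>carrier GP. \<forall>v\<in>V. \<forall>a\<in>carrier (G v). s (g \<otimes>\<^bsub>GP\<^esub> letter v a) = act v a (s g)))"

lemma st_spec:
  "(\<forall>g\<in>carrier GP. st g \<in> states) \<and> st \<one>\<^bsub>GP\<^esub> = (\<lambda>_ _. []) \<and>
    (\<forall>g\<in>carrier GP. \<forall>v\<in>V. \<forall>a\<in>carrier (G v). st (g \<otimes>\<^bsub>GP\<^esub> letter v a) = act v a (st g))"
proof -
  have "\<exists>s. (\<forall>g\<in>carrier GP. s g \<in> states) \<and> s \<one>\<^bsub>GP\<^esub> = (\<lambda>_ _. []) \<and>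
    (\<forall>g\<in>carrier GP. \<forall>v\<in>V. \<forall>a\<in>carrier (G v). s (g \<otimes>\<^bsub>GP\<^esub> letter v a) = act v a (s g))"
  proof (rule GP_action)
    show "act v \<one>\<^bsub>G v\<^esub> \<sigma> = \<sigma>" for v \<sigma> by (simp add: act_def)
  qed (rule states.empty act_states act_mult act_commute; assumption)+
  then show ?thesis unfolding st_def by (rule someI_ex)
qed

lemma st_states: "g \<in> carrier GP \<Longrightarrow> st g \<in> states"
  and st_one: "st \<one>\<^bsub>GP\<^esub> = (\<lambda>_ _. [])"
  and st_letter: "g \<in> carrier GP \<Longrightarrow> v \<in> V \<Longrightarrow> a \<in> carrier (G v) \<Longrightarrow>
    st (g \<otimes>\<^bsub>GP\<^esub> letter v a) = act v a (st g)"
  using st_spec by blast+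

abbreviation "D g \<equiv> final (st g)"

lemma st_push:
  "g \<in> carrier GP \<Longrightarrow> v \<in> V \<Longrightarrow> v \<notin> D g \<Longrightarrow> a \<in> units v \<Longrightarrow>
    st (g \<otimes>\<^bsub>GP\<^esub> letter v a) = push v a (st g)"
  by (simp add: st_letter units_def act_def)

lemma D_clique: "g \<in> carrier GP \<Longrightarrow> u \<in> D g \<Longrightarrow> v \<in> D g \<Longrightarrow> u \<noteq> v \<Longrightarrow> {u, v} \<in> E"
  using final_adjacent st_states by blast

lemma D_subset: "D g \<subseteq> V"
  by (auto simp: final_def)

lemma D_adj:
  assumes "g \<in> carrier GP" "{u, v} \<in> E" "b \<in> carrier (G v)"
  shows "u \<in> D (g \<otimes>\<^bsub>GP\<^esub> letter v b) \<longleftrightarrow> u \<in> D g"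
  using assms edge_verts[OF assms(2)] by (simp add: st_letter act_final_adj)

section \<open>Reduced expressions for elements of the graph product\<close>

inductive_set reduced :: "('v \<times> 'a) list set set set" where
  one: "\<one>\<^bsub>GP\<^esub> \<in> reduced"
| push: "g \<in> reduced \<Longrightarrow> g \<in> carrier GP \<Longrightarrow> v \<in> V \<Longrightarrow> v \<notin> D g \<Longrightarrow> a \<in> units v \<Longrightarrow>
    g \<otimes>\<^bsub>GP\<^esub> letter v a \<in> reduced"

lemma reduced_carrier: "g \<in> reduced \<Longrightarrow> g \<in> carrier GP"
  by (induction rule: reduced.induct) (auto simp: units_def)

text \<open>The exchange argument of \<open>states_final\<close> is repeated for group elements:
  decomposing the state \<open>st g\<close> does not by itself decompose \<open>g\<close>, as
  injectivity of \<open>st\<close> is not established.\<close>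

lemma reduced_final:
  assumes "g \<in> reduced" "v \<in> D g"
  shows "\<exists>h\<in>reduced. \<exists>a\<in>units v. v \<notin> D h \<and> g = h \<otimes>\<^bsub>GP\<^esub> letter v a"
  using assms
proof induction
  case one
  then have "nonadj v v" by (simp add: final_def)
  then show ?case using one unfolding final_def st_one by blast
next
  case (push g u b)
  show ?case
  proof (cases "u = v")
    case True
    then show ?thesis using push by blast
  next
    case False
    then have vu: "{v, u} \<in> E" "v \<in> D g"
      using push.prems push.hyps by (auto simp: st_push final_push)
    then obtain h a where h: "h \<in> reduced" "a \<in> units v" "v \<notin> D h" "g = h \<otimes>\<^bsub>GP\<^esub> letter v a"
      using push.IH by blast
    have uv: "{u, v} \<in> E" using vu by (simp add: insert_commute)
    have c: "a \<in> carrier (G v)" "b \<in> carrier (G u)" "v \<in> V" "h \<in> carrier GP"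
      using h push vu by (auto simp: units_def reduced_carrier final_def)
    have "u \<notin> D h" using D_adj[OF c(4) uv c(1)] push.hyps h by simp
    then have "h \<otimes>\<^bsub>GP\<^esub> letter u b \<in> reduced"
      using h push.hyps c by (intro reduced.push) auto
    moreover have "v \<notin> D (h \<otimes>\<^bsub>GP\<^esub> letter u b)" using D_adj[OF c(4) vu(1) c(2)] h by simp
    moreover have "g \<otimes>\<^bsub>GP\<^esub> letter u b = h \<otimes>\<^bsub>GP\<^esub> letter u b \<otimes>\<^bsub>GP\<^esub> letter v a"
      unfolding h(4) using letter_commute[OF vu(1) c(1,2)] c push.hyps by (simp add: GP.m_assoc)
    ultimately show ?thesis using h(2) by blast
  qed
qed

lemma reduced_letter:
  assumes g: "g \<in> reduced" and v: "v \<in> V" "b \<in> carrier (G v)"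
  shows "g \<otimes>\<^bsub>GP\<^esub> letter v b \<in> reduced"
proof -
  interpret Gv: group "G v" by (rule groups[OF v(1)])
  have *: "g \<otimes>\<^bsub>GP\<^esub> letter v b \<in> reduced"
    if "g \<in> reduced" "v \<notin> D g" "b \<in> carrier (G v)" for g b
    using that v reduced_carrier[of g]
    by (cases "b = \<one>\<^bsub>G v\<^esub>") (auto simp: letter_one units_def intro: reduced.push)
  show ?thesis
  proof (cases "v \<in> D g")
    case True
    then obtain h a where h: "h \<in> reduced" "a \<in> units v" "v \<notin> D h" "g = h \<otimes>\<^bsub>GP\<^esub> letter v a"
      using reduced_final[OF g] by blast
    then have "g \<otimes>\<^bsub>GP\<^esub> letter v b = h \<otimes>\<^bsub>GP\<^esub> letter v (a \<otimes>\<^bsub>G v\<^esub> b)"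
      using v reduced_carrier by (simp add: units_def GP.m_assoc letter_mult)
    then show ?thesis using * h v by (simp add: units_def)
  qed (use * g v in blast)
qed

lemma reduced_eq: "reduced = carrier GP"
proof
  show "carrier GP \<subseteq> reduced"
  proof
    fix g assume "g \<in> carrier GP"
    then show "g \<in> reduced"
      by (induction rule: GP_induct) (auto intro: reduced.one reduced_letter)
  qed
qed (use reduced_carrier in blast)

text \<open>In contrast to \<open>GP_induct\<close>, no step merges or cancels letters, so the state
  changes by a plain \<open>push\<close> each time and \<open>D\<close>, \<open>supp\<close> and
  \<open>L\<close> can be followed.\<close>

lemma reduced_induct [consumes 1, case_names one push]:
  assumes "g \<in> carrier GP" "P \<one>\<^bsub>GP\<^esub>"
    and "\<And>g v a. g \<in> carrier GP \<Longrightarrow> P g \<Longrightarrow> v \<in> V \<Longrightarrow> v \<notin> D g \<Longrightarrow> a \<in> units v \<Longrightarrow>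
      P (g \<otimes>\<^bsub>GP\<^esub> letter v a)"
  shows "P g"
  using assms(1) unfolding reduced_eq[symmetric]
  by (induction rule: reduced.induct) (use assms(2,3) in auto)

lemma D_decompose:
  assumes "g \<in> carrier GP" "v \<in> D g"
  obtains h a where "h \<in> carrier GP" "a \<in> units v" "v \<notin> D h" "g = h \<otimes>\<^bsub>GP\<^esub> letter v a"
  using reduced_final[of g v] assms unfolding reduced_eq by blast

section \<open>Supports and special subgroups\<close>

definition supp :: "('v \<times> 'a) list set set \<Rightarrow> 'v set" where
  "supp g = {v \<in> V. st g v v \<noteq> []}"

text \<open>This is the subgroup generated by the vertex groups over \<open>X\<close>. Describing it
  by supports allows membership to be refuted by exhibiting one letter outside
  \<open>X\<close>.\<close>

definition special :: "'v set \<Rightarrow> ('v \<times> 'a) list set set set" where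
  "special X = {g \<in> carrier GP. supp g \<subseteq> X}"

lemma supp_one: "supp \<one>\<^bsub>GP\<^esub> = {}"
  by (simp add: supp_def st_one)

lemma supp_push:
  "g \<in> carrier GP \<Longrightarrow> v \<in> V \<Longrightarrow> v \<notin> D g \<Longrightarrow> a \<in> units v \<Longrightarrow>
    supp (g \<otimes>\<^bsub>GP\<^esub> letter v a) = insert v (supp g)"
  by (auto simp: supp_def st_push push_def)

lemma supp_letter:
  assumes "g \<in> carrier GP" "v \<in> V" "a \<in> carrier (G v)"
  shows "supp (g \<otimes>\<^bsub>GP\<^esub> letter v a) \<subseteq> insert v (supp g)"
  using assms by (auto simp: supp_def st_letter act_def push_def pop_def split: if_splits)

lemma special_letter_right:
  "g \<in> special X \<Longrightarrow> v \<in> X \<Longrightarrow> v \<in> V \<Longrightarrow> a \<in> carrier (G v) \<Longrightarrow> g \<otimes>\<^bsub>GP\<^esub> letter v a \<in> special X"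
  using supp_letter[of g v a] by (auto simp: special_def)

lemma special_one: "\<one>\<^bsub>GP\<^esub> \<in> special X"
  by (simp add: special_def supp_one)

lemma letter_special: "v \<in> X \<Longrightarrow> v \<in> V \<Longrightarrow> a \<in> carrier (G v) \<Longrightarrow> letter v a \<in> special X"
  using special_letter_right[OF special_one, of v X a] by simp

lemma special_induct [consumes 1, case_names one push]:
  assumes "g \<in> special X" "P \<one>\<^bsub>GP\<^esub>"
    and "\<And>g v a. g \<in> special X \<Longrightarrow> P g \<Longrightarrow> v \<in> X \<Longrightarrow> v \<in> V \<Longrightarrow> v \<notin> D g \<Longrightarrow> a \<in> units v \<Longrightarrow>
      P (g \<otimes>\<^bsub>GP\<^esub> letter v a)"
  shows "P g"
proof -
  have g: "g \<in> carrier GP" "supp g \<subseteq> X" using assms(1) by (auto simp: special_def)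
  from g show ?thesis
    by (induction rule: reduced_induct) (use assms(2,3) in \<open>auto simp: supp_push special_def\<close>)
qed

lemma special_subgroup: "subgroup (special X) GP"
proof (rule GP.subgroupI)
  show "special X \<subseteq> carrier GP" by (auto simp: special_def)
  show "special X \<noteq> {}" using special_one by blast
  have mult: "a \<otimes>\<^bsub>GP\<^esub> b \<in> special X" if "a \<in> special X" "b \<in> special X" for a b
    using that(2)
  proof (induction rule: special_induct)
    case one
    then show ?case using that by (simp add: special_def)
  next
    case (push g v c)
    have "a \<otimes>\<^bsub>GP\<^esub> g \<otimes>\<^bsub>GP\<^esub> letter v c \<in> special X"
      using push by (intro special_letter_right) (auto simp: units_def)
    then show ?case using push that by (simp add: GP.m_assoc special_def units_def)
  qed
  then show "a \<otimes>\<^bsub>GP\<^esub> b \<in> special X" if "a \<in> special X" "b \<in> special X" for a b using that .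
  show "inv\<^bsub>GP\<^esub> a \<in> special X" if "a \<in> special X" for a
    using that
  proof (induction rule: special_induct)
    case one
    then show ?case using special_one by simp
  next
    case (push g v c)
    then have "letter v (inv\<^bsub>G v\<^esub> c) \<otimes>\<^bsub>GP\<^esub> inv\<^bsub>GP\<^esub> g \<in> special X"
      by (intro mult letter_special) (auto simp: units_def)
    then show ?case using push by (simp add: GP.inv_mult_group special_def units_def letter_inv)
  qed
qed

end

section \<open>Finite vertex groups: word length and finiteness of balls\<close>

locale finite_graph_of_groups = graph_of_groups \<Gamma> G
  for \<Gamma> :: "'v graph" and G :: "'v \<Rightarrow> ('a, 'b) monoid_scheme" +
  assumes finite_V: "finite (verts \<Gamma>)"
    and finite_G: "v \<in> verts \<Gamma> \<Longrightarrow> finite (carrier (G v))"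
    and nontrivial_G: "v \<in> verts \<Gamma> \<Longrightarrow> \<not> trivial_group (G v)"
begin

lemma units_nonempty: "v \<in> V \<Longrightarrow> \<exists>a. a \<in> units v"
  using nontrivial_G[of v] groups[of v] by (auto simp: units_def trivial_group_def)

text \<open>Length of a reduced expression: the diagonal projection at \<open>v\<close> lists
  exactly the \<open>v\<close>-letters, so every letter is counted once.\<close>

definition L :: "('v \<times> 'a) list set set \<Rightarrow> nat" where
  "L g = (\<Sum>v\<in>V. length (st g v v))"

lemma L_one: "L \<one>\<^bsub>GP\<^esub> = 0"
  by (simp add: L_def st_one)

lemma L_push:
  assumes "g \<in> carrier GP" "v \<in> V" "v \<notin> D g" "a \<in> units v"
  shows "L (g \<otimes>\<^bsub>GP\<^esub> letter v a) = Suc (L g)"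
proof -
  have "L (g \<otimes>\<^bsub>GP\<^esub> letter v a) = (\<Sum>u\<in>V. length (st g u u) + (if u = v then 1 else 0))"
    unfolding L_def st_push[OF assms] by (intro sum.cong) (auto simp: push_def)
  also have "\<dots> = L g + 1" using assms(2) finite_V by (simp add: sum.distrib L_def)
  finally show ?thesis by simp
qed

definition letters :: "('v \<times> 'a) list set set set" where
  "letters = (\<Union>v\<in>V. letter v ` carrier (G v))"

lemma finite_letters: "finite letters"
  using finite_V finite_G by (simp add: letters_def)

lemma finite_generating_letters: "finite_generating_set GP letters"
proof -
  have "g \<in> generate GP letters" if "g \<in> carrier GP" for g
    using that
  proof (induction rule: GP_induct)
    case (mult g v a)
    then have "letter v a \<in> letters" by (auto simp: letters_def)
    then show ?case using mult by (blast intro: generate.eng generate.incl)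
  qed (rule generate.one)
  moreover have "letters \<subseteq> carrier GP" by (auto simp: letters_def)
  moreover then have "generate GP letters \<subseteq> carrier GP"
    by (rule GP.generate_incl)
  ultimately show ?thesis using finite_letters by (auto simp: finite_generating_set_def)
qed

lemma finite_ball: "finite {g \<in> carrier GP. L g \<le> n}"
proof (induction n)
  case 0
  have "g = \<one>\<^bsub>GP\<^esub>" if "g \<in> carrier GP" "L g \<le> 0" for g
    using that by (induction rule: reduced_induct) (auto simp: L_push)
  then have "{g \<in> carrier GP. L g \<le> 0} \<subseteq> {\<one>\<^bsub>GP\<^esub>}" by blast
  then show ?case using finite_subset by blast
next
  case (Suc n)
  have "g \<in> insert \<one>\<^bsub>GP\<^esub> ((\<lambda>(g, t). g \<otimes>\<^bsub>GP\<^esub> t) ` ({g \<in> carrier GP. L g \<le> n} \<times> letters))"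
    if "g \<in> carrier GP" "L g \<le> Suc n" for g
    using that
  proof (induction rule: reduced_induct)
    case (push g v a)
    then have "(g, letter v a) \<in> {g \<in> carrier GP. L g \<le> n} \<times> letters"
      by (auto simp: L_push letters_def units_def)
    then show ?case by force
  qed simp
  then have "{g \<in> carrier GP. L g \<le> Suc n} \<subseteq>
      insert \<one>\<^bsub>GP\<^esub> ((\<lambda>(g, t). g \<otimes>\<^bsub>GP\<^esub> t) ` ({g \<in> carrier GP. L g \<le> n} \<times> letters))"
    by blast
  then show ?case using Suc finite_letters by (auto elim!: finite_subset)
qed

end

section \<open>Cliques and splittings of the graph\<close>

context graph_of_groups
begin

definition clique :: "'v set \<Rightarrow> bool" where
  "clique X \<longleftrightarrow> X \<subseteq> V \<and> (\<forall>u\<in>X. \<forall>v\<in>X. u \<noteq> v \<longrightarrow> {u, v} \<in> E)"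

text \<open>A complete separating subgraph enters only through its vertex set \<open>X\<close>.
  \<open>P\<close> and \<open>Q\<close> may be unions of several components of the rest, which keeps
  the notion symmetric and makes any component and its complement a valid pair.\<close>

definition splitting :: "'v set \<Rightarrow> 'v set \<Rightarrow> 'v set \<Rightarrow> bool" where
  "splitting X P Q \<longleftrightarrow> clique X \<and> X \<union> P \<union> Q = V \<and> X \<inter> P = {} \<and> X \<inter> Q = {} \<and> P \<inter> Q = {} \<and>
     P \<noteq> {} \<and> Q \<noteq> {} \<and> (\<forall>p\<in>P. \<forall>q\<in>Q. {p, q} \<notin> E)"

lemma splitting_sym: "splitting X P Q \<Longrightarrow> splitting X Q P"
  unfolding splitting_def by (simp add: ac_simps) (metis doubleton_eq_iff)

text \<open>Connectedness of \<open>V - X\<close> in the form of locally constant functions: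
  otherwise a fibre of \<open>\<phi>\<close> and its complement in \<open>V - X\<close> would be a
  splitting.\<close>

lemma nonsplit_constant:
  assumes "\<And>P Q. \<not> splitting X P Q" "clique X"
    and adj: "\<And>u v. u \<in> V - X \<Longrightarrow> v \<in> V - X \<Longrightarrow> {u, v} \<in> E \<Longrightarrow> \<phi> u = \<phi> v"
    and uv: "u \<in> V - X" "v \<in> V - X"
  shows "\<phi> u = \<phi> v"
proof (rule ccontr)
  assume n: "\<phi> u \<noteq> \<phi> v"
  let ?P = "{w \<in> V - X. \<phi> w = \<phi> u}" and ?Q = "{w \<in> V - X. \<phi> w \<noteq> \<phi> u}"
  have "splitting X ?P ?Q"
    unfolding splitting_def
  proof (intro conjI)
    show "\<forall>p\<in>?P. \<forall>q\<in>?Q. {p, q} \<notin> E" using adj by force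
    show "X \<union> ?P \<union> ?Q = V" using assms(2) by (auto simp: clique_def)
    show "?P \<noteq> {}" "?Q \<noteq> {}" using uv n by auto
  qed (use assms(2) in auto)
  then show False using assms(1) by blast
qed

lemma clique_D: "g \<in> carrier GP \<Longrightarrow> clique (D g)"
  using D_clique D_subset by (simp add: clique_def)

lemma states_letters: "\<sigma> \<in> states \<Longrightarrow> x \<in> set (\<sigma> v w) \<Longrightarrow> fst x = v \<or> fst x = w"
  by (induction rule: states.induct) (auto simp: push_def split: if_splits)

text \<open>With no letter at \<open>w\<close>, the lists for \<open>v, w\<close> and for
  \<open>v, v\<close> grow in step.\<close>

lemma states_single:
  assumes "\<sigma> \<in> states" "\<sigma> w w = []" "nonadj v w" shows "\<sigma> v w = (if v = w then [] else \<sigma> v v)"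
  using assms
proof induction
  case (push \<sigma> u a)
  have "w \<in> V" "v \<in> V" using push.prems by (auto simp: nonadj_def)
  then have "u \<noteq> w" using push.prems by (auto simp: push_def)
  then have "\<sigma> w w = []" using push.prems by (simp add: push_def split: if_splits)
  then have "\<sigma> v w = (if v = w then [] else \<sigma> v v)" using push by blast
  then show ?case using push.prems \<open>u \<noteq> w\<close> \<open>v \<in> V\<close> by (cases "u = v") (auto simp: push_def)
qed simp

lemma D_one: "D \<one>\<^bsub>GP\<^esub> = {}"
proof -
  have "v \<notin> D \<one>\<^bsub>GP\<^esub>" for v
    using nonadj_refl[of v] unfolding final_def st_one by blast
  then show ?thesis by blast
qed

lemma D_push:
  "g \<in> carrier GP \<Longrightarrow> v \<in> V \<Longrightarrow> v \<notin> D g \<Longrightarrow> a \<in> units v \<Longrightarrow>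
    D (g \<otimes>\<^bsub>GP\<^esub> letter v a) = insert v {w \<in> D g. {w, v} \<in> E}"
  by (simp add: st_push final_push)

lemma units_carrier: "a \<in> units v \<Longrightarrow> a \<in> carrier (G v)"
  by (simp add: units_def)

lemma D_letter: "v \<in> V \<Longrightarrow> a \<in> units v \<Longrightarrow> D (letter v a) = {v}"
  using D_push[of "\<one>\<^bsub>GP\<^esub>" v a] by (simp add: D_one units_carrier)

lemma supp_letter_eq: "v \<in> V \<Longrightarrow> a \<in> units v \<Longrightarrow> supp (letter v a) = {v}"
  using supp_push[of "\<one>\<^bsub>GP\<^esub>" v a] by (simp add: D_one supp_one units_carrier)

lemma units_mult_inv:
  assumes "v \<in> V" "a \<in> units v" "b \<in> units v"
  shows "inv\<^bsub>G v\<^esub> a \<in> units v" "a \<noteq> b \<Longrightarrow> inv\<^bsub>G v\<^esub> a \<otimes>\<^bsub>G v\<^esub> b \<in> units v"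
proof -
  interpret group "G v" by (rule groups[OF assms(1)])
  show "inv\<^bsub>G v\<^esub> a \<in> units v" using assms by (auto simp: units_def inv_eq_1_iff)
  show "inv\<^bsub>G v\<^esub> a \<otimes>\<^bsub>G v\<^esub> b \<in> units v" if "a \<noteq> b"
  proof -
    have "a \<in> carrier (G v)" "b \<in> carrier (G v)" using assms by (auto simp: units_def)
    moreover have "b = a" if "inv\<^bsub>G v\<^esub> a \<otimes>\<^bsub>G v\<^esub> b = \<one>\<^bsub>G v\<^esub>"
      using calculation inv_solve_left'[of "\<one>\<^bsub>G v\<^esub>" a b] that by simp
    ultimately show ?thesis using that by (auto simp: units_def)
  qed
qed

end

context finite_graph_of_groups
begin

text \<open>Over a clique all letters commute, so a second letter at the same vertex would merge
  with the first. Reduced expressions have at most one letter per vertex, and balls are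
  finite.\<close>

lemma finite_special:
  assumes "clique X" shows "finite (special X)"
proof -
  have "length (st g v v) \<le> 1" if "g \<in> special X" "v \<in> V" for g v
    using that(1)
  proof (induction rule: special_induct)
    case one
    then show ?case by (simp add: st_one)
  next
    case (push g u a)
    have gc: "g \<in> carrier GP" "supp g \<subseteq> X" using push by (auto simp: special_def)
    show ?case
    proof (cases "u = v")
      case True
      \<comment> \<open>An earlier \<open>v\<close>-letter would make \<open>v\<close> final: a
        vertex \<open>w\<close> not adjacent to \<open>v\<close> and distinct from it lies outside
        the clique \<open>X\<close> and contributes no letters, so all the relevant projections
        equal \<open>st g v v\<close>.\<close>
      have "st g v v = []"
      proof (rule ccontr)
        assume n: "st g v v \<noteq> []"
        have "fst (hd (st g v v)) = v"
          using states_letters[OF st_states[OF gc(1)], of "hd (st g v v)" v v] n by simp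
        moreover have "st g v w = st g v v" if "nonadj v w" for w
        proof (cases "w = v")
          case False
          then have "w \<notin> X" using assms that \<open>u \<in> X\<close> True by (auto simp: clique_def nonadj_def)
          then have "st g w w = []" using gc that by (auto simp: supp_def nonadj_def)
          then show ?thesis using states_single[OF st_states[OF gc(1)] _ that] False by simp
        qed simp
        ultimately have "st g v w \<noteq> [] \<and> fst (hd (st g v w)) = v" if "nonadj v w" for w
          using that n by metis
        then have "v \<in> D g" using \<open>v \<in> V\<close> unfolding final_def by blast
        then show False using push True by simp
      qed
      then show ?thesis using push gc True \<open>v \<in> V\<close> by (simp add: st_push push_def)
    next
      case False
      then show ?thesis using push gc by (simp add: st_push push_def)
    qed
  qed
  then have "L g \<le> (\<Sum>v\<in>V. 1)" if "g \<in> special X" for g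
    unfolding L_def using that by (intro sum_mono) auto
  then have "special X \<subseteq> {g \<in> carrier GP. L g \<le> (\<Sum>v\<in>V. 1)}"
    by (auto simp: special_def)
  then show ?thesis using finite_ball finite_subset by blast
qed

lemma special_V: "special V = carrier GP"
  by (auto simp: special_def supp_def)

subsection \<open>The one-ended case\<close>

lemma ex_not_D:
  assumes "\<not> clique V" "g \<in> carrier GP"
  obtains v a where "v \<in> V" "v \<notin> D g" "a \<in> units v"
proof -
  have "D g \<noteq> V" using clique_D[OF assms(2)] assms(1) by metis
  then obtain v where "v \<in> V" "v \<notin> D g" using D_subset[of g] by blast
  then show thesis using units_nonempty that by blast
qed

text \<open>\<open>D g\<close> is always a clique, so some letter can always be appended, and
  elements of every length exist.\<close>

lemma infinite_GP:
  assumes "\<not> clique V" shows "infinite (carrier GP)"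
proof
  assume fin: "finite (carrier GP)"
  have "\<exists>g\<in>carrier GP. L g = n" for n
  proof (induction n)
    case 0
    show ?case using L_one by blast
  next
    case (Suc n)
    then obtain g where g: "g \<in> carrier GP" "L g = n" by blast
    then obtain v a where "v \<in> V" "v \<notin> D g" "a \<in> units v" using ex_not_D[OF assms] by blast
    then have "g \<otimes>\<^bsub>GP\<^esub> letter v a \<in> carrier GP" "L (g \<otimes>\<^bsub>GP\<^esub> letter v a) = Suc n"
      using g L_push[of g v a] by (simp_all add: units_carrier)
    then show ?case by blast
  qed
  then obtain g where "g \<in> carrier GP" "L g = Suc (Max (L ` carrier GP))" by blast
  moreover have "L g \<le> Max (L ` carrier GP)" using fin \<open>g \<in> carrier GP\<close> by (intro Max_ge imageI finite_imageI)
  ultimately show False by simp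
qed

text \<open>
  The complement of every ball is connected: a path in \<open>L \<ge> m\<close> is pushed off the sphere \<open>L = m\<close>
  by replacing each point of the sphere by an outward neighbour. The outward neighbours of \<open>g\<close> are
  indexed by \<open>V - D g\<close>, and \<open>D g\<close> is a clique. In terms of locally constant functions \<open>f\<close>, this
  extends \<open>f\<close> from \<open>L > m\<close> to \<open>L \<ge> m\<close>.
\<close>

lemma complement_of_ball_connected:
  fixes f :: "('v \<times> 'a) list set set \<Rightarrow> bool"
  assumes nosplit: "\<And>X P Q. \<not> splitting X P Q" and ncl: "\<not> clique V"
    and f: "\<And>g v a. g \<in> carrier GP \<Longrightarrow> v \<in> V \<Longrightarrow> a \<in> carrier (G v) \<Longrightarrow> m \<le> L g \<Longrightarrow>
      m \<le> L (g \<otimes>\<^bsub>GP\<^esub> letter v a) \<Longrightarrow> f g = f (g \<otimes>\<^bsub>GP\<^esub> letter v a)"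
    and gh: "g \<in> carrier GP" "h \<in> carrier GP" "m \<le> L g" "m \<le> L h"
  shows "f g = f h"
  using f gh
proof (induction m arbitrary: f g h)
  case 0
  have *: "f k = f \<one>\<^bsub>GP\<^esub>" if "k \<in> carrier GP" for k
    using that
  proof (induction rule: GP_induct)
    case (mult g v a)
    have "f g = f (g \<otimes>\<^bsub>GP\<^esub> letter v a)" by (rule 0(1)) (use mult in simp_all)
    then show ?case using mult.IH by (rule subst)
  qed (rule refl)
  show ?case using *[OF 0(2)] *[OF 0(3)] by simp
next
  case (Suc m)
  note f = Suc.prems(1)
  have out: "f (g \<otimes>\<^bsub>GP\<^esub> letter u a) = f (g \<otimes>\<^bsub>GP\<^esub> letter v b)"
    if g: "g \<in> carrier GP" "L g = m" and u: "u \<in> V" "u \<notin> D g" "a \<in> units u"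
      and v: "v \<in> V" "v \<notin> D g" "b \<in> units v" for g u a v b
  proof -
    \<comment> \<open>Outward neighbours of \<open>g\<close> at one vertex \<open>w\<close> differ
      by a letter of the same vertex group, along an edge inside \<open>L = Suc m\<close>.\<close>
    have same: "f (g \<otimes>\<^bsub>GP\<^esub> letter w c) = f (g \<otimes>\<^bsub>GP\<^esub> letter w d)"
      if w: "w \<in> V" "w \<notin> D g" "c \<in> units w" "d \<in> units w" for w c d
    proof -
      interpret group "G w" by (rule groups[OF w(1)])
      have cd: "c \<in> carrier (G w)" "d \<in> carrier (G w)" using w by (auto simp: units_def)
      then have "c \<otimes>\<^bsub>G w\<^esub> (inv\<^bsub>G w\<^esub> c \<otimes>\<^bsub>G w\<^esub> d) = d" by (simp add: m_assoc[symmetric])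
      then have "g \<otimes>\<^bsub>GP\<^esub> letter w c \<otimes>\<^bsub>GP\<^esub> letter w (inv\<^bsub>G w\<^esub> c \<otimes>\<^bsub>G w\<^esub> d) = g \<otimes>\<^bsub>GP\<^esub> letter w d"
        using g w cd by (simp add: GP.m_assoc letter_mult)
      then show ?thesis
        using f[of "g \<otimes>\<^bsub>GP\<^esub> letter w c" w "inv\<^bsub>G w\<^esub> c \<otimes>\<^bsub>G w\<^esub> d"] L_push g w cd by simp
    qed
    define \<phi> where "\<phi> w = f (g \<otimes>\<^bsub>GP\<^esub> letter w (SOME c. c \<in> units w))" for w
    have unit: "(SOME c. c \<in> units w) \<in> units w" if "w \<in> V" for w
      using units_nonempty[OF that] by (rule someI_ex)
    have \<phi>: "\<phi> w = f (g \<otimes>\<^bsub>GP\<^esub> letter w c)" if "w \<in> V" "w \<notin> D g" "c \<in> units w" for w c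
      unfolding \<phi>_def by (rule same[OF that(1,2) unit[OF that(1)] that(3)])
    have "\<phi> u = \<phi> v"
    proof (rule nonsplit_constant[where \<phi>=\<phi> and X="D g"])
      fix w x assume wx: "w \<in> V - D g" "x \<in> V - D g" "{w, x} \<in> E"
      obtain c d where cd: "c \<in> units w" "d \<in> units x" using wx units_nonempty by blast
      \<comment> \<open>For adjacent \<open>w\<close>, \<open>x\<close> both outward neighbours are
        corners of a square at \<open>g\<close> whose fourth corner has length \<open>m + 2\<close>;
        the detour through it stays outside the ball.\<close>
      have half: "f (g \<otimes>\<^bsub>GP\<^esub> letter w c) = f (g \<otimes>\<^bsub>GP\<^esub> letter w c \<otimes>\<^bsub>GP\<^esub> letter x d)"
        if "w \<in> V - D g" "x \<in> V - D g" "{w, x} \<in> E" "c \<in> units w" "d \<in> units x" for w x c d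
      proof -
        have "{x, w} \<in> E" using that by (simp add: insert_commute)
        then have "x \<notin> D (g \<otimes>\<^bsub>GP\<^esub> letter w c)" using that D_adj[of g x w c] g units_carrier by auto
        then have "L (g \<otimes>\<^bsub>GP\<^esub> letter w c \<otimes>\<^bsub>GP\<^esub> letter x d) = Suc (Suc m)"
          using that g by (simp add: L_push units_carrier)
        moreover have "L (g \<otimes>\<^bsub>GP\<^esub> letter w c) = Suc m" using that g by (simp add: L_push)
        ultimately show ?thesis
          using f[of "g \<otimes>\<^bsub>GP\<^esub> letter w c" x d] that g by (simp add: units_carrier)
      qed
      have "g \<otimes>\<^bsub>GP\<^esub> letter w c \<otimes>\<^bsub>GP\<^esub> letter x d = g \<otimes>\<^bsub>GP\<^esub> letter x d \<otimes>\<^bsub>GP\<^esub> letter w c"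
        using letter_commute[OF wx(3)] cd wx g by (simp add: GP.m_assoc units_carrier)
      then have "f (g \<otimes>\<^bsub>GP\<^esub> letter w c) = f (g \<otimes>\<^bsub>GP\<^esub> letter x d)"
        using half[OF wx cd] half[OF wx(2,1) _ cd(2,1)] wx(3) by (simp add: insert_commute)
      then show "\<phi> w = \<phi> x" using \<phi>[of w c] \<phi>[of x d] cd wx by simp
    qed (use nosplit clique_D[OF g(1)] u v in simp_all)
    then show ?thesis using \<phi>[OF u] \<phi>[OF v] by simp
  qed
  \<comment> \<open>\<open>r\<close> moves a point of the sphere \<open>L = m\<close> to some
    outward neighbour and fixes everything beyond; by \<open>out\<close>, the value of
    \<open>f\<close> is independent of the choice.\<close>
  define r where "r g = (if Suc m \<le> L g then g else
      (SOME k. \<exists>v a. v \<in> V \<and> v \<notin> D g \<and> a \<in> units v \<and> k = g \<otimes>\<^bsub>GP\<^esub> letter v a))" for g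
  have r_id: "r g = g" if "Suc m \<le> L g" for g using that by (simp add: r_def)
  have r_out: "f (r g) = f (g \<otimes>\<^bsub>GP\<^esub> letter u a)"
    if "g \<in> carrier GP" "L g = m" "u \<in> V" "u \<notin> D g" "a \<in> units u" for g u a
  proof -
    let ?P = "\<lambda>k. \<exists>v a. v \<in> V \<and> v \<notin> D g \<and> a \<in> units v \<and> k = g \<otimes>\<^bsub>GP\<^esub> letter v a"
    have "?P (SOME k. ?P k)" by (rule someI[of ?P "g \<otimes>\<^bsub>GP\<^esub> letter u a"]) (use that in blast)
    then have "?P (r g)" using that by (simp add: r_def)
    then show ?thesis using out[OF that(1,2)] that by metis
  qed
  have up: "f (r g) = f (r (g \<otimes>\<^bsub>GP\<^esub> letter v a))"
    if "g \<in> carrier GP" "m \<le> L g" "v \<in> V" "v \<notin> D g" "a \<in> units v" for g v a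
  proof (cases "L g = m")
    case True
    then show ?thesis using that r_out[of g v a] by (simp add: r_id L_push)
  next
    case False
    then show ?thesis using that f[of g v a] by (simp add: r_id L_push units_carrier)
  qed
  have "f (r g) = f (r (g \<otimes>\<^bsub>GP\<^esub> letter v a))"
    if g: "g \<in> carrier GP" and v: "v \<in> V" "a \<in> carrier (G v)" and
      Lg: "m \<le> L g" "m \<le> L (g \<otimes>\<^bsub>GP\<^esub> letter v a)" for g v a
  proof (cases "v \<in> D g")
    case False
    then show ?thesis using up[of g v a] g v Lg
      by (cases "a = \<one>\<^bsub>G v\<^esub>") (auto simp: units_def letter_one)
  next
    case True
    interpret Gv: group "G v" by (rule groups[OF v(1)])
    obtain h c where h: "h \<in> carrier GP" "c \<in> units v" "v \<notin> D h" "g = h \<otimes>\<^bsub>GP\<^esub> letter v c"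
      using D_decompose[OF g True] by blast
    have ga: "g \<otimes>\<^bsub>GP\<^esub> letter v a = h \<otimes>\<^bsub>GP\<^esub> letter v (c \<otimes>\<^bsub>G v\<^esub> a)"
      using h v by (simp add: GP.m_assoc letter_mult units_carrier)
    have Lg': "L g = Suc (L h)" using h v by (simp add: L_push)
    show ?thesis
    proof (cases "c \<otimes>\<^bsub>G v\<^esub> a = \<one>\<^bsub>G v\<^esub>")
      case True
      then show ?thesis using up[of h v c] ga h v Lg by (simp add: letter_one)
    next
      case False
      then have "c \<otimes>\<^bsub>G v\<^esub> a \<in> units v" using h v by (simp add: units_def)
      then have La: "L (g \<otimes>\<^bsub>GP\<^esub> letter v a) = Suc (L h)" unfolding ga using h v by (simp add: L_push)
      show ?thesis
      proof (cases "L g = m")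
        case False
        then show ?thesis using f[of g v a] g v Lg La Lg' by (simp add: r_id)
      next
        case True
        \<comment> \<open>Both ends of the edge lie on the sphere and differ only in their last
          \<open>v\<close>-letter. A letter at such a \<open>u\<close> commutes with it and pushes
          both ends outward along parallel edges. Without such a \<open>u\<close>, the clique
          \<open>D g - {v}\<close> would separate \<open>v\<close> from
          \<open>V - D g\<close>.\<close>
        have "\<exists>u\<in>V - D g. {u, v} \<in> E"
        proof (rule ccontr)
          assume n: "\<not> ?thesis"
          have "splitting (D g - {v}) {v} (V - D g)"
            using clique_D[OF g] \<open>v \<in> D g\<close> v n ncl D_subset[of g]
            unfolding splitting_def clique_def by (auto simp: insert_commute)
          then show False using nosplit by blast
        qed
        then obtain u b where u: "u \<in> V" "u \<notin> D g" "{u, v} \<in> E" "b \<in> units u"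
          using units_nonempty by blast
        have b: "b \<in> carrier (G u)" using u units_carrier by simp
        have u': "u \<notin> D (g \<otimes>\<^bsub>GP\<^esub> letter v a)" using D_adj[OF g u(3) v(2)] u(2) by simp
        have eq: "g \<otimes>\<^bsub>GP\<^esub> letter v a \<otimes>\<^bsub>GP\<^esub> letter u b = g \<otimes>\<^bsub>GP\<^esub> letter u b \<otimes>\<^bsub>GP\<^esub> letter v a"
          using letter_commute[OF u(3) b v(2)] g v u(1) b by (simp add: GP.m_assoc)
        have "L (g \<otimes>\<^bsub>GP\<^esub> letter v a \<otimes>\<^bsub>GP\<^esub> letter u b) = Suc m"
          using u u' g v La Lg' True by (simp add: L_push)
        then have "f (g \<otimes>\<^bsub>GP\<^esub> letter u b) = f (g \<otimes>\<^bsub>GP\<^esub> letter v a \<otimes>\<^bsub>GP\<^esub> letter u b)"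
          unfolding eq using u g v b True by (intro f) (auto simp: L_push)
        then show ?thesis
          using r_out[of g u b] r_out[of "g \<otimes>\<^bsub>GP\<^esub> letter v a" u b] g v u u' La Lg' True by simp
      qed
    qed
  qed
  then have "f (r g) = f (r h)"
    using Suc.IH[of "\<lambda>g. f (r g)" g h] Suc.prems(2-5) by simp
  then show ?case using Suc.prems(2-5) by (simp add: r_id)
qed

lemma almost_invariant_bound:
  assumes "almost_invariant GP A" "finite T" "T \<subseteq> carrier GP"
  obtains N where "\<And>g t. g \<in> carrier GP \<Longrightarrow> t \<in> T \<Longrightarrow> N < L g \<Longrightarrow> g \<in> A \<longleftrightarrow> g \<otimes>\<^bsub>GP\<^esub> t \<in> A"
proof -
  let ?B = "\<Union>t\<in>T. {g \<in> carrier GP. (g \<in> A) \<noteq> (g \<otimes>\<^bsub>GP\<^esub> t \<in> A)}"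
  have "finite ?B" using assms by (auto simp: almost_invariant_def)
  then have "g \<in> ?B \<Longrightarrow> L g \<le> Max (L ` ?B)" for g by simp
  then have B: "g \<notin> ?B" if "Max (L ` ?B) < L g" for g using that by (meson not_le)
  show thesis
  proof (rule that[of "Max (L ` ?B)"])
    fix g t assume "g \<in> carrier GP" "t \<in> T" "Max (L ` ?B) < L g"
    then show "g \<in> A \<longleftrightarrow> g \<otimes>\<^bsub>GP\<^esub> t \<in> A" using B by blast
  qed
qed

text \<open>Beyond a ball containing the boundary, membership in \<open>A\<close> is unchanged by
  every letter, hence constant there; so \<open>A\<close> or its complement lies in the
  ball.\<close>

lemma almost_invariant_trivial:
  assumes nosplit: "\<And>X P Q. \<not> splitting X P Q" and ncl: "\<not> clique V"
    and A: "almost_invariant GP A"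
  shows "finite A \<or> finite (carrier GP - A)"
proof -
  obtain N where N: "\<And>g t. g \<in> carrier GP \<Longrightarrow> t \<in> letters \<Longrightarrow> N < L g \<Longrightarrow> g \<in> A \<longleftrightarrow> g \<otimes>\<^bsub>GP\<^esub> t \<in> A"
    using almost_invariant_bound[OF A finite_letters]
      finite_generating_letters unfolding finite_generating_set_def by blast
  have const: "g \<in> A \<longleftrightarrow> h \<in> A" if "g \<in> carrier GP" "h \<in> carrier GP" "Suc N \<le> L g" "Suc N \<le> L h" for g h
  proof (rule complement_of_ball_connected[OF nosplit ncl _ that])
    fix g v a assume *: "g \<in> carrier GP" "v \<in> V" "a \<in> carrier (G v)" "Suc N \<le> L g"
    then have "letter v a \<in> letters" by (auto simp: letters_def)
    then show "(g \<in> A) = (g \<otimes>\<^bsub>GP\<^esub> letter v a \<in> A)" using N[of g "letter v a"] * by simp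
  qed
  have "A \<subseteq> {g \<in> carrier GP. L g \<le> N} \<or> carrier GP - A \<subseteq> {g \<in> carrier GP. L g \<le> N}"
  proof (rule ccontr)
    assume "\<not> ?thesis"
    then obtain g h where "g \<in> A" "g \<in> carrier GP" "\<not> L g \<le> N" "h \<notin> A" "h \<in> carrier GP" "\<not> L h \<le> N"
      using A unfolding almost_invariant_def by blast
    then show False using const[of g h] by simp
  qed
  then show ?thesis using finite_ball finite_subset by blast
qed

end

subsection \<open>Ping-pong\<close>

text \<open>Left translation commutes with right multiplication, so it carries boundary to
  boundary.\<close>

lemma (in group) almost_invariant_translate:
  assumes A: "almost_invariant G A" and x: "x \<in> carrier G"
  shows "almost_invariant G ((\<otimes>) x ` A)"
  unfolding almost_invariant_def
proof (intro conjI ballI)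
  have Ac: "A \<subseteq> carrier G" using A by (simp add: almost_invariant_def)
  then show "(\<otimes>) x ` A \<subseteq> carrier G" using x by auto
  have mem: "g \<in> (\<otimes>) x ` A \<longleftrightarrow> inv x \<otimes> g \<in> A" if "g \<in> carrier G" for g
  proof
    assume "g \<in> (\<otimes>) x ` A"
    then obtain a where "a \<in> A" "g = x \<otimes> a" by blast
    moreover then have "a \<in> carrier G" using Ac by blast
    ultimately show "inv x \<otimes> g \<in> A" using x by (simp add: m_assoc[symmetric])
  next
    assume "inv x \<otimes> g \<in> A"
    moreover have "g = x \<otimes> (inv x \<otimes> g)" using x that by (simp add: m_assoc[symmetric])
    ultimately show "g \<in> (\<otimes>) x ` A" by blast
  qed
  fix t assume t: "t \<in> carrier G"
  have "{g \<in> carrier G. (g \<in> (\<otimes>) x ` A) \<noteq> (g \<otimes> t \<in> (\<otimes>) x ` A)} \<subseteq>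
    (\<otimes>) x ` {g \<in> carrier G. (g \<in> A) \<noteq> (g \<otimes> t \<in> A)}"
  proof
    fix g assume g: "g \<in> {g \<in> carrier G. (g \<in> (\<otimes>) x ` A) \<noteq> (g \<otimes> t \<in> (\<otimes>) x ` A)}"
    then have "inv x \<otimes> g \<in> {g \<in> carrier G. (g \<in> A) \<noteq> (g \<otimes> t \<in> A)}"
      using mem[of g] mem[of "g \<otimes> t"] t x by (simp add: m_assoc)
    moreover have "g = x \<otimes> (inv x \<otimes> g)" using x g by (simp add: m_assoc[symmetric])
    ultimately show "g \<in> (\<otimes>) x ` {g \<in> carrier G. (g \<in> A) \<noteq> (g \<otimes> t \<in> A)}" by blast
  qed
  then show "finite {g \<in> carrier G. (g \<in> (\<otimes>) x ` A) \<noteq> (g \<otimes> t \<in> (\<otimes>) x ` A)}"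
    using A t finite_surj unfolding almost_invariant_def by blast
qed

lemma (in group) card_translate:
  assumes "x \<in> carrier G" "A \<subseteq> carrier G"
  shows "inj_on ((\<otimes>) x) A" "card ((\<otimes>) x ` A) = card A" "finite ((\<otimes>) x ` A) \<longleftrightarrow> finite A"
proof -
  show inj: "inj_on ((\<otimes>) x) A"
    using assms by (auto intro!: inj_onI simp: subset_iff)
  show "card ((\<otimes>) x ` A) = card A" using inj by (rule card_image)
  show "finite ((\<otimes>) x ` A) \<longleftrightarrow> finite A" using inj by (rule finite_image_iff)
qed

text \<open>From \<open>n\<close> disjoint almost invariant sets inside \<open>H\<close>, their
  \<open>x\<close>-translates together with \<open>y H\<close> give \<open>n + 1\<close>. The two
  disjoint translates inside \<open>H\<close> also force \<open>H\<close> to be infinite, since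
  twice its size would have to fit into it.\<close>

lemma (in group) ends_infinite:
  assumes gen: "finite_generating_set G S" and H: "almost_invariant G H" "H \<noteq> {}"
    and xy: "x \<in> carrier G" "y \<in> carrier G" "(\<otimes>) x ` H \<subseteq> H" "(\<otimes>) y ` H \<subseteq> H"
      "disjnt ((\<otimes>) x ` H) ((\<otimes>) y ` H)"
  shows "ends G = \<infinity>"
proof -
  have Hc: "H \<subseteq> carrier G" using H by (simp add: almost_invariant_def)
  have infH: "infinite H"
  proof
    assume fin: "finite H"
    have "card ((\<otimes>) x ` H \<union> (\<otimes>) y ` H) \<le> card H" using fin xy by (intro card_mono) auto
    moreover have "card ((\<otimes>) x ` H \<union> (\<otimes>) y ` H) = card H + card H"
      using fin xy Hc by (subst card_Un_disjoint) (auto simp: card_translate disjnt_def)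
    ultimately show False using fin H by simp
  qed
  have "\<exists>\<A>. finite \<A> \<and> card \<A> = n \<and> pairwise disjnt \<A> \<and>
      (\<forall>A\<in>\<A>. infinite A \<and> almost_invariant G A \<and> A \<subseteq> H)" for n
  proof (induction n)
    case 0
    show ?case by (intro exI[of _ "{}"]) simp
  next
    case (Suc n)
    then obtain \<A> where \<A>: "finite \<A>" "card \<A> = n" "pairwise disjnt \<A>"
      "\<And>A. A \<in> \<A> \<Longrightarrow> infinite A \<and> almost_invariant G A \<and> A \<subseteq> H" by blast
    let ?x = "\<lambda>A. (\<otimes>) x ` A" and ?y = "(\<otimes>) y ` H"
    have inj: "inj_on ((\<otimes>) x) H" using card_translate xy Hc by simp
    have inj': "inj_on ?x \<A>"
      using \<A>(4) inj by (auto intro!: inj_onI simp: inj_on_image_eq_iff)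
    have dis: "disjnt ?y (?x A)" if "A \<in> \<A>" for A
      using xy(5) \<A>(4)[OF that] unfolding disjnt_def by blast
    have infy: "infinite ?y" using infH card_translate xy Hc by simp
    have infx: "infinite (?x A)" if "A \<in> \<A>" for A
      using \<A>(4)[OF that] card_translate(3)[OF xy(1), of A] Hc by auto
    have "?y \<notin> ?x ` \<A>"
    proof
      assume "?y \<in> ?x ` \<A>"
      then obtain A where "A \<in> \<A>" "?y = ?x A" by blast
      then have "?y = {}" using dis[of A] by (simp add: disjnt_def)
      then show False using infy by simp
    qed
    then have "card (insert ?y (?x ` \<A>)) = Suc n"
      using \<A> inj' by (simp add: card_image)
    moreover have "pairwise disjnt (insert ?y (?x ` \<A>))"
    proof -
      have "disjnt (?x A) (?x B)" if "A \<in> \<A>" "B \<in> \<A>" "?x A \<noteq> ?x B" for A B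
      proof -
        have "disjnt A B" using that \<A>(3) by (auto simp: pairwise_def)
        then show ?thesis using inj_on_image_Int[OF inj, of A B] \<A>(4) that by (simp add: disjnt_def)
      qed
      then show ?thesis using dis by (auto simp: pairwise_insert pairwise_image disjnt_sym pairwise_def)
    qed
    moreover have "almost_invariant G A \<and> A \<subseteq> H \<and> infinite A" if "A \<in> insert ?y (?x ` \<A>)" for A
      using that
    proof
      assume "A = ?y"
      then show ?thesis using almost_invariant_translate[OF H(1) xy(2)] xy(4) infy by simp
    next
      assume "A \<in> ?x ` \<A>"
      then obtain B where B: "B \<in> \<A>" "A = ?x B" by blast
      have "?x B \<subseteq> ?x H" using \<A>(4)[OF B(1)] by (intro image_mono) simp
      then show ?thesis
        using almost_invariant_translate[of B x] xy(1,3) \<A>(4)[OF B(1)] infx[OF B(1)] B(2) by simp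
    qed
    moreover have "finite (insert ?y (?x ` \<A>))" using \<A>(1) by simp
    ultimately show ?case by (intro exI[of _ "insert ?y (?x ` \<A>)"] conjI ballI) simp_all
  qed
  then have "enat n \<le> ends G" for n
    using ends_ge[OF gen] by metis
  then have "enat (Suc n) \<le> ends G" for n by blast
  then have "ends G \<noteq> enat n" for n by (metis Suc_n_not_le_n enat_ord_simps(1))
  then show ?thesis by (metis enat.exhaust)
qed

subsection \<open>Graphs with a complete separating subgraph\<close>

context finite_graph_of_groups
begin

lemma special_carrier: "g \<in> special X \<Longrightarrow> g \<in> carrier GP"
  by (simp add: special_def)

text \<open>The elements whose reduced words have their first letter outside \<open>X = V - P - Q\<close> in \<open>P\<close>.\<close>

definition half :: "'v set \<Rightarrow> 'v set \<Rightarrow> ('v \<times> 'a) list set set set" where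
  "half P Q = {g \<in> carrier GP. \<exists>p\<in>P. \<forall>q\<in>Q. st g p q \<noteq> [] \<and> fst (last (st g p q)) = p}"

text \<open>Lists are stored in reverse: \<open>push\<close> works at the head and leaves
  \<open>last\<close>, the first letter, untouched on non-empty lists.\<close>

lemma half_push:
  "g \<in> half P Q \<Longrightarrow> v \<in> V \<Longrightarrow> v \<notin> D g \<Longrightarrow> a \<in> units v \<Longrightarrow> g \<otimes>\<^bsub>GP\<^esub> letter v a \<in> half P Q"
  unfolding half_def by (auto simp: st_push units_carrier) (force simp: push_def)

context
  fixes X P Q assumes split: "splitting X P Q"
begin

lemma split_nonadj: "p \<in> P \<Longrightarrow> q \<in> Q \<Longrightarrow> p \<noteq> q \<and> nonadj p q \<and> nonadj q p \<and> p \<in> V \<and> q \<in> V"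
  using split unfolding splitting_def nonadj_def by (auto simp: insert_commute)

text \<open>All letters before \<open>v\<close> are in \<open>X\<close>, so the projections to
  \<open>v\<close> and any \<open>q\<close> in \<open>Q\<close> are still empty and now start with
  \<open>v\<close>.\<close>

lemma half_start:
  assumes "g \<in> special X" "v \<in> P" "v \<notin> D g" "a \<in> units v"
  shows "g \<otimes>\<^bsub>GP\<^esub> letter v a \<in> half P Q"
proof -
  have v: "v \<in> V" "v \<notin> X" using assms split by (auto simp: splitting_def)
  have g: "g \<in> carrier GP" using assms by (simp add: special_def)
  have "st g v q = []" if "q \<in> Q" for q
  proof -
    have "q \<notin> X" "q \<in> V" using that split by (auto simp: splitting_def)
    then have "st g v v = []" "st g q q = []" using v assms by (auto simp: special_def supp_def)
    then show ?thesis
      using states_single[OF st_states[OF g], of q v] split_nonadj[OF assms(2) that] by simp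
  qed
  then have "st (g \<otimes>\<^bsub>GP\<^esub> letter v a) v q = [(v, a)]" if "q \<in> Q" for q
    using that split_nonadj[OF assms(2) that] v g assms by (simp add: st_push push_def)
  then have "\<exists>p\<in>P. \<forall>q\<in>Q. st (g \<otimes>\<^bsub>GP\<^esub> letter v a) p q \<noteq> [] \<and>
      fst (last (st (g \<otimes>\<^bsub>GP\<^esub> letter v a) p q)) = p"
    using assms(2) by (intro bexI[of _ v] ballI) simp_all
  then show ?thesis using g v assms by (simp add: half_def units_carrier)
qed

text \<open>Witnesses \<open>p\<close> and \<open>q\<close> for the two halves share a projection,
  which would have to begin with both.\<close>

lemma half_disjoint:
  assumes "g \<in> half P Q" shows "g \<notin> half Q P"
proof
  assume "g \<in> half Q P"
  then obtain q where q: "q \<in> Q" "\<forall>p\<in>P. st g q p \<noteq> [] \<and> fst (last (st g q p)) = q"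
    by (auto simp: half_def)
  obtain p where p: "p \<in> P" "\<forall>q\<in>Q. st g p q \<noteq> [] \<and> fst (last (st g p q)) = p"
    using assms by (auto simp: half_def)
  have "st g p q = st g q p" using assms states_sym st_states by (simp add: half_def)
  then show False using p q split_nonadj[of p q] by auto
qed

lemma half_supp:
  assumes "g \<in> half P Q" shows "supp g \<inter> P \<noteq> {}"
proof -
  obtain p where p: "p \<in> P" "\<forall>q\<in>Q. st g p q \<noteq> [] \<and> fst (last (st g p q)) = p"
    using assms by (auto simp: half_def)
  have g: "st g \<in> states" using assms st_states by (auto simp: half_def)
  obtain q where q: "q \<in> Q" using split by (auto simp: splitting_def)
  have pq: "nonadj q p" "q \<noteq> p" "p \<in> V" using split_nonadj[OF p(1) q] by auto
  have "st g p p \<noteq> []"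
  proof
    assume "st g p p = []"
    then have "st g p q = st g q q"
      using states_single[OF g _ pq(1)] states_sym[OF g, of p q] pq by simp
    then have "last (st g q q) \<in> set (st g q q)" "fst (last (st g q q)) = p"
      using p(2) q by auto
    then show False using states_letters[OF g, of _ q q] pq by auto
  qed
  then show ?thesis using p pq by (auto simp: supp_def)
qed

lemma half_not_special:
  assumes "g \<in> half P Q" "Y \<inter> P = {}" shows "g \<notin> special Y"
  using half_supp[OF assms(1)] assms(2) by (auto simp: special_def)

end

text \<open>Along a reduced expression the element stays in \<open>special X\<close> until the first
  letter outside \<open>X\<close>; that letter decides the half once and for all.\<close>

lemma half_trichotomy:
  assumes split: "splitting X P Q" and g: "g \<in> carrier GP"
  shows "g \<in> special X \<or> g \<in> half P Q \<or> g \<in> half Q P"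
  using g
proof (induction rule: reduced_induct)
  case one
  then show ?case by (simp add: special_one)
next
  case (push g v a)
  have "v \<in> X \<or> v \<in> P \<or> v \<in> Q" using push split by (auto simp: splitting_def)
  then show ?case
    using push half_push[of g P Q v a] half_push[of g Q P v a] special_letter_right[of g X v a]
      half_start[OF split, of g v a] half_start[OF splitting_sym[OF split], of g v a]
      units_carrier by blast
qed

context
  fixes X P Q assumes split: "splitting X P Q"
begin

text \<open>\<open>special X\<close> is the only passage between the halves. If a final
  \<open>v\<close>-letter is removed, the remaining \<open>h\<close> cannot be in
  \<open>half Q P\<close>, because pushing the letter back would keep \<open>g\<close>
  there.\<close>

lemma half_letter:
  assumes g: "g \<in> half P Q" and v: "v \<in> V" "b \<in> carrier (G v)"
  shows "g \<otimes>\<^bsub>GP\<^esub> letter v b \<in> half P Q \<or> g \<otimes>\<^bsub>GP\<^esub> letter v b \<in> special X"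
proof -
  interpret Gv: group "G v" by (rule groups[OF v(1)])
  have gc: "g \<in> carrier GP" using g by (simp add: half_def)
  show ?thesis
  proof (cases "v \<in> D g")
    case False
    then show ?thesis using half_push[OF g v(1)] gc v g
      by (cases "b = \<one>\<^bsub>G v\<^esub>") (auto simp: letter_one units_def)
  next
    case True
    then obtain h a where h: "h \<in> carrier GP" "a \<in> units v" "v \<notin> D h" "g = h \<otimes>\<^bsub>GP\<^esub> letter v a"
      using D_decompose[OF gc] by blast
    have gb: "g \<otimes>\<^bsub>GP\<^esub> letter v b = h \<otimes>\<^bsub>GP\<^esub> letter v (a \<otimes>\<^bsub>G v\<^esub> b)"
      using h v by (simp add: GP.m_assoc letter_mult units_carrier)
    have hQ: "h \<notin> half Q P"
      using half_push[of h Q P v a] h v half_disjoint[OF split g] by auto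
    show ?thesis
    proof (cases "a \<otimes>\<^bsub>G v\<^esub> b = \<one>\<^bsub>G v\<^esub>")
      case True
      then have "g \<otimes>\<^bsub>GP\<^esub> letter v b = h" unfolding gb using h v by (simp add: letter_one)
      then show ?thesis using hQ half_trichotomy[OF split h(1)] by metis
    next
      case False
      then have u: "a \<otimes>\<^bsub>G v\<^esub> b \<in> units v" using h v by (simp add: units_def)
      show ?thesis
      proof (cases "h \<in> half P Q")
        case True
        then show ?thesis unfolding gb using half_push h v u by simp
      next
        case False
        then have hX: "h \<in> special X" using hQ half_trichotomy[OF split h(1)] by blast
        have "v \<notin> X"
          using special_letter_right[OF hX _ v(1), of a] half_not_special[OF split g, of X] h split
          by (auto simp: splitting_def units_carrier)
        moreover have "v \<notin> Q"
          using half_start[OF splitting_sym[OF split] hX _ h(3,2)] half_disjoint[OF split g] h by auto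
        ultimately have "v \<in> P" using v split by (auto simp: splitting_def)
        then show ?thesis unfolding gb using half_start[OF split hX _ h(3) u] by blast
      qed
    qed
  qed
qed

lemma special_half:
  assumes "a \<in> special (X \<union> P)" "a \<notin> special X" shows "a \<in> half P Q"
proof -
  have "(X \<union> P) \<inter> Q = {}" using split by (auto simp: splitting_def)
  then have "a \<notin> half Q P"
    using assms half_not_special[OF splitting_sym[OF split], of a "X \<union> P"] by blast
  then show ?thesis using assms half_trichotomy[OF split, of a] by (auto simp: special_def)
qed

text \<open>The ping-pong step. While a prefix of \<open>g\<close> is in \<open>special X\<close>,
  its product with \<open>a\<close> lies in \<open>special (X \<union> P)\<close> but not in
  \<open>special X\<close>, hence in \<open>half P Q\<close>. Later products could leave this half
  only through \<open>special X\<close>; that would put an element of \<open>half Q P\<close> into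
  \<open>special (X \<union> P)\<close>, which has no letters in \<open>Q\<close>.\<close>

lemma translate_half:
  assumes a: "a \<in> special (X \<union> P)" "a \<notin> special X" and g: "g \<in> half Q P"
  shows "a \<otimes>\<^bsub>GP\<^esub> g \<in> half P Q"
proof -
  interpret SP: subgroup "special (X \<union> P)" GP by (rule special_subgroup)
  interpret S: subgroup "special X" GP by (rule special_subgroup)
  have sub: "special X \<subseteq> special (X \<union> P)" unfolding special_def by blast
  have ac: "a \<in> carrier GP" using a(1) by (rule special_carrier)
  have aspecial: "a \<otimes>\<^bsub>GP\<^esub> h \<notin> special X" if "h \<in> half Q P" for h
  proof
    assume *: "a \<otimes>\<^bsub>GP\<^esub> h \<in> special X"
    have hc: "h \<in> carrier GP" using that by (simp add: half_def)
    have "inv\<^bsub>GP\<^esub> a \<otimes>\<^bsub>GP\<^esub> (a \<otimes>\<^bsub>GP\<^esub> h) \<in> special (X \<union> P)"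
      by (rule SP.m_closed[OF SP.m_inv_closed[OF a(1)] subsetD[OF sub *]])
    moreover have "inv\<^bsub>GP\<^esub> a \<otimes>\<^bsub>GP\<^esub> (a \<otimes>\<^bsub>GP\<^esub> h) = h"
      using ac hc by (simp add: GP.m_assoc[symmetric] del: SP.m_closed SP.m_inv_closed)
    ultimately have "h \<in> special (X \<union> P)" by (simp only:)
    moreover have "(X \<union> P) \<inter> Q = {}" using split by (auto simp: splitting_def)
    ultimately show False using half_not_special[OF splitting_sym[OF split] that] by blast
  qed
  have "g \<in> carrier GP" using g by (simp add: half_def)
  then show ?thesis using g
  proof (induction rule: reduced_induct)
    case one
    then have False using half_supp[OF splitting_sym[OF split], of "\<one>\<^bsub>GP\<^esub>"] by (simp add: supp_one)
    then show ?case by simp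
  next
    case (push g v b)
    have b: "b \<in> carrier (G v)" using push units_carrier by simp
    have "g \<notin> half P Q"
      using push half_push[of g P Q v b] half_disjoint[OF split] by blast
    then consider "g \<in> half Q P" | "g \<in> special X"
      using half_trichotomy[OF split] push by blast
    then have "a \<otimes>\<^bsub>GP\<^esub> g \<in> half P Q"
    proof cases
      case 2
      have "a \<otimes>\<^bsub>GP\<^esub> g \<in> special (X \<union> P)" using a 2 sub by (intro SP.m_closed) auto
      moreover have "a \<otimes>\<^bsub>GP\<^esub> g \<notin> special X"
      proof
        assume *: "a \<otimes>\<^bsub>GP\<^esub> g \<in> special X"
        have "a \<otimes>\<^bsub>GP\<^esub> g \<otimes>\<^bsub>GP\<^esub> inv\<^bsub>GP\<^esub> g \<in> special X"
          by (rule S.m_closed[OF * S.m_inv_closed[OF 2]])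
        then show False using a push.hyps ac by (simp add: GP.m_assoc)
      qed
      ultimately show ?thesis by (rule special_half)
    qed (use push in blast)
    then have "a \<otimes>\<^bsub>GP\<^esub> g \<otimes>\<^bsub>GP\<^esub> letter v b \<in> half P Q \<or> a \<otimes>\<^bsub>GP\<^esub> g \<otimes>\<^bsub>GP\<^esub> letter v b \<in> special X"
      using half_letter push.hyps b by blast
    then show ?case
      using aspecial[OF push.prems] push.hyps b ac by (simp add: GP.m_assoc)
  qed
qed

text \<open>By \<open>half_letter\<close> each edge leading out of the half has an end in
  \<open>special X\<close>, which is finite because \<open>X\<close> is a clique.\<close>

lemma half_almost_invariant: "almost_invariant GP (half P Q)"
proof (rule GP.almost_invariant_generate)
  show "generate GP letters = carrier GP" "letters \<subseteq> carrier GP"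
    using finite_generating_letters by (auto simp: finite_generating_set_def)
  show "half P Q \<subseteq> carrier GP" by (auto simp: half_def)
  fix t assume "t \<in> letters"
  then obtain v b where v: "v \<in> V" "b \<in> carrier (G v)" "t = letter v b" by (auto simp: letters_def)
  have "{g \<in> carrier GP. (g \<in> half P Q) \<noteq> (g \<otimes>\<^bsub>GP\<^esub> t \<in> half P Q)} \<subseteq>
    special X \<union> (\<lambda>h. h \<otimes>\<^bsub>GP\<^esub> inv\<^bsub>GP\<^esub> t) ` special X"
  proof
    fix g assume g: "g \<in> {g \<in> carrier GP. (g \<in> half P Q) \<noteq> (g \<otimes>\<^bsub>GP\<^esub> t \<in> half P Q)}"
    have eq: "g = g \<otimes>\<^bsub>GP\<^esub> t \<otimes>\<^bsub>GP\<^esub> inv\<^bsub>GP\<^esub> t" using g v by (simp add: GP.m_assoc)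
    show "g \<in> special X \<union> (\<lambda>h. h \<otimes>\<^bsub>GP\<^esub> inv\<^bsub>GP\<^esub> t) ` special X"
    proof (cases "g \<in> half P Q")
      case True
      then have "g \<otimes>\<^bsub>GP\<^esub> t \<in> special X" using half_letter[OF True v(1,2)] g v by auto
      then show ?thesis using eq by blast
    next
      case False
      then have "g \<otimes>\<^bsub>GP\<^esub> t \<in> half P Q" using g by auto
      then have "g \<otimes>\<^bsub>GP\<^esub> t \<otimes>\<^bsub>GP\<^esub> inv\<^bsub>GP\<^esub> t \<in> half P Q \<or> g \<otimes>\<^bsub>GP\<^esub> t \<otimes>\<^bsub>GP\<^esub> inv\<^bsub>GP\<^esub> t \<in> special X"
        using half_letter[of "g \<otimes>\<^bsub>GP\<^esub> t" v "inv\<^bsub>G v\<^esub> b"] v by (simp add: letter_inv)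
      then show ?thesis using eq False by simp
    qed
  qed
  moreover have "finite (special X)" using finite_special split by (simp add: splitting_def)
  ultimately show "finite {g \<in> carrier GP. (g \<in> half P Q) \<noteq> (g \<otimes>\<^bsub>GP\<^esub> t \<in> half P Q)}"
    by (auto elim!: finite_subset)
qed

lemma letter_half:
  assumes "p \<in> P" "s \<in> units p"
  shows "letter p s \<in> special (X \<union> P)" "letter p s \<notin> special X" "letter p s \<in> half P Q"
proof -
  have p: "p \<in> V" "p \<notin> X" using assms split by (auto simp: splitting_def)
  show 1: "letter p s \<in> special (X \<union> P)"
    using assms p by (intro letter_special) (auto simp: units_carrier)
  show 2: "letter p s \<notin> special X" using supp_letter_eq[OF p(1) assms(2)] p by (auto simp: special_def)
  show "letter p s \<in> half P Q" using 1 2 by (rule special_half)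
qed

text \<open>\<open>\<one>\<close>, \<open>a1\<close>, \<open>a2\<close> lie in three cosets of
  \<open>special X\<close> in \<open>special (X \<union> P)\<close>. Both \<open>a1\<close> and
  \<open>a2\<close> send \<open>half Q P\<close> to \<open>half P Q\<close>, and a letter
  \<open>b\<close> over \<open>Q\<close> sends it back, so \<open>b a1\<close> and
  \<open>b a2\<close> map \<open>half Q P\<close> into itself. The images are disjoint because the
  quotient of \<open>a1\<close> and \<open>a2\<close> also moves \<open>half Q P\<close> off
  itself.\<close>

lemma infinitely_many_ends_three_cosets:
  assumes a: "a1 \<in> special (X \<union> P)" "a1 \<notin> special X" "a2 \<in> special (X \<union> P)" "a2 \<notin> special X"
    and a12: "inv\<^bsub>GP\<^esub> a1 \<otimes>\<^bsub>GP\<^esub> a2 \<notin> special X"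
  shows "ends GP = \<infinity>"
proof -
  have sym: "splitting X Q P" by (rule splitting_sym[OF split])
  obtain q where "q \<in> Q" "q \<in> V" using split unfolding splitting_def by blast
  then obtain t where q: "q \<in> Q" "t \<in> units q" "q \<in> V" using units_nonempty by blast
  \<comment> \<open>The surrounding context fixes the order of \<open>P\<close> and
    \<open>Q\<close>; the exported fact is instantiated with the roles exchanged.\<close>
  note b = finite_graph_of_groups.letter_half[OF finite_graph_of_groups_axioms sym q(1,2)]
  let ?b = "letter q t"
  interpret SP: subgroup "special (X \<union> P)" GP by (rule special_subgroup)
  have ac: "a1 \<in> carrier GP" "a2 \<in> carrier GP" "?b \<in> carrier GP"
    using a(1,3) b(1) by (blast dest: special_carrier)+
  have into: "?b \<otimes>\<^bsub>GP\<^esub> a \<otimes>\<^bsub>GP\<^esub> g \<in> half Q P"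
    if "a \<in> special (X \<union> P)" "a \<notin> special X" "g \<in> half Q P" for a g
  proof -
    have "?b \<otimes>\<^bsub>GP\<^esub> (a \<otimes>\<^bsub>GP\<^esub> g) \<in> half Q P"
      using translate_half[OF that] b
      by (intro finite_graph_of_groups.translate_half[OF finite_graph_of_groups_axioms sym])
    moreover have "a \<in> carrier GP" "g \<in> carrier GP"
      using that special_carrier unfolding half_def by blast+
    ultimately show ?thesis using ac by (simp add: GP.m_assoc)
  qed
  show ?thesis
  proof (rule GP.ends_infinite[OF finite_generating_letters])
    show "almost_invariant GP (half Q P)"
      by (rule finite_graph_of_groups.half_almost_invariant[OF finite_graph_of_groups_axioms sym])
    show "half Q P \<noteq> {}" using b by blast
    show "?b \<otimes>\<^bsub>GP\<^esub> a1 \<in> carrier GP" "?b \<otimes>\<^bsub>GP\<^esub> a2 \<in> carrier GP" using ac by auto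
    show "(\<otimes>\<^bsub>GP\<^esub>) (?b \<otimes>\<^bsub>GP\<^esub> a1) ` half Q P \<subseteq> half Q P" "(\<otimes>\<^bsub>GP\<^esub>) (?b \<otimes>\<^bsub>GP\<^esub> a2) ` half Q P \<subseteq> half Q P"
      using into a by auto
    show "disjnt ((\<otimes>\<^bsub>GP\<^esub>) (?b \<otimes>\<^bsub>GP\<^esub> a1) ` half Q P) ((\<otimes>\<^bsub>GP\<^esub>) (?b \<otimes>\<^bsub>GP\<^esub> a2) ` half Q P)"
    proof (rule ccontr)
      assume "\<not> ?thesis"
      then obtain g h where gh: "g \<in> half Q P" "h \<in> half Q P"
        "?b \<otimes>\<^bsub>GP\<^esub> a1 \<otimes>\<^bsub>GP\<^esub> g = ?b \<otimes>\<^bsub>GP\<^esub> a2 \<otimes>\<^bsub>GP\<^esub> h"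
        unfolding disjnt_def by auto
      have c: "g \<in> carrier GP" "h \<in> carrier GP" using gh by (auto simp: half_def)
      then have "a1 \<otimes>\<^bsub>GP\<^esub> g = a2 \<otimes>\<^bsub>GP\<^esub> h" using gh(3) ac by (simp add: GP.m_assoc)
      then have "inv\<^bsub>GP\<^esub> a1 \<otimes>\<^bsub>GP\<^esub> (a1 \<otimes>\<^bsub>GP\<^esub> g) = inv\<^bsub>GP\<^esub> a1 \<otimes>\<^bsub>GP\<^esub> (a2 \<otimes>\<^bsub>GP\<^esub> h)" by simp
      then have "g = inv\<^bsub>GP\<^esub> a1 \<otimes>\<^bsub>GP\<^esub> a2 \<otimes>\<^bsub>GP\<^esub> h"
        using c ac by (simp add: GP.m_assoc[symmetric])
      moreover have "inv\<^bsub>GP\<^esub> a1 \<otimes>\<^bsub>GP\<^esub> a2 \<in> special (X \<union> P)" using a by simp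
      ultimately have "g \<in> half P Q" using translate_half[OF _ a12 gh(2)] by simp
      then show False using half_disjoint[OF split] gh(1) by blast
    qed
  qed
qed

text \<open>The negated condition says that \<open>special X\<close> has index 2 in
  \<open>special (X \<union> P)\<close>. Each way in which it can fail supplies a second nontrivial
  coset besides that of \<open>letter p s\<close>: another vertex of \<open>P\<close>, another
  element of \<open>G p\<close>, or a conjugation moving a letter of \<open>X\<close>.\<close>

lemma infinitely_many_ends:
  assumes "\<not> (\<exists>p. P = {p} \<and> card (carrier (G p)) = 2 \<and> (\<forall>x\<in>X. {p, x} \<in> E))"
  shows "ends GP = \<infinity>"
proof -
  obtain p where "p \<in> P" "p \<in> V" "p \<notin> X" using split unfolding splitting_def by blast
  then obtain s where p: "p \<in> P" "s \<in> units p" "p \<in> V" "p \<notin> X" using units_nonempty by blast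
  note lp = letter_half[OF p(1,2)]
  interpret Gp: group "G p" by (rule groups[OF p(3)])
  have sc: "s \<in> carrier (G p)" using p units_carrier by simp
  have s': "inv\<^bsub>G p\<^esub> s \<in> units p" using units_mult_inv(1)[OF p(3) p(2) p(2)] .
  consider p' where "p' \<in> P" "p' \<noteq> p" | "P = {p}" "card (carrier (G p)) \<noteq> 2"
    | x where "x \<in> X" "{p, x} \<notin> E"
    using assms p by blast
  then show ?thesis
  proof cases
    case 1
    then have "p' \<in> V" "p' \<notin> X" using split unfolding splitting_def by blast+
    then obtain s2 where s2: "s2 \<in> units p'" "p' \<in> V" "p' \<notin> X" using units_nonempty by blast
    have "p' \<notin> D (letter p (inv\<^bsub>G p\<^esub> s))" using 1 by (simp add: D_letter p s')
    then have "supp (letter p (inv\<^bsub>G p\<^esub> s) \<otimes>\<^bsub>GP\<^esub> letter p' s2) = {p', p}"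
      using s2 p s' units_carrier[OF s'] by (simp add: supp_push supp_letter_eq)
    then have "inv\<^bsub>GP\<^esub> (letter p s) \<otimes>\<^bsub>GP\<^esub> letter p' s2 \<notin> special X"
      using p sc by (simp add: letter_inv special_def)
    then show ?thesis using infinitely_many_ends_three_cosets lp letter_half[OF 1(1) s2(1)] by blast
  next
    case 2
    have "\<exists>s2\<in>units p. s2 \<noteq> s"
    proof (rule ccontr)
      assume "\<not> ?thesis"
      then have "carrier (G p) = {\<one>\<^bsub>G p\<^esub>, s}" using sc by (auto simp: units_def)
      moreover have "s \<noteq> \<one>\<^bsub>G p\<^esub>" using p by (simp add: units_def)
      ultimately show False using 2 by simp
    qed
    then obtain s2 where s2: "s2 \<in> units p" "s \<noteq> s2" by blast
    have "inv\<^bsub>G p\<^esub> s \<otimes>\<^bsub>G p\<^esub> s2 \<in> units p" by (rule units_mult_inv(2)[OF p(3,2) s2])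
    then have "letter p (inv\<^bsub>G p\<^esub> s \<otimes>\<^bsub>G p\<^esub> s2) \<notin> special X" by (rule letter_half[OF p(1)])
    then have "inv\<^bsub>GP\<^esub> (letter p s) \<otimes>\<^bsub>GP\<^esub> letter p s2 \<notin> special X"
      using p sc s2 by (simp add: letter_inv letter_mult units_carrier)
    then show ?thesis using infinitely_many_ends_three_cosets lp letter_half[OF p(1) s2(1)] by blast
  next
    \<comment> \<open>Take \<open>a2\<close> as the product of \<open>letter x t\<close> and
      \<open>letter p s\<close>. Then \<open>inv a1\<close> times \<open>a2\<close> is a conjugate
      of \<open>letter x t\<close>, already reduced since \<open>x\<close> and \<open>p\<close> are
      not adjacent, so it keeps \<open>p\<close> in its support.\<close>
    case (3 x)
    then have xV: "x \<in> V" "x \<noteq> p" using split p by (auto simp: splitting_def clique_def)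
    obtain t where t: "t \<in> units x" using units_nonempty xV by blast
    have tc: "t \<in> carrier (G x)" using t units_carrier by simp
    have px: "{x, p} \<notin> E" using 3 by (simp add: insert_commute)
    have l: "letter p s \<in> carrier GP" "letter p (inv\<^bsub>G p\<^esub> s) \<in> carrier GP" "letter x t \<in> carrier GP"
      using p sc xV tc by auto
    have "p \<notin> D (letter x t)" using xV t by (simp add: D_letter)
    then have supp1: "supp (letter x t \<otimes>\<^bsub>GP\<^esub> letter p s) = {p, x}"
      using l p xV t by (simp add: supp_push supp_letter_eq)
    have x1: "x \<notin> D (letter p (inv\<^bsub>G p\<^esub> s))" using xV p s' by (simp add: D_letter)
    then have "p \<notin> D (letter p (inv\<^bsub>G p\<^esub> s) \<otimes>\<^bsub>GP\<^esub> letter x t)"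
      using l xV p t 3 s' by (simp add: D_push D_letter)
    then have "supp (letter p (inv\<^bsub>G p\<^esub> s) \<otimes>\<^bsub>GP\<^esub> letter x t \<otimes>\<^bsub>GP\<^esub> letter p s) = {p, x}"
      using x1 l xV p t s' by (auto simp: supp_push supp_letter_eq)
    then have "letter p (inv\<^bsub>G p\<^esub> s) \<otimes>\<^bsub>GP\<^esub> (letter x t \<otimes>\<^bsub>GP\<^esub> letter p s) \<notin> special X"
      using l p by (simp add: special_def GP.m_assoc)
    then have "inv\<^bsub>GP\<^esub> (letter p s) \<otimes>\<^bsub>GP\<^esub> (letter x t \<otimes>\<^bsub>GP\<^esub> letter p s) \<notin> special X"
      using p sc by (simp add: letter_inv)
    moreover have "letter x t \<otimes>\<^bsub>GP\<^esub> letter p s \<in> special (X \<union> P)"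
      using lp letter_special[of x "X \<union> P" t] 3 xV tc
      by (intro subgroup.m_closed[OF special_subgroup]) auto
    moreover have "letter x t \<otimes>\<^bsub>GP\<^esub> letter p s \<notin> special X" using supp1 p by (simp add: special_def)
    ultimately show ?thesis using infinitely_many_ends_three_cosets lp by blast
  qed
qed

end

end

subsection \<open>The two-ended case\<close>

primrec alt :: "('a, 'b) monoid_scheme \<Rightarrow> 'a \<Rightarrow> 'a \<Rightarrow> nat \<Rightarrow> 'a" where
  "alt M x y 0 = \<one>\<^bsub>M\<^esub>"
| "alt M x y (Suc n) = alt M x y n \<otimes>\<^bsub>M\<^esub> (if even n then x else y)"

lemma (in group) alt_closed: "x \<in> carrier G \<Longrightarrow> y \<in> carrier G \<Longrightarrow> alt G x y n \<in> carrier G"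
  by (induction n) auto

text \<open>Multiplying by an involution appends a letter or cancels the last one. Only
  \<open>y\<close> applied to the empty word changes to the other ray.\<close>

lemma (in group) alt_mult:
  assumes x: "x \<in> carrier G" "x \<otimes> x = \<one>" and y: "y \<in> carrier G" "y \<otimes> y = \<one>"
  shows "alt G x y n \<otimes> x \<in> range (alt G x y)"
    and "alt G x y n \<otimes> y \<in> range (alt G x y) \<union> range (alt G y x)"
proof -
  have cancel: "alt G x y m \<otimes> z \<otimes> z = alt G x y m" if "z \<in> carrier G" "z \<otimes> z = \<one>" for m z
    using that x y by (simp add: m_assoc alt_closed)
  show "alt G x y n \<otimes> x \<in> range (alt G x y)"
  proof (cases "even n")
    case True
    then show ?thesis by (intro range_eqI[of _ _ "Suc n"]) simp
  next
    case False
    then obtain m where "n = Suc m" "even m" by (cases n) auto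
    then show ?thesis using cancel[OF x] by (intro range_eqI[of _ _ m]) simp
  qed
  show "alt G x y n \<otimes> y \<in> range (alt G x y) \<union> range (alt G y x)"
  proof (cases n)
    case 0
    then have "alt G x y n \<otimes> y = alt G y x (Suc 0)" by simp
    then show ?thesis by blast
  next
    case (Suc m)
    show ?thesis
    proof (cases "even m")
      case True
      then have "alt G x y n \<otimes> y = alt G x y (Suc n)" using Suc by simp
      then show ?thesis by blast
    next
      case False
      then have "alt G x y n \<otimes> y = alt G x y m" using Suc cancel[OF y] by simp
      then show ?thesis by blast
    qed
  qed
qed

context finite_graph_of_groups
begin

text \<open>The last vertex has to be tracked along with the length: as it is not adjacent to the
  next one, every step is a push and leaves a single final vertex.\<close>

lemma alt_length:
  assumes "p \<in> V" "s \<in> units p" "q \<in> V" "t \<in> units q" "p \<noteq> q" "{p, q} \<notin> E"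
  shows "L (alt GP (letter p s) (letter q t) n) = n \<and>
    D (alt GP (letter p s) (letter q t) n) = (if n = 0 then {} else if even n then {q} else {p})"
proof (induction n)
  case 0
  show ?case by (simp add: L_one D_one)
next
  case (Suc n)
  let ?w = "alt GP (letter p s) (letter q t) n"
  have w: "?w \<in> carrier GP"
    using assms by (intro GP.alt_closed letter_closed units_carrier)
  have pq: "{q, p} \<notin> E" using assms by (simp add: insert_commute)
  show ?case
  proof (cases "even n")
    case True
    then have *: "p \<notin> D ?w" "{w \<in> D ?w. {w, p} \<in> E} = {}"
      using Suc assms(5) pq by (auto split: if_splits)
    have "D (?w \<otimes>\<^bsub>GP\<^esub> letter p s) = {p}"
      unfolding D_push[OF w assms(1) *(1) assms(2)] *(2) ..
    then show ?thesis
      using True conjunct1[OF Suc] L_push[OF w assms(1) *(1) assms(2)] by simp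
  next
    case False
    then have *: "q \<notin> D ?w" "{w \<in> D ?w. {w, q} \<in> E} = {}"
      using Suc assms(5,6) by (auto split: if_splits)
    have "D (?w \<otimes>\<^bsub>GP\<^esub> letter q t) = {q}"
      unfolding D_push[OF w assms(3) *(1) assms(4)] *(2) ..
    then show ?thesis
      using False conjunct1[OF Suc] L_push[OF w assms(3) *(1) assms(4)] by simp
  qed
qed

lemma special_commute:
  assumes "c \<in> special X" "v \<in> V" "a \<in> carrier (G v)" "\<And>x. x \<in> X \<Longrightarrow> {v, x} \<in> E"
  shows "c \<otimes>\<^bsub>GP\<^esub> letter v a = letter v a \<otimes>\<^bsub>GP\<^esub> c"
  using assms(1)
proof (induction rule: special_induct)
  case one
  then show ?case using assms by simp
next
  case (push g u b)
  have c: "g \<in> carrier GP" "b \<in> carrier (G u)" "letter u b \<in> carrier GP" "letter v a \<in> carrier GP"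
    using push assms by (auto simp: special_carrier units_carrier)
  have "g \<otimes>\<^bsub>GP\<^esub> letter u b \<otimes>\<^bsub>GP\<^esub> letter v a = g \<otimes>\<^bsub>GP\<^esub> letter v a \<otimes>\<^bsub>GP\<^esub> letter u b"
    using letter_commute[OF assms(4)[OF \<open>u \<in> X\<close>] assms(3) c(2)] c by (simp add: GP.m_assoc)
  also have "\<dots> = letter v a \<otimes>\<^bsub>GP\<^esub> (g \<otimes>\<^bsub>GP\<^esub> letter u b)"
    using push c by (simp add: GP.m_assoc)
  finally show ?case .
qed

text \<open>Far out, neither a step along the ray nor right multiplication by
  \<open>special X\<close> changes membership in \<open>A\<close>. So a whole tail of the ray,
  thickened by \<open>special X\<close>, lies inside or outside \<open>A\<close>.\<close>

lemma ray_tail: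
  assumes A: "almost_invariant GP A" and X: "finite (special X)"
    and w: "\<And>n. w n \<in> carrier GP" "\<And>n. L (w n) = n"
      "\<And>n. \<exists>t\<in>letters. w (Suc n) = w n \<otimes>\<^bsub>GP\<^esub> t"
  obtains N where "\<And>n c. N < n \<Longrightarrow> c \<in> special X \<Longrightarrow> w n \<otimes>\<^bsub>GP\<^esub> c \<in> A \<longleftrightarrow> w (Suc N) \<in> A"
proof -
  have "finite (letters \<union> special X)" "letters \<union> special X \<subseteq> carrier GP"
    using X finite_generating_letters by (auto simp: finite_generating_set_def special_carrier)
  then obtain N where N: "\<And>g t. g \<in> carrier GP \<Longrightarrow> t \<in> letters \<union> special X \<Longrightarrow> N < L g \<Longrightarrow>
      g \<in> A \<longleftrightarrow> g \<otimes>\<^bsub>GP\<^esub> t \<in> A"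
    using almost_invariant_bound[OF A, of "letters \<union> special X" thesis] by metis
  have ray: "w (Suc N + k) \<in> A \<longleftrightarrow> w (Suc N) \<in> A" for k
  proof (induction k)
    case (Suc k)
    obtain t where "t \<in> letters" "w (Suc (Suc N + k)) = w (Suc N + k) \<otimes>\<^bsub>GP\<^esub> t" using w(3) by blast
    then show ?case using N[of "w (Suc N + k)" t] w Suc by simp
  qed simp
  show thesis
  proof (rule that)
    fix n c assume "N < n" "c \<in> special X"
    then have "w n \<otimes>\<^bsub>GP\<^esub> c \<in> A \<longleftrightarrow> w n \<in> A" using N[of "w n" c] w by simp
    also have "\<dots> \<longleftrightarrow> w (Suc N) \<in> A" using ray[of "n - Suc N"] \<open>N < n\<close> by simp
    finally show "w n \<otimes>\<^bsub>GP\<^esub> c \<in> A \<longleftrightarrow> w (Suc N) \<in> A" .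
  qed
qed

text \<open>For the upper bound, every infinite almost invariant set contains a tail of one of two
  rays, and disjoint sets cannot share a tail. The two halves give the lower bound.\<close>

lemma two_ends:
  assumes split: "splitting X {p} {q}" and card: "card (carrier (G p)) = 2" "card (carrier (G q)) = 2"
    and adj: "\<And>x. x \<in> X \<Longrightarrow> {p, x} \<in> E" "\<And>x. x \<in> X \<Longrightarrow> {q, x} \<in> E"
  shows "ends GP = 2"
proof -
  have V: "V = X \<union> {p, q}" "p \<in> V" "q \<in> V" "p \<noteq> q" "{p, q} \<notin> E" and "clique X"
    using split by (auto simp: splitting_def)
  have invol: "\<exists>s. carrier (G v) = {\<one>\<^bsub>G v\<^esub>, s} \<and> s \<in> units v \<and> s \<otimes>\<^bsub>G v\<^esub> s = \<one>\<^bsub>G v\<^esub>"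
    if v: "v \<in> V" "card (carrier (G v)) = 2" for v
  proof -
    interpret group "G v" by (rule groups[OF v(1)])
    obtain s where s: "s \<in> units v" using units_nonempty[OF v(1)] by blast
    then have sc: "s \<in> carrier (G v)" "s \<noteq> \<one>\<^bsub>G v\<^esub>" by (auto simp: units_def)
    have eq: "carrier (G v) = {\<one>\<^bsub>G v\<^esub>, s}"
    proof (rule sym, rule card_subset_eq)
      show "card {\<one>\<^bsub>G v\<^esub>, s} = card (carrier (G v))" using v sc by simp
    qed (use finite_G v sc in auto)
    have "s \<otimes>\<^bsub>G v\<^esub> s \<noteq> s" using sc by simp
    moreover have "s \<otimes>\<^bsub>G v\<^esub> s \<in> {\<one>\<^bsub>G v\<^esub>, s}" using sc eq[symmetric] by simp
    ultimately show ?thesis using eq s by blast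
  qed
  obtain s where s: "carrier (G p) = {\<one>\<^bsub>G p\<^esub>, s}" "s \<in> units p" "s \<otimes>\<^bsub>G p\<^esub> s = \<one>\<^bsub>G p\<^esub>"
    using invol V card by blast
  obtain t where t: "carrier (G q) = {\<one>\<^bsub>G q\<^esub>, t}" "t \<in> units q" "t \<otimes>\<^bsub>G q\<^esub> t = \<one>\<^bsub>G q\<^esub>"
    using invol V card by blast
  define a where "a = letter p s"
  define b where "b = letter q t"
  have sc: "s \<in> carrier (G p)" "t \<in> carrier (G q)" using s t by auto
  have ab: "a \<in> carrier GP" "b \<in> carrier GP" "a \<otimes>\<^bsub>GP\<^esub> a = \<one>\<^bsub>GP\<^esub>" "b \<otimes>\<^bsub>GP\<^esub> b = \<one>\<^bsub>GP\<^esub>"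
    "a \<in> letters" "b \<in> letters"
    using V s(3) t(3) sc by (auto simp: a_def b_def letter_mult letter_one letters_def)
  define w where "w = alt GP a b"
  define w' where "w' = alt GP b a"
  have wc: "w n \<in> carrier GP" "w' n \<in> carrier GP" for n
    unfolding w_def w'_def using ab by (auto intro: GP.alt_closed)
  have qp: "{q, p} \<notin> E" using V by (simp add: insert_commute)
  have wL: "L (w n) = n" "L (w' n) = n" for n
    unfolding w_def w'_def a_def b_def
    using alt_length[OF V(2) s(2) V(3) t(2) V(4,5)] alt_length[OF V(3) t(2) V(2) s(2) _ qp] V(4) by auto
  have wS: "\<exists>t\<in>letters. w (Suc n) = w n \<otimes>\<^bsub>GP\<^esub> t" "\<exists>t\<in>letters. w' (Suc n) = w' n \<otimes>\<^bsub>GP\<^esub> t" for n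
    unfolding w_def w'_def using ab by auto
  let ?W = "range w \<union> range w'"
  have Wa: "u \<otimes>\<^bsub>GP\<^esub> a \<in> ?W" "u \<otimes>\<^bsub>GP\<^esub> b \<in> ?W" if "u \<in> ?W" for u
    using that GP.alt_mult[OF ab(1,3,2,4)] GP.alt_mult[OF ab(2,4,1,3)] unfolding w_def w'_def by blast+
  have fX: "finite (special X)" by (rule finite_special[OF \<open>clique X\<close>])
  \<comment> \<open>Letters over \<open>X\<close> are absorbed into the factor \<open>c\<close>; the
    letters at \<open>p\<close> and \<open>q\<close> commute past \<open>c\<close> and move along
    the rays.\<close>
  have cover: "\<exists>u\<in>?W. \<exists>c\<in>special X. g = u \<otimes>\<^bsub>GP\<^esub> c" if "g \<in> carrier GP" for g
    using that
  proof (induction rule: GP_induct)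
    case one
    have "w 0 = \<one>\<^bsub>GP\<^esub>" by (simp add: w_def)
    then have "\<one>\<^bsub>GP\<^esub> = w 0 \<otimes>\<^bsub>GP\<^esub> \<one>\<^bsub>GP\<^esub>" by simp
    then show ?case using special_one by blast
  next
    case (mult g v e)
    then obtain u c where uc: "u \<in> ?W" "c \<in> special X" "g = u \<otimes>\<^bsub>GP\<^esub> c" by blast
    then have cc: "u \<in> carrier GP" "c \<in> carrier GP" using wc by (auto simp: special_carrier)
    show ?case
    proof (cases "v \<in> X \<or> e = \<one>\<^bsub>G v\<^esub>")
      case True
      then have "c \<otimes>\<^bsub>GP\<^esub> letter v e \<in> special X"
        using mult uc cc by (auto simp: letter_one special_letter_right)
      moreover have "g \<otimes>\<^bsub>GP\<^esub> letter v e = u \<otimes>\<^bsub>GP\<^esub> (c \<otimes>\<^bsub>GP\<^esub> letter v e)"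
        using uc cc mult by (simp add: GP.m_assoc)
      ultimately show ?thesis using uc by blast
    next
      case False
      then have ve: "(v = p \<and> e = s) \<or> (v = q \<and> e = t)" using mult V s(1) t(1) by auto
      then have "letter v e = a \<or> letter v e = b" by (auto simp: a_def b_def)
      moreover have "c \<otimes>\<^bsub>GP\<^esub> letter v e = letter v e \<otimes>\<^bsub>GP\<^esub> c"
        using special_commute[OF uc(2) mult.hyps(2,3)] adj ve by blast
      ultimately have "g \<otimes>\<^bsub>GP\<^esub> letter v e = u \<otimes>\<^bsub>GP\<^esub> letter v e \<otimes>\<^bsub>GP\<^esub> c" "u \<otimes>\<^bsub>GP\<^esub> letter v e \<in> ?W"
        using uc cc mult Wa[OF uc(1)] by (auto simp: GP.m_assoc)
      then show ?thesis using uc by blast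
    qed
  qed
  \<comment> \<open>If \<open>A\<close> contained neither tail, it would lie in the product of two
    finite initial segments with the finite group \<open>special X\<close>.\<close>
  have dich: "(\<exists>N. \<forall>n>N. w n \<in> A) \<or> (\<exists>N. \<forall>n>N. w' n \<in> A)"
    if A: "almost_invariant GP A" "infinite A" for A
  proof -
    obtain N where N: "\<And>n c. N < n \<Longrightarrow> c \<in> special X \<Longrightarrow> w n \<otimes>\<^bsub>GP\<^esub> c \<in> A \<longleftrightarrow> w (Suc N) \<in> A"
      using ray_tail[OF A(1) fX, of w] wc wL wS by blast
    obtain N' where N': "\<And>n c. N' < n \<Longrightarrow> c \<in> special X \<Longrightarrow> w' n \<otimes>\<^bsub>GP\<^esub> c \<in> A \<longleftrightarrow> w' (Suc N') \<in> A"
      using ray_tail[OF A(1) fX, of w'] wc wL wS by blast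
    have "w (Suc N) \<in> A \<or> w' (Suc N') \<in> A"
    proof (rule ccontr)
      assume n: "\<not> ?thesis"
      have "A \<subseteq> (\<lambda>(u, c). u \<otimes>\<^bsub>GP\<^esub> c) ` ((w ` {..N} \<union> w' ` {..N'}) \<times> special X)"
      proof
        fix g assume g: "g \<in> A"
        then obtain u c where uc: "u \<in> ?W" "c \<in> special X" "g = u \<otimes>\<^bsub>GP\<^esub> c"
          using cover A(1) unfolding almost_invariant_def by blast
        from uc(1) have "u \<in> w ` {..N} \<union> w' ` {..N'}"
        proof
          assume "u \<in> range w"
          then obtain k where k: "u = w k" by blast
          have "\<not> N < k" using N[of k c] n g uc(2,3) k by blast
          then show ?thesis using k by (simp add: not_less)
        next
          assume "u \<in> range w'"
          then obtain k where k: "u = w' k" by blast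
          have "\<not> N' < k" using N'[of k c] n g uc(2,3) k by blast
          then show ?thesis using k by (simp add: not_less)
        qed
        then show "g \<in> (\<lambda>(u, c). u \<otimes>\<^bsub>GP\<^esub> c) ` ((w ` {..N} \<union> w' ` {..N'}) \<times> special X)"
          using uc by force
      qed
      then show False using A(2) fX by (auto dest: finite_subset)
    qed
    then show ?thesis
    proof
      assume "w (Suc N) \<in> A"
      then have "\<forall>n>N. w n \<in> A" using N[OF _ special_one] wc by simp
      then show ?thesis by blast
    next
      assume "w' (Suc N') \<in> A"
      then have "\<forall>n>N'. w' n \<in> A" using N'[OF _ special_one] wc by simp
      then show ?thesis by blast
    qed
  qed
  have "ends GP \<le> enat 2"
  proof (rule GP.ends_le[OF finite_generating_letters])
    fix \<A> :: "('v \<times> 'a) list set set set set"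
    assume \<A>: "finite \<A>" "pairwise disjnt \<A>" "\<And>A. A \<in> \<A> \<Longrightarrow> infinite A"
      "\<And>A. A \<in> \<A> \<Longrightarrow> almost_invariant GP A"
    have le1: "card {A \<in> \<A>. \<exists>N::nat. \<forall>n>N. f n \<in> A} \<le> Suc 0" for f :: "nat \<Rightarrow> ('v \<times> 'a) list set set"
    proof -
      have "A = B" if "A \<in> \<A>" "B \<in> \<A>" "\<forall>n>N. f n \<in> A" "\<forall>n>M. f n \<in> B" for A B N M
      proof (rule ccontr)
        assume "A \<noteq> B"
        then have "disjnt A B" using that \<A>(2) by (simp add: pairwise_def)
        moreover have "f (Suc (N + M)) \<in> A" "f (Suc (N + M)) \<in> B" using that by auto
        ultimately show False unfolding disjnt_def by blast
      qed
      then show ?thesis using \<A>(1) by (subst card_le_Suc0_iff_eq) auto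
    qed
    have "\<A> = {A \<in> \<A>. \<exists>N. \<forall>n>N. w n \<in> A} \<union> {A \<in> \<A>. \<exists>N. \<forall>n>N. w' n \<in> A}"
      using dich \<A>(3,4) by blast
    then have "card \<A> \<le> card {A \<in> \<A>. \<exists>N. \<forall>n>N. w n \<in> A} + card {A \<in> \<A>. \<exists>N. \<forall>n>N. w' n \<in> A}"
      by (metis (no_types, lifting) card_Un_le)
    then show "card \<A> \<le> 2" using le1[of w] le1[of w'] by linarith
  qed
  moreover have "enat (card {half {p} {q}, half {q} {p}}) \<le> ends GP"
  proof (rule GP.ends_ge[OF finite_generating_letters])
    have sym: "splitting X {q} {p}" by (rule splitting_sym[OF split])
    \<comment> \<open>A letter over \<open>Q\<close> translates \<open>half P Q\<close> injectively
      into \<open>half Q P\<close>. So the halves are finite together, which the infinite group with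
      finite \<open>special X\<close> excludes.\<close>
    have inj: "finite (half P Q)" if "splitting X P Q" "finite (half Q P)" for P Q
    proof -
      obtain v where v: "v \<in> Q" "v \<in> V" using \<open>splitting X P Q\<close> unfolding splitting_def by blast
      then obtain c where c: "c \<in> units v" using units_nonempty by blast
      note sym' = splitting_sym[OF that(1)]
      have "(\<otimes>\<^bsub>GP\<^esub>) (letter v c) ` half P Q \<subseteq> half Q P"
        using translate_half[OF sym' letter_half(1,2)[OF sym' v(1) c]] by blast
      moreover have "half P Q \<subseteq> carrier GP" by (auto simp: half_def)
      ultimately show ?thesis
        using that(2) GP.card_translate(3)[of "letter v c" "half P Q"] v c
        by (simp add: units_carrier finite_subset)
    qed
    have "carrier GP = special X \<union> half {p} {q} \<union> half {q} {p}"
      using half_trichotomy[OF split] by (auto simp: half_def special_carrier)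
    moreover have "\<not> clique V" using V unfolding clique_def by blast
    ultimately have "infinite (half {p} {q}) \<and> infinite (half {q} {p})"
      using infinite_GP fX inj[OF split] inj[OF sym] by fastforce
    then show "infinite A" if "A \<in> {half {p} {q}, half {q} {p}}" for A using that by blast
    show "almost_invariant GP A" if "A \<in> {half {p} {q}, half {q} {p}}" for A
      using that half_almost_invariant[OF split] half_almost_invariant[OF sym] by blast
    show "pairwise disjnt {half {p} {q}, half {q} {p}}"
      using half_disjoint[OF split] half_disjoint[OF sym] by (auto simp: pairwise_def disjnt_def)
  qed simp
  moreover have "half {p} {q} \<noteq> half {q} {p}"
    using letter_half(3)[OF split _ s(2)] half_disjoint[OF split] by blast
  ultimately show ?thesis by (simp add: numeral_eq_enat numeral_2_eq_2 order_antisym)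
qed

subsection \<open>The four cases\<close>

lemma complete_graph_iff: "complete_graph \<Gamma> \<longleftrightarrow> clique V"
  by (auto simp: complete_graph_def clique_def)

text \<open>A single component is taken as \<open>P\<close> and everything else outside
  \<open>\<Delta>\<close> as \<open>Q\<close>. Conversely, a path avoiding \<open>X\<close> that
  starts in \<open>P\<close> never reaches \<open>Q\<close>.\<close>

lemma splitting_iff:
  "(\<exists>\<Delta>. complete_graph \<Delta> \<and> separating_subgraph \<Delta> \<Gamma>) \<longleftrightarrow> (\<exists>X P Q. splitting X P Q)"
proof
  assume "\<exists>\<Delta>. complete_graph \<Delta> \<and> separating_subgraph \<Delta> \<Gamma>"
  then obtain \<Delta> A B where \<Delta>: "complete_graph \<Delta>" "subgraph \<Delta> \<Gamma>"
    "A \<in> components (graph_minus \<Gamma> \<Delta>)" "B \<in> components (graph_minus \<Gamma> \<Delta>)" "A \<noteq> B"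
    unfolding separating_subgraph_def by blast
  let ?M = "graph_minus \<Gamma> \<Delta>"
  have M: "verts ?M = V - verts \<Delta>" "edges ?M = {e \<in> E. e \<subseteq> V - verts \<Delta>}"
    by (auto simp: graph_minus_def full_subgraph_def)
  obtain x where x: "x \<in> verts ?M" "A = {y \<in> verts ?M. (x, y) \<in> (adj ?M)\<^sup>*}"
    using \<Delta>(3) unfolding in_components_iff by blast
  obtain y where y: "y \<in> verts ?M" "B = {z \<in> verts ?M. (y, z) \<in> (adj ?M)\<^sup>*}"
    using \<Delta>(4) unfolding in_components_iff by blast
  have mem: "x \<in> A" "y \<in> B" using x y by auto
  have "y \<notin> A" using components_disjnt[OF \<Delta>(3-5)] mem by (auto simp: disjnt_def)
  have "splitting (verts \<Delta>) A (V - verts \<Delta> - A)"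
    unfolding splitting_def
  proof (intro conjI ballI)
    show "clique (verts \<Delta>)"
      using \<Delta>(1,2) unfolding clique_def complete_graph_def subgraph_def by blast
    have "verts \<Delta> \<subseteq> V" using \<Delta>(2) by (simp add: subgraph_def)
    then show "verts \<Delta> \<union> A \<union> (V - verts \<Delta> - A) = V" using x M by auto
    show "verts \<Delta> \<inter> A = {}" using x M by auto
    show "V - verts \<Delta> - A \<noteq> {}" using y(1) \<open>y \<notin> A\<close> M by blast
    fix u v assume uv: "u \<in> A" "v \<in> V - verts \<Delta> - A"
    show "{u, v} \<notin> E"
    proof
      assume "{u, v} \<in> E"
      then have "(u, v) \<in> adj ?M" using uv x M by (auto simp: adj_def)
      then have "v \<in> A" using uv x M by (auto intro: rtrancl_into_rtrancl)
      then show False using uv by simp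
    qed
  qed (use mem in auto)
  then show "\<exists>X P Q. splitting X P Q" by blast
next
  assume "\<exists>X P Q. splitting X P Q"
  then obtain X P Q where split: "splitting X P Q" by blast
  let ?\<Delta> = "full_subgraph \<Gamma> X"
  let ?M = "graph_minus \<Gamma> ?\<Delta>"
  have X: "X \<subseteq> V" using split by (simp add: splitting_def clique_def)
  have \<Delta>: "verts ?\<Delta> = X" "edges ?\<Delta> = {e \<in> E. e \<subseteq> X}" using X by (auto simp: full_subgraph_def)
  have M: "verts ?M = P \<union> Q" "edges ?M = {e \<in> E. e \<subseteq> P \<union> Q}"
  proof -
    have "V - X = P \<union> Q" "P \<union> Q \<subseteq> V" using split unfolding splitting_def by blast+
    then show "verts ?M = P \<union> Q" "edges ?M = {e \<in> E. e \<subseteq> P \<union> Q}"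
      unfolding graph_minus_def \<Delta>(1) by (auto simp: full_subgraph_def)
  qed
  obtain p q where pq: "p \<in> P" "q \<in> Q" using split unfolding splitting_def by blast
  let ?C = "\<lambda>x. {y \<in> verts ?M. (x, y) \<in> (adj ?M)\<^sup>*}"
  have "y \<in> P" if "(p, y) \<in> (adj ?M)\<^sup>*" for y
    using that
  proof induction
    case (step y z)
    then have "{y, z} \<in> E" "z \<in> P \<union> Q" using M by (auto simp: adj_def)
    then show ?case using step.IH split by (auto simp: splitting_def)
  qed (rule pq)
  moreover have "q \<notin> P" using split pq by (auto simp: splitting_def)
  moreover have "q \<in> ?C q" using pq M by simp
  ultimately have "?C p \<noteq> ?C q" by blast
  moreover have "?C p \<in> components ?M" "?C q \<in> components ?M"
    using pq M unfolding in_components_iff by blast+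
  moreover have "complete_graph ?\<Delta>"
    using split unfolding complete_graph_def \<Delta> splitting_def clique_def by auto
  moreover have "subgraph ?\<Delta> \<Gamma>"
    using X simplicial unfolding subgraph_def \<Delta> simplicial_graph_def by auto
  ultimately show "\<exists>\<Delta>. complete_graph \<Delta> \<and> separating_subgraph \<Delta> \<Gamma>"
    unfolding separating_subgraph_def
    by (intro exI[of _ ?\<Delta>] conjI bexI[of _ "?C p"] bexI[of _ "?C q"])
qed

text \<open>In a disconnected graph the empty clique already splits off a component.\<close>

lemma connected_if_nonsplit:
  assumes "\<And>X P Q. \<not> splitting X P Q" shows "connected_graph \<Gamma>"
  unfolding connected_graph_def
proof (intro ballI, rule ccontr)
  fix u v assume uv: "u \<in> V" "v \<in> V" "(u, v) \<notin> (adj \<Gamma>)\<^sup>*"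
  let ?P = "{w \<in> V. (u, w) \<in> (adj \<Gamma>)\<^sup>*}"
  have "splitting {} ?P (V - ?P)"
    unfolding splitting_def clique_def
  proof (intro conjI ballI)
    fix p q assume "p \<in> ?P" "q \<in> V - ?P"
    then show "{p, q} \<notin> E" by (auto simp: adj_def intro: rtrancl_into_rtrancl)
  qed (use uv in auto)
  then show False using assms by blast
qed

lemma ends_complete: assumes "clique V" shows "ends GP = 0"
proof -
  have fin: "finite (carrier GP)" using finite_special[OF assms] by (simp add: special_V)
  have "ends GP \<le> enat 0"
  proof (rule GP.ends_le[OF finite_generating_letters])
    fix \<A> assume \<A>: "\<And>A. A \<in> \<A> \<Longrightarrow> infinite A" "\<And>A. A \<in> \<A> \<Longrightarrow> almost_invariant GP A"
    have "A \<notin> \<A>" for A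
      using \<A>[of A] finite_subset[OF _ fin, of A] unfolding almost_invariant_def by metis
    then have "\<A> = {}" by blast
    then show "card \<A> \<le> 0" by simp
  qed
  then show ?thesis by (simp add: zero_enat_def[symmetric])
qed

text \<open>Of two disjoint infinite almost invariant sets neither could be cofinite; the whole
  group is one such set.\<close>

lemma ends_nonsplit:
  assumes "\<And>X P Q. \<not> splitting X P Q" "\<not> clique V" shows "ends GP = 1"
proof -
  have "ends GP \<le> enat 1"
  proof (rule GP.ends_le[OF finite_generating_letters])
    fix \<A> assume \<A>: "finite \<A>" "pairwise disjnt \<A>" "\<And>A. A \<in> \<A> \<Longrightarrow> infinite A"
      "\<And>A. A \<in> \<A> \<Longrightarrow> almost_invariant GP A"
    have "A = B" if AB: "A \<in> \<A>" "B \<in> \<A>" for A B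
    proof (rule ccontr)
      assume "A \<noteq> B"
      then have "disjnt A B" using AB \<A>(2) by (simp add: pairwise_def)
      then have "B \<subseteq> carrier GP - A"
        using \<A>(4)[OF AB(2)] unfolding almost_invariant_def disjnt_def by blast
      moreover have "finite (carrier GP - A)"
        using almost_invariant_trivial[OF assms \<A>(4)[OF AB(1)]] \<A>(3)[OF AB(1)] by blast
      ultimately show False using \<A>(3)[OF AB(2)] finite_subset by blast
    qed
    then show "card \<A> \<le> 1" using \<A>(1) by (simp add: card_le_Suc0_iff_eq)
  qed
  moreover have "enat (card {carrier GP}) \<le> ends GP"
  proof (rule GP.ends_ge[OF finite_generating_letters])
    have empty: "{g \<in> carrier GP. (g \<in> carrier GP) \<noteq> (g \<otimes>\<^bsub>GP\<^esub> t \<in> carrier GP)} = {}"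
      if "t \<in> carrier GP" for t
      using that by simp
    have "almost_invariant GP (carrier GP)"
      unfolding almost_invariant_def
    proof (intro conjI ballI subset_refl)
      fix t assume "t \<in> carrier GP"
      then show "finite {g \<in> carrier GP. (g \<in> carrier GP) \<noteq> (g \<otimes>\<^bsub>GP\<^esub> t \<in> carrier GP)}"
        by (simp only: empty finite.emptyI)
    qed
    then show "almost_invariant GP A" if "A \<in> {carrier GP}" for A using that by simp
  qed (use infinite_GP[OF assms(2)] in simp_all)
  ultimately show ?thesis by (simp add: one_enat_def)
qed

text \<open>The condition on \<open>\<Gamma>2\<close> in terms of vertices and orders; a group of
  order 2 is determined up to isomorphism. In this case \<open>special {p, q}\<close> is the
  infinite dihedral group.\<close>

definition dihedral :: bool where
  "dihedral \<longleftrightarrow> (\<exists>p q. p \<noteq> q \<and> V - {v \<in> V. \<forall>w\<in>V. w \<noteq> v \<longrightarrow> {v, w} \<in> E} = {p, q} \<and> {p, q} \<notin> E \<and>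
     card (carrier (G p)) = 2 \<and> card (carrier (G q)) = 2)"

lemma ends_dihedral:
  assumes dihedral shows "ends GP = 2 \<and> (\<exists>X P Q. splitting X P Q)"
proof -
  let ?X = "{v \<in> V. \<forall>w\<in>V. w \<noteq> v \<longrightarrow> {v, w} \<in> E}"
  obtain p q where pq: "p \<noteq> q" "V - ?X = {p, q}" "{p, q} \<notin> E"
    "card (carrier (G p)) = 2" "card (carrier (G q)) = 2"
    using assms unfolding dihedral_def by blast
  have V: "p \<in> V" "q \<in> V" "p \<notin> ?X" "q \<notin> ?X" "?X \<union> {p} \<union> {q} = V" "?X \<inter> {p} = {}" "?X \<inter> {q} = {}"
    using pq(2) by blast+
  have "splitting ?X {p} {q}"
    unfolding splitting_def
  proof (intro conjI)
    show "clique ?X" by (auto simp: clique_def)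
  qed (use V(5-7) pq(1,3) in simp_all)
  moreover have "{p, x} \<in> E" "{q, x} \<in> E" if "x \<in> ?X" for x
  proof -
    have "p \<noteq> x" "q \<noteq> x" using that V(3,4) by metis+
    then have "{x, p} \<in> E" "{x, q} \<in> E" using that V(1,2) by simp_all
    then show "{p, x} \<in> E" "{q, x} \<in> E" by (simp_all add: insert_commute)
  qed
  ultimately show ?thesis using two_ends pq by blast
qed

text \<open>If \<open>ends\<close> is finite, both sides are exceptional single vertices joined to
  all of \<open>X\<close>. Then \<open>X\<close> is exactly the set of vertices adjacent to all
  others, and \<open>p\<close>, \<open>q\<close> are the vertices of
  \<open>\<Gamma>2\<close>.\<close>

lemma ends_split:
  assumes split: "splitting X P Q" and "\<not> dihedral" shows "ends GP = \<infinity>"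
proof (rule ccontr)
  assume n: "ends GP \<noteq> \<infinity>"
  obtain p where p: "P = {p}" "card (carrier (G p)) = 2" "\<forall>x\<in>X. {p, x} \<in> E"
    using infinitely_many_ends[OF split] n by blast
  obtain q where q: "Q = {q}" "card (carrier (G q)) = 2" "\<forall>x\<in>X. {q, x} \<in> E"
    using infinitely_many_ends[OF splitting_sym[OF split]] n by blast
  have s: "clique X" "V = X \<union> {p, q}" "p \<notin> X" "q \<notin> X" "p \<noteq> q" "{p, q} \<notin> E"
    using split p q unfolding splitting_def by auto
  have *: "{v \<in> V. \<forall>w\<in>V. w \<noteq> v \<longrightarrow> {v, w} \<in> E} = X"
  proof -
    have "x \<in> V \<and> (\<forall>w\<in>V. w \<noteq> x \<longrightarrow> {x, w} \<in> E)" if "x \<in> X" for x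
      using that s(1,2) p(3) q(3) unfolding clique_def by (auto simp: insert_commute)
    moreover have "\<not> (\<forall>w\<in>V. w \<noteq> p \<longrightarrow> {p, w} \<in> E)" "\<not> (\<forall>w\<in>V. w \<noteq> q \<longrightarrow> {q, w} \<in> E)"
      using s by (auto simp: insert_commute)
    ultimately show ?thesis using s(2) by blast
  qed
  have "V - {v \<in> V. \<forall>w\<in>V. w \<noteq> v \<longrightarrow> {v, w} \<in> E} = {p, q}"
    unfolding * using s(2-4) by blast
  then have dihedral
    unfolding dihedral_def using s(5,6) p(2) q(2) by (intro exI[of _ p] exI[of _ q]) simp
  then show False using assms by blast
qed

end

section \<open>Translation into the labelled-graph condition, and the final case distinction\<close>

lemma (in group) card_2_iso:
  assumes "card (carrier G) = 2" shows "G \<cong> integer_mod_group 2"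
proof -
  obtain a b where ab: "carrier G = {a, b}" "a \<noteq> b" using assms by (auto simp: card_2_iff)
  then obtain s where s: "carrier G = {\<one>, s}" "s \<noteq> \<one>" using one_closed by fastforce
  then have sc: "s \<in> carrier G" by simp
  have "s \<otimes> s \<noteq> s" using sc s(2) by simp
  moreover have "s \<otimes> s \<in> {\<one>, s}" using sc s(1)[symmetric] by simp
  ultimately have ss: "s \<otimes> s = \<one>" by blast
  define h where "h x = (if x = \<one> then 0 else 1 :: int)" for x
  have "h \<in> iso G (integer_mod_group 2)"
    unfolding iso_def hom_def
  proof (intro CollectI conjI ballI)
    have c: "carrier (integer_mod_group 2) = {0, 1}" by (auto simp: carrier_integer_mod_group)
    show "h \<in> carrier G \<rightarrow> carrier (integer_mod_group 2)" unfolding c by (auto simp: h_def)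
    show "bij_betw h (carrier G) (carrier (integer_mod_group 2))"
      unfolding c s(1) using s(2) by (auto simp: bij_betw_def h_def)
    show "h (x \<otimes> y) = h x \<otimes>\<^bsub>integer_mod_group 2\<^esub> h y" if "x \<in> carrier G" "y \<in> carrier G" for x y
      using that sc s ss by (auto simp: h_def)
  qed
  then show ?thesis by (auto simp: is_iso_def)
qed

lemma (in finite_graph_of_groups) dihedral_iff:
  assumes \<Gamma>1: "\<Gamma>1 = full_subgraph \<Gamma> {v \<in> verts \<Gamma>. \<forall>w\<in>verts \<Gamma>. w \<noteq> v \<longrightarrow> {v, w} \<in> edges \<Gamma>}"
    and \<Gamma>2: "\<Gamma>2 = full_subgraph \<Gamma> (verts \<Gamma> - verts \<Gamma>1)"
  shows "labelled_graph_iso \<Gamma>2 G two_points (\<lambda>_. integer_mod_group 2) \<longleftrightarrow> dihedral"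
proof -
  let ?Y = "V - {v \<in> V. \<forall>w\<in>V. w \<noteq> v \<longrightarrow> {v, w} \<in> E}"
  have V2: "verts \<Gamma>2 = ?Y" "edges \<Gamma>2 = {e \<in> E. e \<subseteq> ?Y}"
    unfolding \<Gamma>2 \<Gamma>1 full_subgraph_def by auto
  show ?thesis
  proof
    assume "labelled_graph_iso \<Gamma>2 G two_points (\<lambda>_. integer_mod_group 2)"
    then obtain f :: "'v \<Rightarrow> nat" where f: "bij_betw f ?Y {0, 1}"
      "\<forall>u\<in>?Y. \<forall>v\<in>?Y. {u, v} \<notin> edges \<Gamma>2"
      "\<forall>v\<in>?Y. G v \<cong> integer_mod_group 2"
      unfolding labelled_graph_iso_def two_points_def V2(1) by auto
    have "card ?Y = 2" using bij_betw_same_card[OF f(1)] by simp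
    then obtain p q where pq: "?Y = {p, q}" "p \<noteq> q" by (auto simp: card_2_iff)
    have card: "card (carrier (G v)) = 2" if "v \<in> ?Y" for v
    proof -
      have "G v \<cong> integer_mod_group 2" using f(3) that by (rule bspec)
      then obtain h where "h \<in> iso (G v) (integer_mod_group 2)" unfolding is_iso_def by blast
      then have "bij_betw h (carrier (G v)) (carrier (integer_mod_group 2))" by (simp add: iso_def)
      then show ?thesis using bij_betw_same_card by (fastforce simp: carrier_integer_mod_group)
    qed
    have "{p, q} \<notin> E" using f(2) pq V2(2) by auto
    then show dihedral unfolding dihedral_def using pq card by blast
  next
    assume dihedral
    then obtain p q where pq: "p \<noteq> q" "?Y = {p, q}" "{p, q} \<notin> E"
      "card (carrier (G p)) = 2" "card (carrier (G q)) = 2"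
      unfolding dihedral_def by blast
    have V: "p \<in> V" "q \<in> V" using pq(2) by blast+
    have "G p \<cong> integer_mod_group 2" "G q \<cong> integer_mod_group 2"
      using group.card_2_iso[OF groups] V pq by auto
    moreover have "{u, v} \<notin> edges \<Gamma>2" if "u \<in> {p, q}" "v \<in> {p, q}" for u v
      using that pq(3) edge_verts[of u v] unfolding V2(2) by (auto simp: insert_commute)
    moreover have "bij_betw (\<lambda>v. if v = p then 0 else 1 :: nat) {p, q} {0, 1}"
      using pq(1) by (auto simp: bij_betw_def)
    ultimately show "labelled_graph_iso \<Gamma>2 G two_points (\<lambda>_. integer_mod_group 2)"
      unfolding labelled_graph_iso_def two_points_def V2(1) pq(2)
      by (intro exI[of _ "\<lambda>v. if v = p then 0 else 1 :: nat"]) auto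
  qed
qed

theorem corollaryC:
  fixes \<Gamma> \<Gamma>1 \<Gamma>2 :: "'v graph"
    and G :: "'v \<Rightarrow> ('a, 'b) monoid_scheme"
  assumes "simplicial_graph \<Gamma>"
    and "finite (verts \<Gamma>)"
    and "\<And>v. v \<in> verts \<Gamma> \<Longrightarrow> group (G v)"
    and "\<And>v. v \<in> verts \<Gamma> \<Longrightarrow> finite (carrier (G v))"
    and "\<And>v. v \<in> verts \<Gamma> \<Longrightarrow> \<not> trivial_group (G v)"
    and "\<Gamma>1 = full_subgraph \<Gamma> {v \<in> verts \<Gamma>. \<forall>w\<in>verts \<Gamma>. w \<noteq> v \<longrightarrow> {v, w} \<in> edges \<Gamma>}"
    and "\<Gamma>2 = full_subgraph \<Gamma> (verts \<Gamma> - verts \<Gamma>1)"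
  shows "\<Gamma> = graph_join \<Gamma>1 \<Gamma>2 \<and>
    (ends (graph_product \<Gamma> G) = 0 \<longleftrightarrow> complete_graph \<Gamma>) \<and>
    (ends (graph_product \<Gamma> G) = 1 \<longleftrightarrow>
       connected_graph \<Gamma> \<and> \<not> complete_graph \<Gamma> \<and>
       \<not> (\<exists>\<Delta>. complete_graph \<Delta> \<and> separating_subgraph \<Delta> \<Gamma>)) \<and>
    (ends (graph_product \<Gamma> G) = 2 \<longleftrightarrow>
       labelled_graph_iso \<Gamma>2 G two_points (\<lambda>_. integer_mod_group 2)) \<and>
    (ends (graph_product \<Gamma> G) = \<infinity> \<longleftrightarrow>
       (\<exists>\<Delta>. complete_graph \<Delta> \<and> separating_subgraph \<Delta> \<Gamma>) \<and>
       \<not> labelled_graph_iso \<Gamma>2 G two_points (\<lambda>_. integer_mod_group 2))"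
proof -
  interpret finite_graph_of_groups \<Gamma> G
    by (intro finite_graph_of_groups.intro graph_of_groups.intro group_family.intro
        graph_of_groups_axioms.intro finite_graph_of_groups_axioms.intro) (simp_all add: assms(1-5))
  have join: "\<Gamma> = graph_join \<Gamma>1 \<Gamma>2"
  proof -
    let ?X = "{v \<in> V. \<forall>w\<in>V. w \<noteq> v \<longrightarrow> {v, w} \<in> E}"
    have v1: "verts \<Gamma>1 = ?X" "edges \<Gamma>1 = {e \<in> E. e \<subseteq> ?X}"
      unfolding assms(6) full_subgraph_def by auto
    have v2: "verts \<Gamma>2 = V - ?X" "edges \<Gamma>2 = {e \<in> E. e \<subseteq> V - ?X}"
      unfolding assms(7) v1 full_subgraph_def by auto
    have "E \<subseteq> {e \<in> E. e \<subseteq> ?X} \<union> {e \<in> E. e \<subseteq> V - ?X} \<union> {{u, v} |u v. u \<in> ?X \<and> v \<in> V - ?X}"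
    proof
      fix e assume e: "e \<in> E"
      then obtain u v where uv: "e = {u, v}" "u \<in> V" "v \<in> V"
        using simplicial by (auto simp: simplicial_graph_def card_2_iff)
      consider "u \<in> ?X" "v \<in> ?X" | "u \<notin> ?X" "v \<notin> ?X" | "u \<in> ?X" "v \<notin> ?X" | "v \<in> ?X" "u \<notin> ?X"
        by blast
      then show "e \<in> {e \<in> E. e \<subseteq> ?X} \<union> {e \<in> E. e \<subseteq> V - ?X} \<union> {{u, v} |u v. u \<in> ?X \<and> v \<in> V - ?X}"
      proof cases
        case 4
        have "e = {v, u}" using uv by (simp add: insert_commute)
        then show ?thesis using 4 uv by blast
      qed (use e uv in blast)+
    qed
    moreover have "{u, v} \<in> E" if "u \<in> ?X" "v \<in> V - ?X" for u v
    proof -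
      have "v \<noteq> u" using that by blast
      then show ?thesis using that by simp
    qed
    then have "{{u, v} |u v. u \<in> ?X \<and> v \<in> V - ?X} \<subseteq> E" by blast
    ultimately have "E = {e \<in> E. e \<subseteq> ?X} \<union> {e \<in> E. e \<subseteq> V - ?X} \<union> {{u, v} |u v. u \<in> ?X \<and> v \<in> V - ?X}"
      by blast
    moreover have "V = ?X \<union> (V - ?X)" by blast
    ultimately show ?thesis
      unfolding graph_join_def v1 v2 by (metis (no_types, lifting) prod.collapse)
  qed
  have complete: "\<not> (\<exists>X P Q. splitting X P Q)" if "clique V"
  proof clarify
    fix X P Q assume split: "splitting X P Q"
    then obtain p q where "p \<in> P" "q \<in> Q" unfolding splitting_def by blast
    moreover from this split have "p \<in> V" "q \<in> V" "p \<noteq> q" "{p, q} \<notin> E" unfolding splitting_def by blast+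
    ultimately show False using that unfolding clique_def by blast
  qed
  have gp: "graph_product \<Gamma> G = GP" by (simp add: GP_def)
  let ?S = "\<exists>X P Q. splitting X P Q"
  have conn: "connected_graph \<Gamma>" if "\<not> ?S" using connected_if_nonsplit that by blast
  \<comment> \<open>Four exclusive cases with distinct values of \<open>ends\<close>, so each
    equivalence can be read off case by case.\<close>
  consider "clique V" "\<not> ?S" "\<not> dihedral" "ends GP = 0" | "\<not> clique V" "\<not> ?S" "\<not> dihedral" "ends GP = 1"
    | "\<not> clique V" ?S dihedral "ends GP = 2" | "\<not> clique V" ?S "\<not> dihedral" "ends GP = \<infinity>"
  proof -
    have "\<not> dihedral" if "\<not> ?S" using ends_dihedral that by blast
    moreover have "ends GP = 1" if "\<not> clique V" "\<not> ?S"
      by (rule ends_nonsplit) (use that in blast)+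
    moreover have "ends GP = \<infinity>" if ?S "\<not> dihedral" using ends_split that by blast
    moreover have "ends GP = 2" if dihedral using ends_dihedral that by blast
    ultimately show thesis using that complete ends_complete by argo
  qed
  then show ?thesis
    unfolding gp complete_graph_iff splitting_iff dihedral_iff[OF assms(6,7)]
    using join conn by cases simp_all
qed

end
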